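(* Assume the setup below, and suppose there exist constants $C''>0$ and $\tau>\tfrac32$ such that $\max_{n\in\{0,1\}}a(m,n)\le C''|m|^{-\tau}$ for all $m\in\mathbb Z\setminus\{0\}$. Then for $\mu$-almost every $\omega\in\Omega$, the operator $J_\omega$ has purely pure point spectrum.
   Context: Setup: $r:\mathbb R\to[0,\infty)$ is bounded, measurable, compactly supported, with $\int_{\mathbb R} r(x)\,dx=1$. $(d_n)_{n\in\mathbb Z}$ is a fixed sequence of positive reals and $r_n(x)=d_n^{-1}r(d_n^{-1}x)$. $c\in\ell^\infty(\mathbb Z)$ is real. $a\in\ell^\infty(\mathbb Z)$ is real with $a(n)\ge\delta>0$ for all $n$. $\Omega=\mathbb R^{\mathbb Z}$ and $\mu$ is the product probability measure $d\mu(\omega)=\prod_{n} r_n(\omega(n)-c(n))\,d\omega(n)$. $(J_\omega\phi)(n)=a(n)\phi(n+1)+a(n-1)\phi(n-1)+\omega(n)\phi(n)$ on $\ell^2(\mathbb Z)$. For $m,n\in\mathbb Z$, $a(m,n)=\int_\Omega\sup_{t\in\mathbb R}|\langle\delta_m,e^{-itJ_\omega}\delta_n\rangle|\,d\mu(\omega)$. *)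

theory Defs
  imports "HOL-Probability.Probability"
begin

definition l2 :: "(int \<Rightarrow> complex) set" where
  "l2 = {\<phi>. (\<lambda>n. (cmod (\<phi> n))\<^sup>2) summable_on UNIV}"

definition l2norm :: "(int \<Rightarrow> complex) \<Rightarrow> real" where
  "l2norm \<phi> = sqrt (\<Sum>\<^sub>\<infinity>n. (cmod (\<phi> n))\<^sup>2)"

definition l2inner :: "(int \<Rightarrow> complex) \<Rightarrow> (int \<Rightarrow> complex) \<Rightarrow> complex" where
  "l2inner \<phi> \<psi> = (\<Sum>\<^sub>\<infinity>n. cnj (\<phi> n) * \<psi> n)"

definition kdelta :: "int \<Rightarrow> int \<Rightarrow> complex" where
  "kdelta n = (\<lambda>k. if k = n then 1 else 0)"

text \<open>The Jacobi operator J_omega, acting entrywise (its maximal domain is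
  {phi in l2. J phi in l2}).\<close>
definition jac :: "(int \<Rightarrow> real) \<Rightarrow> (int \<Rightarrow> real) \<Rightarrow> (int \<Rightarrow> complex) \<Rightarrow> int \<Rightarrow> complex" where
  "jac a \<omega> \<phi> n = of_real (a n) * \<phi> (n + 1) + of_real (a (n - 1)) * \<phi> (n - 1)
                   + of_real (\<omega> n) * \<phi> n"

definition schroedinger_sol ::
  "(int \<Rightarrow> real) \<Rightarrow> (int \<Rightarrow> real) \<Rightarrow> (int \<Rightarrow> complex) \<Rightarrow> (real \<Rightarrow> int \<Rightarrow> complex) \<Rightarrow> bool" where
  "schroedinger_sol a \<omega> \<psi>0 \<psi> \<longleftrightarrow> \<psi> 0 = \<psi>0 \<and>
     (\<forall>t. \<psi> t \<in> l2 \<and> jac a \<omega> (\<psi> t) \<in> l2 \<and>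
        ((\<lambda>h. l2norm (\<lambda>n. (\<psi> (t + h) n - \<psi> t n) / of_real h + \<i> * jac a \<omega> (\<psi> t) n))
           \<longlongrightarrow> 0) (at 0))"

text \<open>The unitary evolution: evol a omega psi0 t = exp(-itJ) psi0.\<close>
definition evol :: "(int \<Rightarrow> real) \<Rightarrow> (int \<Rightarrow> real) \<Rightarrow> (int \<Rightarrow> complex) \<Rightarrow> real \<Rightarrow> int \<Rightarrow> complex" where
  "evol a \<omega> \<psi>0 = (THE \<psi>. schroedinger_sol a \<omega> \<psi>0 \<psi>)"

definition mu :: "(real \<Rightarrow> real) \<Rightarrow> (int \<Rightarrow> real) \<Rightarrow> (int \<Rightarrow> real) \<Rightarrow> (int \<Rightarrow> real) measure" where
  "mu r d c = PiM UNIV (\<lambda>n. density lborel (\<lambda>x. ennreal (r ((x - c n) / d n) / d n)))"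

definition amp :: "(real \<Rightarrow> real) \<Rightarrow> (int \<Rightarrow> real) \<Rightarrow> (int \<Rightarrow> real) \<Rightarrow> (int \<Rightarrow> real)
                    \<Rightarrow> int \<Rightarrow> int \<Rightarrow> ennreal" where
  "amp r d c a m n = (\<integral>\<^sup>+ \<omega>. (SUP t. ennreal (cmod (l2inner (kdelta m) (evol a \<omega> (kdelta n) t))))
                         \<partial>mu r d c)"

definition pure_point_spectrum :: "(int \<Rightarrow> real) \<Rightarrow> (int \<Rightarrow> real) \<Rightarrow> bool" where
  "pure_point_spectrum a \<omega> \<longleftrightarrow>
     (\<exists>B. B \<subseteq> l2 \<and>
        (\<forall>\<phi>\<in>B. l2norm \<phi> = 1 \<and> (\<exists>ev::complex. jac a \<omega> \<phi> = (\<lambda>n. ev * \<phi> n))) \<and>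
        (\<forall>\<phi>\<in>B. \<forall>\<psi>\<in>B. \<phi> \<noteq> \<psi> \<longrightarrow> l2inner \<phi> \<psi> = 0) \<and>
        (\<forall>\<psi>\<in>l2. (\<forall>\<phi>\<in>B. l2inner \<phi> \<psi> = 0) \<longrightarrow> \<psi> = (\<lambda>_. 0)))"

end

theory Submission
  imports Defs "HOL-Complex_Analysis.Great_Picard"
begin

text \<open>
  Summing the decay hypothesis over \<open>m\<close> shows that almost surely the orbits of \<open>\<delta>\<^sub>0\<close> and
  \<open>\<delta>\<^sub>1\<close> under \<open>exp (-itJ)\<close> are dominated, uniformly in \<open>t\<close>, by a summable sequence \<open>g\<close>. No
  spectral theorem is used to conclude from this.

  For such an orbit \<open>u\<close>, let \<open>K(m,k)\<close> be a limit of time averages of \<open>u\<^sub>m(t) cnj (u\<^sub>k(t))\<close>. It is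
  a compact Hermitian kernel, and it commutes with \<open>J\<close> entrywise because the average of a
  derivative of a bounded function vanishes. Let \<open>S\<close> be the orthogonal complement of all
  eigenvectors of \<open>J\<close>. If \<open>K\<close> did not vanish on \<open>S\<close>, it would have an eigenvector in \<open>S\<close> with
  nonzero eigenvalue; on that eigenspace \<open>J\<close> is a multiple of the compact Hermitian \<open>JK\<close>, so \<open>J\<close>
  would have an eigenvector in \<open>S\<close>, which is absurd. Hence for \<open>\<psi>\<close> in \<open>S\<close> the average of
  \<open>|\<langle>\<psi>,u(t)\<rangle>|\<^sup>2\<close> vanishes along a sequence of times. The orbit being totally bounded, \<open>u\<close> returns
  close to \<open>u(0)\<close> with positive frequency, and therefore \<open>\<langle>\<psi>,u(t)\<rangle> = 0\<close> for all \<open>t\<close>.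
  Differentiating in \<open>t\<close> propagates this from \<open>\<delta>\<^sub>0\<close>, \<open>\<delta>\<^sub>1\<close> to every \<open>\<delta>\<^sub>n\<close>, so \<open>S = 0\<close>.

  The potential may be unbounded, so the evolution is constructed by a Dyson series in the hopping
  term, with bounds that do not involve the potential.
\<close>

section \<open>Square-summable sequences on the integers\<close>

text \<open>The orbit itself cannot usefully be averaged: a phase \<open>exp (-itE)\<close> averages
  to zero unless \<open>E\<close> is zero. In the product \<open>u t m * cnj (u t k)\<close> the
  phases of equal energies cancel, so that by Wiener's theorem \<open>K\<close> is in effect the
  sum, over the eigenvalues of J, of the rank-one kernels of the projections of \<open>u 0\<close>.
  The argument establishes what is needed of this without spectral measures. The obstacle is that J
  may be unbounded. What unitarity would give is drawn from conservation of the norm, proved for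
  solutions that satisfy the equation only coordinate by coordinate. Applied to differences it gives
  uniqueness; to difference quotients, strong differentiability at every time; to
  \<open>J u\<close>, the bound that makes \<open>J K\<close> compact; to differences of translates,
  the passage from a near return to a return near the start. Boundedness of \<open>a\<close> makes
  the boundary terms vanish. Two adjacent starting sites occur because the eigenvalue equation is a
  recurrence of order two, and a single site need not be cyclic.\<close>

lemma l2I:
  assumes "\<And>F. finite F \<Longrightarrow> (\<Sum>m\<in>F. (cmod (x m))\<^sup>2) \<le> C"
  shows "x \<in> l2"
  unfolding l2_def mem_Collect_eq
  by (rule nonneg_bounded_partial_sums_imp_summable_on[where C=C])
     (auto intro!: eventually_finite_subsets_at_top_weakI assms)

lemma l2norm_nonneg [simp]: "l2norm x \<ge> 0"
  by (auto simp: l2norm_def intro!: infsum_nonneg)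

lemma l2norm_sq: "(l2norm x)\<^sup>2 = (\<Sum>\<^sub>\<infinity>n. (cmod (x n))\<^sup>2)"
  unfolding l2norm_def by (rule real_sqrt_pow2) (auto intro!: infsum_nonneg)

lemma l2_sum_le:
  assumes "x \<in> l2" "finite F"
  shows "(\<Sum>m\<in>F. (cmod (x m))\<^sup>2) \<le> (l2norm x)\<^sup>2"
  unfolding l2norm_sq by (rule finite_sum_le_infsum) (use assms in \<open>auto simp: l2_def\<close>)

lemma l2_L2_set_le:
  assumes "x \<in> l2" "finite F"
  shows "L2_set (\<lambda>m. cmod (x m)) F \<le> l2norm x"
  unfolding L2_set_def using l2_sum_le[OF assms] by (intro real_le_lsqrt) auto

lemma l2norm_leI:
  assumes "\<And>F. finite F \<Longrightarrow> L2_set (\<lambda>m. cmod (x m)) F \<le> C"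
  shows "x \<in> l2" "l2norm x \<le> C"
proof -
  have C: "C \<ge> 0" using assms[of "{}"] by simp
  have le: "(\<Sum>m\<in>F. (cmod (x m))\<^sup>2) \<le> C\<^sup>2" if "finite F" for F
    using assms[OF that] unfolding L2_set_def by (simp add: sqrt_le_D)
  show "x \<in> l2" using le by (rule l2I)
  then have "(l2norm x)\<^sup>2 \<le> C\<^sup>2"
    unfolding l2norm_sq by (intro infsum_le_finite_sums le) (auto simp: l2_def)
  then show "l2norm x \<le> C" using C by (rule power2_le_imp_le)
qed

lemma l2norm_le_sqI:
  assumes "\<And>F. finite F \<Longrightarrow> (\<Sum>m\<in>F. (cmod (x m))\<^sup>2) \<le> C\<^sup>2" "C \<ge> 0"
  shows "x \<in> l2" "l2norm x \<le> C"
proof -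
  have "L2_set (\<lambda>m. cmod (x m)) F \<le> C" if "finite F" for F
    unfolding L2_set_def using assms(1)[OF that] assms(2) by (intro real_le_lsqrt) auto
  from l2norm_leI[OF this] show "x \<in> l2" "l2norm x \<le> C" by auto
qed

lemma l2_coord_le: "x \<in> l2 \<Longrightarrow> cmod (x m) \<le> l2norm x"
  using l2_L2_set_le[of x "{m}"] by simp

lemma l2norm_eq_0D: "x \<in> l2 \<Longrightarrow> l2norm x = 0 \<Longrightarrow> x = (\<lambda>_. 0)"
  using l2_coord_le[of x] by auto

lemma l2_add:
  assumes "x \<in> l2" "y \<in> l2"
  shows "(\<lambda>m. x m + y m) \<in> l2" "l2norm (\<lambda>m. x m + y m) \<le> l2norm x + l2norm y"
proof -
  have "L2_set (\<lambda>m. cmod (x m + y m)) F \<le> l2norm x + l2norm y" if "finite F" for F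
  proof -
    have "L2_set (\<lambda>m. cmod (x m + y m)) F \<le> L2_set (\<lambda>m. cmod (x m) + cmod (y m)) F"
      by (rule L2_set_mono) (auto intro: norm_triangle_ineq)
    also have "\<dots> \<le> L2_set (\<lambda>m. cmod (x m)) F + L2_set (\<lambda>m. cmod (y m)) F"
      by (rule L2_set_triangle_ineq)
    finally show ?thesis using l2_L2_set_le[OF assms(1) that] l2_L2_set_le[OF assms(2) that] by simp
  qed
  from l2norm_leI[OF this]
  show "(\<lambda>m. x m + y m) \<in> l2" "l2norm (\<lambda>m. x m + y m) \<le> l2norm x + l2norm y" by auto
qed

lemma l2norm_scale: "l2norm (\<lambda>m. c * x m) = cmod c * l2norm x"
  unfolding l2norm_def norm_mult power_mult_distrib
  by (simp add: infsum_cmult_right' real_sqrt_mult)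

lemma l2_scale: "x \<in> l2 \<Longrightarrow> (\<lambda>m. c * x m) \<in> l2"
  unfolding l2_def mem_Collect_eq norm_mult power_mult_distrib by (rule summable_on_cmult_right)

lemma l2_cnj [simp]: "(\<lambda>m. cnj (x m)) \<in> l2 \<longleftrightarrow> x \<in> l2"
  by (simp add: l2_def)

lemma l2norm_cnj [simp]: "l2norm (\<lambda>m. cnj (x m)) = l2norm x"
  by (simp add: l2norm_def)

lemma l2_diff:
  assumes "x \<in> l2" "y \<in> l2"
  shows "(\<lambda>m. x m - y m) \<in> l2" "l2norm (\<lambda>m. x m - y m) \<le> l2norm x + l2norm y"
  using l2_add[OF assms(1) l2_scale[OF assms(2), of "-1"]] l2norm_scale[of "-1" y] by auto

lemma kdelta_l2 [simp]: "kdelta n \<in> l2"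
proof -
  have "(\<lambda>m. (cmod (kdelta n m))\<^sup>2) summable_on UNIV \<longleftrightarrow> (\<lambda>m. (cmod (kdelta n m))\<^sup>2) summable_on {n}"
    by (rule summable_on_cong_neutral) (auto simp: kdelta_def)
  then show ?thesis by (simp add: l2_def)
qed

lemma l2inner_kdelta: "l2inner (kdelta m) x = x m"
proof -
  have "l2inner (kdelta m) x = (\<Sum>\<^sub>\<infinity>n\<in>{m}. cnj (kdelta m n) * x n)"
    unfolding l2inner_def by (rule infsum_cong_neutral) (auto simp: kdelta_def)
  then show ?thesis by (simp add: kdelta_def)
qed

lemma l2_mult_summable:
  assumes "x \<in> l2" "y \<in> l2"
  shows "(\<lambda>k. cmod (x k * y k)) summable_on UNIV"
    and "(\<Sum>\<^sub>\<infinity>k. cmod (x k * y k)) \<le> l2norm x * l2norm y"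
    and "(\<lambda>k. x k * y k) summable_on UNIV"
    and "cmod (\<Sum>\<^sub>\<infinity>k. x k * y k) \<le> l2norm x * l2norm y"
proof -
  have le: "(\<Sum>k\<in>F. cmod (x k * y k)) \<le> l2norm x * l2norm y" if "finite F" for F
  proof -
    have "(\<Sum>k\<in>F. cmod (x k * y k)) = (\<Sum>k\<in>F. \<bar>cmod (x k)\<bar> * \<bar>cmod (y k)\<bar>)"
      by (simp add: norm_mult)
    also have "\<dots> \<le> L2_set (\<lambda>m. cmod (x m)) F * L2_set (\<lambda>m. cmod (y m)) F"
      by (rule L2_set_mult_ineq)
    also have "\<dots> \<le> l2norm x * l2norm y"
      by (intro mult_mono l2_L2_set_le assms that) auto
    finally show ?thesis .
  qed
  show s: "(\<lambda>k. cmod (x k * y k)) summable_on UNIV"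
    by (rule nonneg_bounded_partial_sums_imp_summable_on[where C="l2norm x * l2norm y"])
       (auto intro!: eventually_finite_subsets_at_top_weakI le)
  show le': "(\<Sum>\<^sub>\<infinity>k. cmod (x k * y k)) \<le> l2norm x * l2norm y"
    by (intro infsum_le_finite_sums le s)
  show "(\<lambda>k. x k * y k) summable_on UNIV"
    using s by (rule abs_summable_summable)
  show "cmod (\<Sum>\<^sub>\<infinity>k. x k * y k) \<le> l2norm x * l2norm y"
    using norm_infsum_bound[OF s] le' by simp
qed

lemma l2inner_summable:
  assumes "x \<in> l2" "y \<in> l2"
  shows "(\<lambda>k. cnj (x k) * y k) summable_on UNIV"
  using l2_mult_summable(3)[of "\<lambda>k. cnj (x k)" y] assms by simp

lemma l2inner_bound: "x \<in> l2 \<Longrightarrow> y \<in> l2 \<Longrightarrow> cmod (l2inner x y) \<le> l2norm x * l2norm y"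
  using l2_mult_summable(4)[of "\<lambda>k. cnj (x k)" y] by (simp add: l2inner_def)

lemma l2inner_add_right:
  "x \<in> l2 \<Longrightarrow> y \<in> l2 \<Longrightarrow> z \<in> l2 \<Longrightarrow> l2inner x (\<lambda>k. y k + z k) = l2inner x y + l2inner x z"
  unfolding l2inner_def distrib_left by (intro infsum_add l2inner_summable)

lemma l2inner_scale_right: "l2inner x (\<lambda>k. c * y k) = c * l2inner x y"
  unfolding l2inner_def by (simp add: mult.left_commute infsum_cmult_right')

lemma l2inner_scale_left: "l2inner (\<lambda>k. c * x k) y = cnj c * l2inner x y"
  unfolding l2inner_def by (simp add: mult.assoc infsum_cmult_right')

lemma l2inner_commute: "l2inner y x = cnj (l2inner x y)"
  unfolding l2inner_def by (simp flip: infsum_cnj add: mult.commute)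

lemma l2inner_add_left:
  "x \<in> l2 \<Longrightarrow> y \<in> l2 \<Longrightarrow> z \<in> l2 \<Longrightarrow> l2inner (\<lambda>k. y k + z k) x = l2inner y x + l2inner z x"
  by (subst (1 2 3) l2inner_commute) (simp add: l2inner_add_right)

lemma l2inner_self: "x \<in> l2 \<Longrightarrow> l2inner x x = of_real ((l2norm x)\<^sup>2)"
proof -
  assume that: "x \<in> l2"
  have "l2inner x x = (\<Sum>\<^sub>\<infinity>k. complex_of_real ((cmod (x k))\<^sup>2))"
    unfolding l2inner_def complex_norm_square by (simp add: mult.commute)
  also have "\<dots> = of_real (\<Sum>\<^sub>\<infinity>k. (cmod (x k))\<^sup>2)"
    using that by (intro infsumI has_sum_of_real has_sum_infsum) (simp add: l2_def)
  finally show "l2inner x x = of_real ((l2norm x)\<^sup>2)" by (simp add: l2norm_sq)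
qed

lemma infsum_tail_bound:
  fixes f :: "'a \<Rightarrow> complex"
  assumes h: "h summable_on UNIV" and f: "\<And>m. cmod (f m) \<le> h m" and X: "finite X"
  shows "cmod (infsum f UNIV - sum f X) \<le> infsum h UNIV - sum h X"
proof -
  have sm: "(\<lambda>m. cmod (f m)) summable_on A" for A
    by (rule summable_on_comparison_test[OF summable_on_subset_banach[OF h]]) (use f in auto)
  note sm' = abs_summable_summable[OF sm]
  have "infsum h UNIV = sum h X + infsum h (-X)"
    using infsum_Un_disjoint[of h X "-X"] X summable_on_subset_banach[OF h] by simp
  moreover have "infsum f UNIV = sum f X + infsum f (-X)"
    using infsum_Un_disjoint[of f X "-X"] X sm' by simp
  moreover have "cmod (infsum f (-X)) \<le> infsum (\<lambda>m. cmod (f m)) (-X)" by (rule norm_infsum_bound[OF sm])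
  moreover have "infsum (\<lambda>m. cmod (f m)) (-X) \<le> infsum h (-X)"
    by (rule infsum_mono[OF sm summable_on_subset_banach[OF h]]) (use f in auto)
  ultimately show ?thesis by simp
qed

text \<open>Both tails stay below the tail of \<open>h\<close>, so a finite window decides. The
  filter is arbitrary because the lemma serves sequences as well as difference quotients with time
  tending to zero.\<close>

lemma infsum_dominated_tendsto:
  fixes f :: "'b \<Rightarrow> 'a \<Rightarrow> complex"
  assumes lim: "\<And>m. ((\<lambda>j. f j m) \<longlongrightarrow> f0 m) F"
    and dom: "eventually (\<lambda>j. \<forall>m. cmod (f j m) \<le> h m) F"
    and h: "h summable_on UNIV" and F: "F \<noteq> bot"
  shows "((\<lambda>j. infsum (f j) UNIV) \<longlongrightarrow> infsum f0 UNIV) F"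
proof (rule tendstoI)
  fix e :: real assume e: "e > 0"
  have f0: "cmod (f0 m) \<le> h m" for m
    by (rule tendsto_upperbound[OF tendsto_norm[OF lim] _ F]) (use dom in \<open>auto elim: eventually_mono\<close>)
  obtain X where X: "finite X" "dist (sum h X) (infsum h UNIV) \<le> e/4"
    using infsum_finite_approximation[OF h, of "e/4"] e by auto
  have tl: "cmod (infsum g UNIV - sum g X) \<le> e/4" if "\<And>m. cmod (g m) \<le> h m" for g
    using infsum_tail_bound[OF h that X(1)] X(2) unfolding dist_real_def by linarith
  have "((\<lambda>j. sum (f j) X) \<longlongrightarrow> sum f0 X) F" by (rule tendsto_sum) (rule lim)
  then have "eventually (\<lambda>j. dist (sum (f j) X) (sum f0 X) < e/4) F" using e by (intro tendstoD) auto
  with dom show "eventually (\<lambda>j. dist (infsum (f j) UNIV) (infsum f0 UNIV) < e) F"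
  proof eventually_elim
    case (elim j)
    have 1: "cmod (infsum (f j) UNIV - sum (f j) X) \<le> e/4" using elim by (intro tl) auto
    have 2: "cmod (infsum f0 UNIV - sum f0 X) \<le> e/4" by (intro tl f0)
    have "infsum (f j) UNIV - infsum f0 UNIV = (infsum (f j) UNIV - sum (f j) X)
       + ((sum (f j) X - sum f0 X) - (infsum f0 UNIV - sum f0 X))" by simp
    then have "cmod (infsum (f j) UNIV - infsum f0 UNIV) \<le> cmod (infsum (f j) UNIV - sum (f j) X)
       + (cmod (sum (f j) X - sum f0 X) + cmod (infsum f0 UNIV - sum f0 X))"
      by (metis (no_types, lifting) add_left_mono norm_triangle_ineq norm_triangle_ineq4 order_trans)
    then show ?case using 1 2 elim(2) e by (simp add: dist_norm)
  qed
qed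

text \<open>The windows are cofinal among the finite sets. Summation by parts needs intervals, not
  arbitrary finite sets.\<close>

lemma infsum_int_tendsto:
  fixes f :: "int \<Rightarrow> 'a::banach"
  assumes "f summable_on UNIV"
  shows "(\<lambda>N::nat. \<Sum>m\<in>{- int N..int N}. f m) \<longlonglongrightarrow> infsum f UNIV"
proof -
  have "filterlim (\<lambda>N::nat. {- int N..int N}) (finite_subsets_at_top UNIV) sequentially"
    unfolding filterlim_finite_subsets_at_top
  proof (intro allI impI)
    fix X :: "int set" assume X: "finite X \<and> X \<subseteq> UNIV"
    obtain b where b: "\<And>x. x \<in> X \<Longrightarrow> \<bar>x\<bar> \<le> b"
      using X finite_imageI[of X abs] by (meson Max_ge image_eqI)
    have "\<forall>\<^sub>F N in sequentially. N \<ge> nat b" by (rule eventually_ge_at_top)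
    then show "\<forall>\<^sub>F N::nat in sequentially. finite {- int N..int N} \<and> X \<subseteq> {- int N..int N} \<and> {- int N..int N} \<subseteq> UNIV"
      by eventually_elim (use b in fastforce)
  qed
  from filterlim_compose[OF infsum_tendsto[OF assms] this] show ?thesis .
qed

lemma l2_tendsto_zero:
  assumes "x \<in> l2"
  shows "(\<lambda>N::nat. x (int N + c)) \<longlonglongrightarrow> 0" "(\<lambda>N::nat. x (- int N + c)) \<longlonglongrightarrow> 0"
proof -
  have *: "(\<lambda>N. x (g N)) \<longlonglongrightarrow> 0" if g: "inj g" for g :: "nat \<Rightarrow> int"
  proof -
    have "(\<lambda>m. (cmod (x m))\<^sup>2) summable_on range g"
      using assms summable_on_subset_banach unfolding l2_def by blast
    then have "(\<lambda>N. (cmod (x (g N)))\<^sup>2) summable_on UNIV"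
      using summable_on_reindex[OF g, of "\<lambda>m. (cmod (x m))\<^sup>2"] by (simp add: o_def)
    then have "(\<lambda>N. (cmod (x (g N)))\<^sup>2) \<longlonglongrightarrow> 0"
      by (intro summable_LIMSEQ_zero summable_on_imp_summable)
    then have "(\<lambda>N. sqrt ((cmod (x (g N)))\<^sup>2)) \<longlonglongrightarrow> sqrt 0" by (rule tendsto_real_sqrt)
    then show ?thesis by (simp add: tendsto_norm_zero_iff)
  qed
  show "(\<lambda>N::nat. x (int N + c)) \<longlonglongrightarrow> 0" "(\<lambda>N::nat. x (- int N + c)) \<longlonglongrightarrow> 0"
    by (rule *; simp add: inj_def)+
qed

section \<open>Green formula and conservation of the norm\<close>

lemma sum_telescope_int:
  fixes w :: "int \<Rightarrow> 'a::ab_group_add"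
  shows "(\<Sum>k\<in>{- int N..int N}. w k - w (k - 1)) = w (int N) - w (- int N - 1)"
proof (induction N)
  case (Suc N)
  have "{- int (Suc N)..int (Suc N)} = insert (- int N - 1) (insert (int N + 1) {- int N..int N})"
    by auto
  then show ?case using Suc by (simp add: add.commute)
qed simp

lemma jac_add: "jac a \<omega> (\<lambda>m. x m + y m) k = jac a \<omega> x k + jac a \<omega> y k"
  by (simp add: jac_def algebra_simps)

lemma jac_scale: "jac a \<omega> (\<lambda>m. c * x m) k = c * jac a \<omega> x k"
  by (simp add: jac_def algebra_simps)

lemma jac_cnj: "jac a \<omega> (\<lambda>m. cnj (x m)) k = cnj (jac a \<omega> x k)"
  by (simp add: jac_def)

text \<open>The discrete Wronskian, taken without conjugation so that it is constant on pairs of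
  solutions with the same, possibly complex, eigenvalue.\<close>

definition wronski :: "(int \<Rightarrow> real) \<Rightarrow> (int \<Rightarrow> complex) \<Rightarrow> (int \<Rightarrow> complex) \<Rightarrow> int \<Rightarrow> complex" where
  "wronski a x y k = of_real (a k) * (x (k + 1) * y k - x k * y (k + 1))"

lemma jac_wronski:
  "jac a \<omega> x k * y k - x k * jac a \<omega> y k = wronski a x y k - wronski a x y (k - 1)"
  by (simp add: jac_def wronski_def algebra_simps)

lemma wronski_tendsto_zero:
  assumes a: "\<And>n. \<bar>a n\<bar> \<le> B" and x: "x \<in> l2" and y: "y \<in> l2"
  shows "(\<lambda>N. wronski a x y (int N + c)) \<longlonglongrightarrow> 0" "(\<lambda>N. wronski a x y (- int N + c)) \<longlonglongrightarrow> 0"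
proof -
  note lims = l2_tendsto_zero[OF x] l2_tendsto_zero[OF y]
  have *: "(\<lambda>N. of_real (a (g N)) * z N) \<longlonglongrightarrow> 0" if "z \<longlonglongrightarrow> 0" for g :: "nat \<Rightarrow> int" and z :: "nat \<Rightarrow> complex"
  proof (rule tendsto_0_le[OF that])
    show "\<forall>\<^sub>F N in sequentially. norm (of_real (a (g N)) * z N) \<le> norm (z N) * B"
      unfolding norm_mult norm_of_real by (subst mult.commute) (intro always_eventually allI mult_left_mono a norm_ge_zero)
  qed
  have "(\<lambda>N. x (int N + (c + 1)) * y (int N + c) - x (int N + c) * y (int N + (c + 1))) \<longlonglongrightarrow> 0 * 0 - 0 * 0"
    by (intro tendsto_intros lims)
  then show "(\<lambda>N. wronski a x y (int N + c)) \<longlonglongrightarrow> 0"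
    unfolding wronski_def by (intro *) (simp add: add.assoc)
  have "(\<lambda>N. x (- int N + (c + 1)) * y (- int N + c) - x (- int N + c) * y (- int N + (c + 1))) \<longlonglongrightarrow> 0 * 0 - 0 * 0"
    by (intro tendsto_intros lims)
  then show "(\<lambda>N. wronski a x y (- int N + c)) \<longlonglongrightarrow> 0"
    unfolding wronski_def by (intro *) (simp add: algebra_simps)
qed

text \<open>Summation by parts leaves Wronskians at the two ends of a window, and these vanish in
  the limit. The formula holds on the maximal domain: with bounded \<open>a\<close> no boundary
  condition at infinity is called for.\<close>

lemma jac_green:
  assumes a: "\<And>n. \<bar>a n\<bar> \<le> B"
    and x: "x \<in> l2" "jac a \<omega> x \<in> l2" and y: "y \<in> l2" "jac a \<omega> y \<in> l2"
  shows "(\<Sum>\<^sub>\<infinity>k. jac a \<omega> x k * y k) = (\<Sum>\<^sub>\<infinity>k. x k * jac a \<omega> y k)"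
proof -
  have s: "(\<lambda>k. jac a \<omega> x k * y k) summable_on UNIV" "(\<lambda>k. x k * jac a \<omega> y k) summable_on UNIV"
    using l2_mult_summable(3) x y by blast+
  have "(\<lambda>N. (\<Sum>k\<in>{- int N..int N}. jac a \<omega> x k * y k) - (\<Sum>k\<in>{- int N..int N}. x k * jac a \<omega> y k))
     \<longlonglongrightarrow> (\<Sum>\<^sub>\<infinity>k. jac a \<omega> x k * y k) - (\<Sum>\<^sub>\<infinity>k. x k * jac a \<omega> y k)"
    by (intro tendsto_diff infsum_int_tendsto s)
  then have 1: "(\<lambda>N. wronski a x y (int N) - wronski a x y (- int N - 1))
     \<longlonglongrightarrow> (\<Sum>\<^sub>\<infinity>k. jac a \<omega> x k * y k) - (\<Sum>\<^sub>\<infinity>k. x k * jac a \<omega> y k)"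
    by (simp only: sum_subtractf[symmetric] jac_wronski sum_telescope_int)
  have 2: "(\<lambda>N. wronski a x y (int N) - wronski a x y (- int N - 1)) \<longlonglongrightarrow> 0 - 0"
    using wronski_tendsto_zero(1)[OF a x(1) y(1), where c=0] wronski_tendsto_zero(2)[OF a x(1) y(1), where c="-1"]
    by (intro tendsto_diff) simp_all
  show ?thesis using LIMSEQ_unique[OF 1 2] by simp
qed

lemma jac_symmetric:
  assumes a: "\<And>n. \<bar>a n\<bar> \<le> B"
    and x: "x \<in> l2" "jac a \<omega> x \<in> l2" and y: "y \<in> l2" "jac a \<omega> y \<in> l2"
  shows "l2inner (jac a \<omega> x) y = l2inner x (jac a \<omega> y)"
proof -
  have c: "(\<lambda>k. cnj (jac a \<omega> x k)) = jac a \<omega> (\<lambda>k. cnj (x k))" by (simp add: jac_cnj fun_eq_iff)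
  have "jac a \<omega> (\<lambda>k. cnj (x k)) \<in> l2" using x(2) unfolding c[symmetric] by simp
  then show ?thesis
    using jac_green[OF a, where x="\<lambda>k. cnj (x k)" and y=y] x y
    by (simp add: l2inner_def jac_cnj)
qed

text \<open>A coordinatewise solution of the Schroedinger equation whose norm is only required to be
  locally bounded: this class is closed under all the operations needed below, and the norm is
  nevertheless conserved on it.\<close>
definition coord_sol ::
  "(int \<Rightarrow> real) \<Rightarrow> (int \<Rightarrow> real) \<Rightarrow> (real \<Rightarrow> int \<Rightarrow> complex) \<Rightarrow> bool" where
  "coord_sol a \<omega> u \<longleftrightarrow>
     (\<forall>t m. ((\<lambda>s. u s m) has_vector_derivative (- \<i> * jac a \<omega> (u t) m)) (at t)) \<and>
     (\<forall>T. \<exists>C. \<forall>t. \<bar>t\<bar> \<le> T \<longrightarrow> u t \<in> l2 \<and> l2norm (u t) \<le> C)"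

lemma coord_sol_deriv:
  "coord_sol a \<omega> u \<Longrightarrow> ((\<lambda>s. u s m) has_vector_derivative (- \<i> * jac a \<omega> (u t) m)) (at t)"
  by (simp add: coord_sol_def)

lemma coord_sol_l2: "coord_sol a \<omega> u \<Longrightarrow> u t \<in> l2"
  unfolding coord_sol_def by (meson order_refl)

lemma coord_sol_isCont: "coord_sol a \<omega> u \<Longrightarrow> isCont (\<lambda>s. u s m) t"
  using coord_sol_deriv has_vector_derivative_continuous by blast

lemma coord_sol_add:
  assumes "coord_sol a \<omega> u" "coord_sol a \<omega> v"
  shows "coord_sol a \<omega> (\<lambda>t m. u t m + v t m)"
  unfolding coord_sol_def
proof (intro conjI allI)
  fix t m show "((\<lambda>s. u s m + v s m) has_vector_derivative - \<i> * jac a \<omega> (\<lambda>m. u t m + v t m) m) (at t)"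
    unfolding jac_add distrib_left
    by (intro has_vector_derivative_add coord_sol_deriv assms)
next
  fix T
  obtain C D where CD: "\<And>t. \<bar>t\<bar> \<le> T \<Longrightarrow> u t \<in> l2 \<and> l2norm (u t) \<le> C" "\<And>t. \<bar>t\<bar> \<le> T \<Longrightarrow> v t \<in> l2 \<and> l2norm (v t) \<le> D"
    using assms unfolding coord_sol_def by meson
  have "\<forall>t. \<bar>t\<bar> \<le> T \<longrightarrow> (\<lambda>m. u t m + v t m) \<in> l2 \<and> l2norm (\<lambda>m. u t m + v t m) \<le> C + D"
  proof (intro allI impI conjI)
    fix t :: real assume t: "\<bar>t\<bar> \<le> T"
    show "(\<lambda>m. u t m + v t m) \<in> l2" using l2_add(1) CD[OF t] by blast
    show "l2norm (\<lambda>m. u t m + v t m) \<le> C + D" using l2_add(2)[of "u t" "v t"] CD[OF t] by simp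
  qed
  then show "\<exists>C. \<forall>t. \<bar>t\<bar> \<le> T \<longrightarrow> (\<lambda>m. u t m + v t m) \<in> l2 \<and> l2norm (\<lambda>m. u t m + v t m) \<le> C" by (rule exI)
qed

lemma coord_sol_scale:
  assumes "coord_sol a \<omega> u"
  shows "coord_sol a \<omega> (\<lambda>t m. c * u t m)"
  unfolding coord_sol_def
proof (intro conjI allI)
  fix t m
  have "((\<lambda>s. c * u s m) has_vector_derivative c * (- \<i> * jac a \<omega> (u t) m)) (at t)"
    by (intro has_vector_derivative_mult_right coord_sol_deriv assms)
  then show "((\<lambda>s. c * u s m) has_vector_derivative - \<i> * jac a \<omega> (\<lambda>m. c * u t m) m) (at t)"
    by (simp add: jac_scale mult.left_commute)
next
  fix T
  obtain C where "\<And>t. \<bar>t\<bar> \<le> T \<Longrightarrow> u t \<in> l2 \<and> l2norm (u t) \<le> C" using assms unfolding coord_sol_def by meson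
  then have "\<forall>t. \<bar>t\<bar> \<le> T \<longrightarrow> (\<lambda>m. c * u t m) \<in> l2 \<and> l2norm (\<lambda>m. c * u t m) \<le> cmod c * C"
    by (auto simp: l2norm_scale l2_scale mult_left_mono)
  then show "\<exists>C. \<forall>t. \<bar>t\<bar> \<le> T \<longrightarrow> (\<lambda>m. c * u t m) \<in> l2 \<and> l2norm (\<lambda>m. c * u t m) \<le> C" by (rule exI)
qed

lemma coord_sol_diff:
  assumes "coord_sol a \<omega> u" "coord_sol a \<omega> v"
  shows "coord_sol a \<omega> (\<lambda>t m. u t m - v t m)"
  using coord_sol_add[OF assms(1) coord_sol_scale[OF assms(2), of "-1"]] by simp

lemma coord_sol_shift:
  assumes "coord_sol a \<omega> u"
  shows "coord_sol a \<omega> (\<lambda>t. u (t + h))"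
  unfolding coord_sol_def
proof (intro conjI allI)
  fix t m
  have sh: "((\<lambda>s. s + h) has_vector_derivative 1) (at t)"
    by (auto intro!: derivative_eq_intros simp flip: has_real_derivative_iff_has_vector_derivative)
  have "((\<lambda>s. u s m) \<circ> (\<lambda>s. s + h) has_vector_derivative 1 *\<^sub>R (- \<i> * jac a \<omega> (u (t + h)) m)) (at t)"
    by (rule vector_diff_chain_at[OF sh coord_sol_deriv[OF assms]])
  then show "((\<lambda>s. u (s + h) m) has_vector_derivative - \<i> * jac a \<omega> (u (t + h)) m) (at t)"
    by (simp add: o_def)
next
  fix T
  obtain C where "\<And>t. \<bar>t\<bar> \<le> T + \<bar>h\<bar> \<Longrightarrow> u t \<in> l2 \<and> l2norm (u t) \<le> C" using assms unfolding coord_sol_def by meson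
  then have "\<forall>t. \<bar>t\<bar> \<le> T \<longrightarrow> u (t + h) \<in> l2 \<and> l2norm (u (t + h)) \<le> C"
    by simp
  then show "\<exists>C. \<forall>t. \<bar>t\<bar> \<le> T \<longrightarrow> u (t + h) \<in> l2 \<and> l2norm (u (t + h)) \<le> C" by (rule exI)
qed

text \<open>With a nonzero limit the partial sums would grow linearly. This is how a bound on the
  total over all windows becomes an exact conservation law.\<close>

lemma bounded_partial_sums_limit_zero:
  fixes x :: "nat \<Rightarrow> real"
  assumes lim: "x \<longlonglongrightarrow> D" and bd: "\<And>M. \<bar>\<Sum>N<M. x N\<bar> \<le> C"
  shows "D = 0"
proof (rule ccontr)
  assume D: "D \<noteq> 0"
  then obtain N0 where N0: "\<And>N. N \<ge> N0 \<Longrightarrow> \<bar>x N - D\<bar> < \<bar>D\<bar> / 2"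
    using LIMSEQ_D[OF lim, of "\<bar>D\<bar> / 2"] by auto
  have le: "real k * \<bar>D\<bar> / 2 \<le> 2 * C" for k
  proof -
    have "(\<Sum>N<N0 + k. x N) - (\<Sum>N<N0. x N) = sum x {N0..<N0 + k}"
      by (simp add: lessThan_atLeast0 sum_diff_nat_ivl)
    then have "(\<Sum>N<N0 + k. x N) - (\<Sum>N<N0. x N) - real k * D = (\<Sum>N\<in>{N0..<N0 + k}. x N - D)"
      by (simp add: sum_subtractf)
    moreover have "\<bar>\<Sum>N\<in>{N0..<N0 + k}. x N - D\<bar> \<le> (\<Sum>N\<in>{N0..<N0 + k}. \<bar>D\<bar> / 2)"
      by (rule order_trans[OF sum_abs sum_mono]) (use N0 in force)
    ultimately have "\<bar>(\<Sum>N<N0 + k. x N) - (\<Sum>N<N0. x N) - real k * D\<bar> \<le> real k * \<bar>D\<bar> / 2" by simp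
    moreover have "\<bar>real k * D\<bar> = real k * \<bar>D\<bar>" by (simp add: abs_mult)
    ultimately show ?thesis using bd[of "N0 + k"] bd[of N0] by linarith
  qed
  obtain k where "real k > 4 * C / \<bar>D\<bar>" using reals_Archimedean2 by blast
  then have "real k * \<bar>D\<bar> > 4 * C" using D by (simp add: divide_less_eq)
  then show False using le[of k] by simp
qed

text \<open>The mass in a window changes only by the current through its two ends. At a single end
  this need not be small uniformly in time, but the currents through the ends of all windows
  together are controlled by the squared norm. The changes of mass in the windows therefore have
  bounded partial sums, while they converge to the change of the total mass.\<close>

lemma coord_sol_norm_const:
  assumes a: "\<And>n. \<bar>a n\<bar> \<le> B" and u: "coord_sol a \<omega> u"
  shows "l2norm (u t) = l2norm (u 0)"
proof -
  have B: "B \<ge> 0" using a[of 0] by linarith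
  obtain C where C: "\<And>s. \<bar>s\<bar> \<le> \<bar>t\<bar> \<Longrightarrow> u s \<in> l2 \<and> l2norm (u s) \<le> C"
    using u unfolding coord_sol_def by meson
  \<comment> \<open>Half the rate at which mass passes from site \<open>m + 1\<close> to site
    \<open>m\<close>.\<close>
  define fl where "fl s m = a m * Im (cnj (u s m) * u s (m + 1))" for s m
  define S where "S N s = (\<Sum>m\<in>{- int N..int N}. (cmod (u s m))\<^sup>2)" for N :: nat and s
  have d1: "((\<lambda>s. (cmod (u s m))\<^sup>2) has_real_derivative 2 * (fl s m - fl s (m - 1))) (at s)" for s m
  proof -
    let ?d = "- \<i> * jac a \<omega> (u s) m"
    have r: "((\<lambda>s. Re (u s m)) has_real_derivative Re ?d) (at s)"
      using bounded_linear.has_vector_derivative[OF bounded_linear_Re coord_sol_deriv[OF u]]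
      by (simp add: has_real_derivative_iff_has_vector_derivative)
    have i: "((\<lambda>s. Im (u s m)) has_real_derivative Im ?d) (at s)"
      using bounded_linear.has_vector_derivative[OF bounded_linear_Im coord_sol_deriv[OF u]]
      by (simp add: has_real_derivative_iff_has_vector_derivative)
    have "((\<lambda>s. (Re (u s m))\<^sup>2 + (Im (u s m))\<^sup>2) has_real_derivative
        2 * (Re (u s m) * Re ?d + Im (u s m) * Im ?d)) (at s)"
      by (rule derivative_eq_intros r i refl | simp add: algebra_simps)+
    moreover have "2 * (Re (u s m) * Re ?d + Im (u s m) * Im ?d) = 2 * (fl s m - fl s (m - 1))"
      by (simp add: fl_def jac_def algebra_simps)
    ultimately show ?thesis by (simp add: cmod_power2)
  qed
  have d2: "((\<lambda>s. S N s) has_real_derivative 2 * (fl s (int N) - fl s (- int N - 1))) (at s)" for s N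
    unfolding S_def
    by (rule DERIV_cong[OF DERIV_sum[OF d1]]) (simp only: sum_distrib_left[symmetric] sum_telescope_int)
  have d3: "((\<lambda>s. \<Sum>N<M. S N s) has_real_derivative (\<Sum>N<M. 2 * (fl s (int N) - fl s (- int N - 1)))) (at s)" for s M
    by (rule DERIV_sum[OF d2])
  \<comment> \<open>An injective \<open>g\<close> meets each site at most once, and so does its
    shift by one; hence the bound does not depend on \<open>M\<close>.\<close>
  have flb: "(\<Sum>N<M. \<bar>fl s (g N)\<bar>) \<le> B * C\<^sup>2" if s: "\<bar>s\<bar> \<le> \<bar>t\<bar>" and g: "inj g" for s M and g :: "nat \<Rightarrow> int"
  proof -
    have q: "(\<Sum>N<M. (cmod (u s (g' N)))\<^sup>2) \<le> C\<^sup>2" if "inj g'" for g' :: "nat \<Rightarrow> int"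
    proof -
      have "(\<Sum>N<M. (cmod (u s (g' N)))\<^sup>2) = (\<Sum>m\<in>g' ` {..<M}. (cmod (u s m))\<^sup>2)"
        using that by (subst sum.reindex) (auto intro: inj_on_subset)
      also have "\<dots> \<le> (l2norm (u s))\<^sup>2" using C[OF s] by (intro l2_sum_le) auto
      also have "\<dots> \<le> C\<^sup>2" using C[OF s] by (intro power_mono) auto
      finally show ?thesis .
    qed
    have b: "\<bar>fl s m\<bar> \<le> B * ((cmod (u s m))\<^sup>2 + (cmod (u s (m + 1)))\<^sup>2) / 2" for m
    proof -
      have "\<bar>Im (cnj (u s m) * u s (m + 1))\<bar> \<le> cmod (u s m) * cmod (u s (m + 1))"
        using abs_Im_le_cmod[of "cnj (u s m) * u s (m + 1)"] by (simp add: norm_mult)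
      also have "\<dots> \<le> ((cmod (u s m))\<^sup>2 + (cmod (u s (m + 1)))\<^sup>2) / 2"
        using sum_squares_bound[of "cmod (u s m)" "cmod (u s (m + 1))"] by simp
      finally have "\<bar>a m\<bar> * \<bar>Im (cnj (u s m) * u s (m + 1))\<bar> \<le> B * (((cmod (u s m))\<^sup>2 + (cmod (u s (m + 1)))\<^sup>2) / 2)"
        using a B by (intro mult_mono) auto
      then show ?thesis by (simp add: fl_def abs_mult)
    qed
    have "(\<Sum>N<M. \<bar>fl s (g N)\<bar>) \<le> (\<Sum>N<M. B * ((cmod (u s (g N)))\<^sup>2 + (cmod (u s (g N + 1)))\<^sup>2) / 2)"
      by (intro sum_mono b)
    also have "\<dots> = B * ((\<Sum>N<M. (cmod (u s (g N)))\<^sup>2) + (\<Sum>N<M. (cmod (u s (g N + 1)))\<^sup>2)) / 2"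
      by (simp add: sum_distrib_left sum.distrib[symmetric] sum_divide_distrib)
    also have "\<dots> \<le> B * (C\<^sup>2 + C\<^sup>2) / 2"
      using g by (intro divide_right_mono mult_left_mono add_mono q B) (auto simp: inj_def)
    finally show ?thesis by simp
  qed
  have bd: "\<bar>\<Sum>N<M. 2 * (fl s (int N) - fl s (- int N - 1))\<bar> \<le> 4 * B * C\<^sup>2" if s: "\<bar>s\<bar> \<le> \<bar>t\<bar>" for s M
  proof -
    have tr: "\<bar>2 * (p - q)\<bar> \<le> 2 * \<bar>p\<bar> + 2 * \<bar>q\<bar>" for p q :: real
      unfolding abs_mult using abs_triangle_ineq4[of p q] by simp
    have "\<bar>\<Sum>N<M. 2 * (fl s (int N) - fl s (- int N - 1))\<bar> \<le> (\<Sum>N<M. 2 * \<bar>fl s (int N)\<bar> + 2 * \<bar>fl s (- int N - 1)\<bar>)"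
      by (rule order_trans[OF sum_abs sum_mono]) (rule tr)
    also have "\<dots> = 2 * (\<Sum>N<M. \<bar>fl s (int N)\<bar>) + 2 * (\<Sum>N<M. \<bar>fl s (- int N - 1)\<bar>)"
      by (simp add: sum.distrib sum_distrib_left)
    also have "\<dots> \<le> 2 * (B * C\<^sup>2) + 2 * (B * C\<^sup>2)"
      using flb[OF s, of int M] flb[OF s, of "\<lambda>N. - int N - 1" M] by (auto simp: inj_def)
    finally show ?thesis by simp
  qed
  have "\<bar>\<Sum>N<M. S N t - S N 0\<bar> \<le> 4 * B * C\<^sup>2 * \<bar>t\<bar>" for M
  proof -
    have "norm ((\<Sum>N<M. S N t) - (\<Sum>N<M. S N 0)) \<le> 4 * B * C\<^sup>2 * norm (t - 0)"
    proof (rule field_differentiable_bound[where S="{-\<bar>t\<bar>..\<bar>t\<bar>}"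
            and f'="\<lambda>s. \<Sum>N<M. 2 * (fl s (int N) - fl s (- int N - 1))"])
      fix s assume "s \<in> {-\<bar>t\<bar>..\<bar>t\<bar>}"
      then have "\<bar>s\<bar> \<le> \<bar>t\<bar>" by auto
      then show "norm (\<Sum>N<M. 2 * (fl s (int N) - fl s (- int N - 1))) \<le> 4 * B * C\<^sup>2"
        unfolding real_norm_def by (rule bd)
    qed ((rule has_field_derivative_at_within[OF d3] | simp)+, auto)
    then show ?thesis by (simp add: sum_subtractf)
  qed
  moreover have "(\<lambda>N. S N t - S N 0) \<longlonglongrightarrow> (l2norm (u t))\<^sup>2 - (l2norm (u 0))\<^sup>2"
    unfolding S_def l2norm_sq using coord_sol_l2[OF u]
    by (intro tendsto_diff infsum_int_tendsto) (auto simp: l2_def)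
  ultimately have "(l2norm (u t))\<^sup>2 - (l2norm (u 0))\<^sup>2 = 0"
    by (intro bounded_partial_sums_limit_zero)
  then show ?thesis by (simp add: power2_eq_iff_nonneg)
qed

lemma coord_sol_unique:
  assumes a: "\<And>n. \<bar>a n\<bar> \<le> B" and "coord_sol a \<omega> u" "coord_sol a \<omega> v" "u 0 = v 0"
  shows "u = v"
proof (intro ext)
  fix t m
  have s: "coord_sol a \<omega> (\<lambda>t m. u t m - v t m)" using assms by (intro coord_sol_diff)
  have "l2norm (\<lambda>m. u t m - v t m) = 0" using coord_sol_norm_const[OF a s, of t] assms(4) by (simp add: l2norm_def)
  then have "(\<lambda>m. u t m - v t m) = (\<lambda>_. 0)"
    using coord_sol_l2[OF s] by (rule l2norm_eq_0D[rotated])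
  then show "u t m = v t m" by (meson eq_iff_diff_eq_0)
qed

text \<open>The strong derivative forces the norm to be continuous in time, hence bounded on compact
  intervals. This places every candidate for \<open>evol\<close> in the class in which solutions are
  unique.\<close>

lemma schroedinger_sol_coord_sol:
  assumes "schroedinger_sol a \<omega> \<psi>0 \<psi>"
  shows "coord_sol a \<omega> \<psi>"
proof -
  define q where "q t h = (\<lambda>n. (\<psi> (t + h) n - \<psi> t n) / of_real h + \<i> * jac a \<omega> (\<psi> t) n)" for t h
  have l: "\<psi> t \<in> l2" "jac a \<omega> (\<psi> t) \<in> l2" and lim: "((\<lambda>h. l2norm (q t h)) \<longlongrightarrow> 0) (at 0)" for t
    using assms unfolding schroedinger_sol_def q_def by auto
  have q: "q t h \<in> l2" for t h
    using l2_add(1)[OF l2_scale[OF l2_diff(1)[OF l(1)[of "t+h"] l(1)[of t]], of "1 / of_real h"] l2_scale[OF l(2)[of t], of \<i>]]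
    by (simp add: q_def)
  have der: "((\<lambda>s. \<psi> s m) has_vector_derivative (- \<i> * jac a \<omega> (\<psi> t) m)) (at t)" for t m
  proof -
    have "((\<lambda>h. q t h m) \<longlongrightarrow> 0) (at 0)"
      by (rule tendsto_0_le[OF lim[of t], where K=1]) (use l2_coord_le[OF q] in auto)
    then have lim0: "((\<lambda>h. norm (q t h m)) \<longlongrightarrow> 0) (at 0)" by (rule tendsto_norm_zero)
    have ev: "\<forall>\<^sub>F h in at 0. norm (q t h m) = norm (\<psi> (t + h) m - \<psi> t m - h *\<^sub>R (- \<i> * jac a \<omega> (\<psi> t) m)) / norm h"
    proof (rule eventually_mono[OF eventually_neq_at_within[of 0]])
      fix h :: real assume "h \<noteq> 0"
      then have "q t h m = (\<psi> (t + h) m - \<psi> t m - h *\<^sub>R (- \<i> * jac a \<omega> (\<psi> t) m)) / of_real h"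
        by (simp add: q_def field_simps scaleR_conv_of_real)
      then show "norm (q t h m) = norm (\<psi> (t + h) m - \<psi> t m - h *\<^sub>R (- \<i> * jac a \<omega> (\<psi> t) m)) / norm h"
        by (simp add: norm_divide)
    qed
    show ?thesis
      unfolding has_vector_derivative_def has_derivative_at
      by (intro conjI bounded_linear_scaleR_left Lim_transform_eventually[OF lim0 ev])
  qed
  have cont: "isCont (\<lambda>t. l2norm (\<psi> t)) t" for t
    unfolding isCont_iff
  proof (rule LIM_zero_cancel)
    have "((\<lambda>h. \<bar>h\<bar> * (l2norm (q t h) + l2norm (jac a \<omega> (\<psi> t)))) \<longlongrightarrow> 0 * (0 + l2norm (jac a \<omega> (\<psi> t)))) (at 0)"
      by (intro tendsto_intros lim tendsto_rabs_zero)
    then have lim0: "((\<lambda>h. \<bar>h\<bar> * (l2norm (q t h) + l2norm (jac a \<omega> (\<psi> t)))) \<longlongrightarrow> 0) (at 0)" by simp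
    show "((\<lambda>h. l2norm (\<psi> (t + h)) - l2norm (\<psi> t)) \<longlongrightarrow> 0) (at 0)"
    proof (rule tendsto_0_le[OF lim0, where K=1], rule eventually_mono[OF eventually_neq_at_within[of 0]])
      fix h :: real assume h: "h \<noteq> 0"
      define d where "d = (\<lambda>n. of_real h * (q t h n - \<i> * jac a \<omega> (\<psi> t) n))"
      have d: "d \<in> l2" "l2norm d \<le> \<bar>h\<bar> * (l2norm (q t h) + l2norm (jac a \<omega> (\<psi> t)))"
        using l2_diff[OF q[of t h] l2_scale[OF l(2)[of t], of \<i>]]
        by (auto simp: d_def l2norm_scale l2_scale mult_left_mono)
      have p: "\<psi> (t + h) = (\<lambda>n. \<psi> t n + d n)" "\<psi> t = (\<lambda>n. \<psi> (t + h) n - d n)"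
        using h by (auto simp: d_def q_def)
      have "l2norm (\<psi> (t + h)) \<le> l2norm (\<psi> t) + l2norm d" "l2norm (\<psi> t) \<le> l2norm (\<psi> (t + h)) + l2norm d"
        using l2_add(2)[OF l(1)[of t] d(1)] l2_diff(2)[OF l(1)[of "t + h"] d(1)] p by metis+
      then have "\<bar>l2norm (\<psi> (t + h)) - l2norm (\<psi> t)\<bar> \<le> \<bar>h\<bar> * (l2norm (q t h) + l2norm (jac a \<omega> (\<psi> t)))"
        using d(2) by linarith
      then show "norm (l2norm (\<psi> (t + h)) - l2norm (\<psi> t)) \<le> norm (\<bar>h\<bar> * (l2norm (q t h) + l2norm (jac a \<omega> (\<psi> t)))) * 1"
        by (simp add: abs_mult)
    qed
  qed
  show ?thesis unfolding coord_sol_def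
  proof (intro conjI allI der)
    fix T :: real
    have "compact ((\<lambda>t. l2norm (\<psi> t)) ` {-T..T})"
      by (intro compact_continuous_image continuous_at_imp_continuous_on ballI cont) auto
    then obtain C where C: "\<And>t. t \<in> {-T..T} \<Longrightarrow> norm (l2norm (\<psi> t)) \<le> C"
      using compact_imp_bounded bounded_iff by (metis imageI)
    have "\<psi> t \<in> l2 \<and> l2norm (\<psi> t) \<le> C" if "\<bar>t\<bar> \<le> T" for t
      using C[of t] that l(1) by (auto simp: abs_le_iff)
    then show "\<exists>C. \<forall>t. \<bar>t\<bar> \<le> T \<longrightarrow> \<psi> t \<in> l2 \<and> l2norm (\<psi> t) \<le> C" by blast
  qed
qed

section \<open>Construction of the evolution\<close>

definition hop :: "(int \<Rightarrow> real) \<Rightarrow> (int \<Rightarrow> complex) \<Rightarrow> int \<Rightarrow> complex" where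
  "hop a x m = of_real (a m) * x (m + 1) + of_real (a (m - 1)) * x (m - 1)"

lemma jac_hop: "jac a \<omega> x m = hop a x m + of_real (\<omega> m) * x m"
  by (simp add: jac_def hop_def)

text \<open>The terms of the Dyson series, the hopping part being the perturbation. Since the potential
  enters only through unimodular factors, the series converges for arbitrary unbounded potentials.\<close>
primrec dyson :: "(int \<Rightarrow> real) \<Rightarrow> int \<Rightarrow> nat \<Rightarrow> (int \<Rightarrow> real) \<Rightarrow> real \<Rightarrow> int \<Rightarrow> complex" where
  "dyson a n 0 = (\<lambda>\<omega> t m. exp (- (\<i> * of_real (t * \<omega> m))) * kdelta n m)"
| "dyson a n (Suc k) = (\<lambda>\<omega> t m. - \<i> * exp (- (\<i> * of_real (t * \<omega> m))) *
     (LBINT s=ereal 0..ereal t. exp (\<i> * of_real (s * \<omega> m)) * hop a (dyson a n k \<omega> s) m))"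

lemma interval_integral_has_vector_derivative:
  fixes f :: "real \<Rightarrow> complex"
  assumes "continuous_on UNIV f"
  shows "((\<lambda>u. LBINT y=ereal 0..ereal u. f y) has_vector_derivative f x) (at x)"
proof -
  have "((\<lambda>u. LBINT y=ereal 0..ereal u. f y) has_vector_derivative f x) (at x within {min 0 x - 1..max 0 x + 1})"
    by (rule interval_integral_FTC2) (auto intro: continuous_on_subset[OF assms])
  moreover have "at x within {min 0 x - 1..max 0 x + 1} = at x"
    by (rule at_within_interior) (auto simp: interior_atLeastAtMost_real)
  ultimately show ?thesis by simp
qed

lemma exp_times_has_vector_derivative:
  fixes f :: "real \<Rightarrow> complex"
  assumes "(f has_vector_derivative f') (at t)"
  shows "((\<lambda>s. exp (\<i> * of_real (s * w)) * f s) has_vector_derivative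
     exp (\<i> * of_real (t * w)) * (f' + \<i> * of_real w * f t)) (at t)"
proof -
  have "((\<lambda>s. exp (\<i> * of_real (s * w))) has_vector_derivative \<i> * of_real w * exp (\<i> * of_real (t * w))) (at t)"
  proof -
    have "((\<lambda>s. s * w) has_vector_derivative w) (at t)"
      by (auto intro!: derivative_eq_intros simp flip: has_real_derivative_iff_has_vector_derivative)
    from vector_diff_chain_at[OF this has_vector_derivative_iexp] show ?thesis
      by (simp add: o_def scaleR_conv_of_real algebra_simps)
  qed
  from has_vector_derivative_mult[OF this assms] show ?thesis by (simp add: algebra_simps)
qed

text \<open>Variation of constants: the oscillating factor solves the diagonal equation exactly, and
  the integral feeds in the hopping of the previous term.\<close>

lemma dyson_Suc_has_vector_derivative:
  assumes "\<And>m. continuous_on UNIV (\<lambda>t. dyson a n k \<omega> t m)"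
  shows "((\<lambda>s. dyson a n (Suc k) \<omega> s m) has_vector_derivative
     - \<i> * (of_real (\<omega> m) * dyson a n (Suc k) \<omega> t m + hop a (dyson a n k \<omega> t) m)) (at t)"
proof -
  let ?f = "\<lambda>s. exp (\<i> * of_real (s * \<omega> m)) * hop a (dyson a n k \<omega> s) m"
  have "continuous_on UNIV ?f"
    unfolding hop_def by (intro continuous_intros assms)
  note ft = interval_integral_has_vector_derivative[OF this]
  define I where "I s = (LBINT y=ereal 0..ereal s. ?f y)" for s
  define E where "E s = exp (\<i> * of_real (s * - \<omega> m))" for s
  have "(I has_vector_derivative ?f t) (at t)" using ft unfolding I_def .
  from exp_times_has_vector_derivative[OF this, of "- \<omega> m"]
  have 1: "((\<lambda>s. - \<i> * (E s * I s)) has_vector_derivative - \<i> * (E t * (?f t + \<i> * of_real (- \<omega> m) * I t))) (at t)"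
    unfolding E_def by (rule has_vector_derivative_mult_right)
  have dy: "dyson a n (Suc k) \<omega> s m = - \<i> * (E s * I s)" for s
    by (simp add: I_def E_def)
  have "E t * ?f t = hop a (dyson a n k \<omega> t) m"
    unfolding E_def by (simp flip: exp_add mult.assoc)
  moreover define F where "F = ?f t"
  ultimately have F: "E t * F = hop a (dyson a n k \<omega> t) m" by simp
  have "- \<i> * (E t * (?f t + \<i> * of_real (- \<omega> m) * I t))
     = - \<i> * (of_real (\<omega> m) * (- \<i> * (E t * I t)) + hop a (dyson a n k \<omega> t) m)"
    unfolding distrib_left F_def[symmetric] by (simp add: F[symmetric] algebra_simps)
  then show ?thesis using 1 unfolding dy by simp
qed

lemma dyson_0_has_vector_derivative:
  "((\<lambda>s. dyson a n 0 \<omega> s m) has_vector_derivative - \<i> * (of_real (\<omega> m) * dyson a n 0 \<omega> t m)) (at t)"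
proof -
  have "((\<lambda>s. kdelta n m) has_vector_derivative 0) (at t)" by simp
  from exp_times_has_vector_derivative[OF this, of "- \<omega> m"] show ?thesis by (simp add: algebra_simps)
qed

lemma dyson_continuous: "continuous_on UNIV (\<lambda>t. dyson a n k \<omega> t m)"
proof (induction k arbitrary: m)
  case 0
  show ?case by (intro continuous_at_imp_continuous_on ballI has_vector_derivative_continuous[OF dyson_0_has_vector_derivative])
next
  case (Suc k)
  show ?case
    by (intro continuous_at_imp_continuous_on ballI has_vector_derivative_continuous[OF dyson_Suc_has_vector_derivative[OF Suc]])
qed

text \<open>A summable weight that a step to a neighbour increases by at most the factor 2. Bounds
  against it survive the hopping term and at the same time dominate sums over the sites, which a
  bound on norms alone would not do.\<close>

definition wt :: "int \<Rightarrow> real" where "wt m = (1/2) ^ nat \<bar>m\<bar>"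

lemma wt_pos [simp]: "wt m > 0" and wt_nonneg [simp]: "wt m \<ge> 0" and wt_le_1: "wt m \<le> 1"
  by (auto simp: wt_def power_le_one)

lemma wt_shift: "wt (m + 1) \<le> 2 * wt m" "wt (m - 1) \<le> 2 * wt m"
proof -
  have *: "wt k \<le> 2 * wt m" if "\<bar>m\<bar> \<le> \<bar>k\<bar> + 1" for k
  proof -
    have "nat \<bar>m\<bar> \<le> Suc (nat \<bar>k\<bar>)" using that by linarith
    then have "(1/2::real) ^ Suc (nat \<bar>k\<bar>) \<le> (1/2) ^ nat \<bar>m\<bar>" by (intro power_decreasing) auto
    then show ?thesis by (simp add: wt_def)
  qed
  show "wt (m + 1) \<le> 2 * wt m" "wt (m - 1) \<le> 2 * wt m" by (rule *; linarith)+
qed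

lemma wt_summable: "wt summable_on UNIV"
proof -
  have s: "(\<lambda>k::nat. (1/2::real) ^ k) summable_on UNIV"
    by (rule summable_nonneg_imp_summable_on) auto
  have 1: "wt summable_on range int"
    using s by (subst summable_on_reindex) (auto simp: wt_def o_def)
  have 2: "wt summable_on range (\<lambda>k. - int k)"
    using s by (subst summable_on_reindex) (auto simp: wt_def o_def inj_def)
  have "wt summable_on (range int \<union> range (\<lambda>k. - int k))" by (rule summable_on_union[OF 1 2])
  moreover have "x \<in> range int \<union> range (\<lambda>k. - int k)" for x
    by (cases "x \<ge> 0") (auto intro: image_eqI[of _ _ "nat x"] image_eqI[of _ _ "nat (- x)"])
  then have "range int \<union> range (\<lambda>k. - int k) = UNIV" by blast
  ultimately show ?thesis by simp
qed

text \<open>The factor 4 is two neighbours times the factor 2 that a unit step costs in the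
  weight.\<close>

lemma hop_bound:
  assumes a: "\<And>n. \<bar>a n\<bar> \<le> B" and x: "\<And>m. cmod (x m) \<le> c * wt m"
  shows "cmod (hop a x m) \<le> 4 * B * c * wt m"
proof -
  have B: "B \<ge> 0" using a[of 0] by linarith
  have "0 \<le> c * wt 0" using x[of 0] norm_ge_zero order_trans by blast
  then have c: "c \<ge> 0" by (simp add: wt_def)
  have "cmod (hop a x m) \<le> \<bar>a m\<bar> * cmod (x (m + 1)) + \<bar>a (m - 1)\<bar> * cmod (x (m - 1))"
    unfolding hop_def by (rule order_trans[OF norm_triangle_ineq]) (simp add: norm_mult)
  also have "\<dots> \<le> B * (c * (2 * wt m)) + B * (c * (2 * wt m))"
    using c B wt_shift[of m]
    by (intro add_mono mult_mono a order_trans[OF x] mult_left_mono) auto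
  finally show ?thesis by simp
qed

lemma vector_derivative_power_bound:
  fixes f :: "real \<Rightarrow> complex"
  assumes d: "\<And>s. (f has_vector_derivative f' s) (at s)" and 0: "f 0 = 0"
    and b: "\<And>s. \<bar>s\<bar> \<le> \<bar>t\<bar> \<Longrightarrow> cmod (f' s) \<le> c * \<bar>s\<bar> ^ k"
  shows "cmod (f t) \<le> c * \<bar>t\<bar> ^ Suc k / Suc k"
proof -
  have pos: "cmod (g t) \<le> c * t ^ Suc k / Suc k"
    if d: "\<And>s. (g has_vector_derivative g' s) (at s)" and 0: "g 0 = 0"
      and b: "\<And>s. 0 \<le> s \<Longrightarrow> s \<le> t \<Longrightarrow> cmod (g' s) \<le> c * s ^ k" and t: "t > 0"
    for g g' :: "real \<Rightarrow> complex" and t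
  proof -
    have "norm (g t - g 0) \<le> c * t ^ Suc k / Suc k - c * 0 ^ Suc k / Suc k"
    proof (rule differentiable_bound_general[OF t])
      show "continuous_on {0..t} g"
        by (intro continuous_at_imp_continuous_on ballI has_vector_derivative_continuous[OF d])
      show "continuous_on {0..t} (\<lambda>s. c * s ^ Suc k / Suc k)" by (intro continuous_intros) auto
      show "(g has_vector_derivative g' s) (at s)" for s by (rule d)
      show "((\<lambda>s. c * s ^ Suc k / real (Suc k)) has_vector_derivative c * s ^ k) (at s)" for s
        unfolding has_real_derivative_iff_has_vector_derivative[symmetric]
        by (rule derivative_eq_intros refl | simp)+
      show "norm (g' s) \<le> c * s ^ k" if "0 < s" "s < t" for s using that by (intro b) auto
    qed
    then show ?thesis using 0 by simp
  qed
  consider "t = 0" | "t > 0" | "t < 0" by linarith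
  then show ?thesis
  proof cases
    case 1 then show ?thesis using 0 by simp
  next
    case 2
    have b0: "cmod (f' s) \<le> c * s ^ k" if "0 \<le> s" "s \<le> t" for s
      using b[of s] that 2 by simp
    have "cmod (f t) \<le> c * t ^ Suc k / Suc k" by (rule pos[OF d 0 b0 2])
    then show ?thesis using 2 by simp
  next
    case 3
    have d': "((\<lambda>s. f (- s)) has_vector_derivative - f' (- s)) (at s)" for s
    proof -
      have sh: "((\<lambda>s::real. - s) has_vector_derivative -1) (at s)"
        by (auto intro!: derivative_eq_intros simp flip: has_real_derivative_iff_has_vector_derivative)
      show ?thesis using vector_diff_chain_at[OF sh d] by (simp add: o_def)
    qed
    have b': "cmod (- f' (- s)) \<le> c * s ^ k" if "0 \<le> s" "s \<le> - t" for s
      using b[of "- s"] that 3 by (simp add: abs_of_nonneg)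
    have "cmod (f (- (- t))) \<le> c * (- t) ^ Suc k / Suc k"
      by (rule pos[OF d' _ b']) (use 0 3 in auto)
    then show ?thesis using 3 by (simp add: abs_of_neg)
  qed
qed

lemma cmod_exp_times: "cmod (exp (\<i> * of_real r) * z) = cmod z"
  by (simp add: norm_mult)

lemma kdelta_bound: "cmod (kdelta n m) \<le> 2 ^ nat \<bar>n\<bar> * wt m"
  by (auto simp: kdelta_def wt_def power_one_over)

text \<open>Multiplication by the unimodular factor leaves the modulus alone and removes the
  potential from the derivative, so that only the hopping bound is integrated, once for each order.
  Each integration supplies one more factor of the factorial.\<close>

lemma dyson_bound:
  assumes a: "\<And>n. \<bar>a n\<bar> \<le> B"
  shows "cmod (dyson a n k \<omega> t m) \<le> (4 * B * \<bar>t\<bar>) ^ k / fact k * 2 ^ nat \<bar>n\<bar> * wt m"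
proof (induction k arbitrary: t m)
  case 0
  have "cmod (dyson a n 0 \<omega> t m) = cmod (kdelta n m)"
    using cmod_exp_times[of "- (t * \<omega> m)"] by simp
  then show ?case using kdelta_bound[of n m] by simp
next
  case (Suc k)
  let ?g = "\<lambda>s. exp (\<i> * of_real (s * \<omega> m)) * dyson a n (Suc k) \<omega> s m"
  let ?c = "4 * B * (4 * B) ^ k / fact k * 2 ^ nat \<bar>n\<bar> * wt m"
  have d: "(?g has_vector_derivative exp (\<i> * of_real (s * \<omega> m)) * (- \<i> * hop a (dyson a n k \<omega> s) m)) (at s)" for s
    using exp_times_has_vector_derivative[OF dyson_Suc_has_vector_derivative[OF dyson_continuous, of a n k \<omega> m s], of "\<omega> m"]
    by (simp add: algebra_simps)
  have "cmod (?g t) \<le> ?c * \<bar>t\<bar> ^ Suc k / Suc k"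
  proof (rule vector_derivative_power_bound[OF d])
    show "?g 0 = 0" by (simp add: interval_integral_endpoints_same)
    fix s
    have "cmod (hop a (dyson a n k \<omega> s) m) \<le> 4 * B * ((4 * B * \<bar>s\<bar>) ^ k / fact k * 2 ^ nat \<bar>n\<bar>) * wt m"
      by (rule hop_bound[OF a Suc])
    also have "\<dots> = ?c * \<bar>s\<bar> ^ k" by (simp add: power_mult_distrib)
    finally show "cmod (exp (\<i> * of_real (s * \<omega> m)) * (- \<i> * hop a (dyson a n k \<omega> s) m)) \<le> ?c * \<bar>s\<bar> ^ k"
      unfolding cmod_exp_times by (simp add: norm_mult)
  qed
  also have "?c * \<bar>t\<bar> ^ Suc k / Suc k = (4 * B * \<bar>t\<bar>) ^ Suc k / fact (Suc k) * 2 ^ nat \<bar>n\<bar> * wt m"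
    by (simp add: power_mult_distrib mult_ac)
  finally show ?case unfolding cmod_exp_times .
qed

section \<open>The propagator as the sum of the Dyson series\<close>

definition propagator :: "(int \<Rightarrow> real) \<Rightarrow> (int \<Rightarrow> real) \<Rightarrow> int \<Rightarrow> real \<Rightarrow> int \<Rightarrow> complex" where
  "propagator a \<omega> n t m = (\<Sum>k. dyson a n k \<omega> t m)"

lemma exp_sums: "(\<lambda>k. x ^ k / fact k * c) sums (exp x * c)" for x :: real
  using sums_mult2[OF exp_converges[of x]] by (simp add: divide_inverse mult.commute)

lemma dyson_sums:
  assumes a: "\<And>n. \<bar>a n\<bar> \<le> B"
  shows "(\<lambda>k. dyson a n k \<omega> t m) sums propagator a \<omega> n t m"
    and "cmod (propagator a \<omega> n t m) \<le> exp (4 * B * \<bar>t\<bar>) * 2 ^ nat \<bar>n\<bar> * wt m"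
proof -
  have s: "(\<lambda>k. (4 * B * \<bar>t\<bar>) ^ k / fact k * (2 ^ nat \<bar>n\<bar> * wt m)) sums (exp (4 * B * \<bar>t\<bar>) * (2 ^ nat \<bar>n\<bar> * wt m))"
    by (rule exp_sums)
  have b: "cmod (dyson a n k \<omega> t m) \<le> (4 * B * \<bar>t\<bar>) ^ k / fact k * (2 ^ nat \<bar>n\<bar> * wt m)" for k
    using dyson_bound[OF a] by (simp add: mult.assoc)
  have ns: "summable (\<lambda>k. cmod (dyson a n k \<omega> t m))"
    by (rule summable_comparison_test'[OF sums_summable[OF s]]) (use b in auto)
  show "(\<lambda>k. dyson a n k \<omega> t m) sums propagator a \<omega> n t m"
    unfolding propagator_def using summable_norm_cancel[OF ns] by (rule summable_sums)
  have "cmod (propagator a \<omega> n t m) \<le> (\<Sum>k. cmod (dyson a n k \<omega> t m))"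
    unfolding propagator_def by (rule summable_norm[OF ns])
  also have "\<dots> \<le> exp (4 * B * \<bar>t\<bar>) * (2 ^ nat \<bar>n\<bar> * wt m)"
    using suminf_le[OF b ns sums_summable[OF s]] sums_unique[OF s] by simp
  finally show "cmod (propagator a \<omega> n t m) \<le> exp (4 * B * \<bar>t\<bar>) * 2 ^ nat \<bar>n\<bar> * wt m" by (simp add: mult.assoc)
qed

lemma propagator_0:
  assumes a: "\<And>n. \<bar>a n\<bar> \<le> B"
  shows "propagator a \<omega> n 0 = kdelta n"
proof
  fix m
  have "(\<lambda>k. dyson a n k \<omega> 0 m) = (\<lambda>k. if k = 0 then kdelta n m else 0)"
  proof
    fix k show "dyson a n k \<omega> 0 m = (if k = 0 then kdelta n m else 0)"
      by (cases k) (simp_all add: interval_integral_endpoints_same)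
  qed
  then have "(\<lambda>k. dyson a n k \<omega> 0 m) sums kdelta n m"
    using sums_single[of 0 "\<lambda>_. kdelta n m"] by simp
  then show "propagator a \<omega> n 0 m = kdelta n m" unfolding propagator_def by (rule sums_unique[symmetric])
qed

lemma propagator_has_vector_derivative:
  assumes a: "\<And>n. \<bar>a n\<bar> \<le> B"
  shows "((\<lambda>s. propagator a \<omega> n s m) has_vector_derivative - \<i> * jac a \<omega> (propagator a \<omega> n t) m) (at t)"
proof -
  have B: "B \<ge> 0" using a[of 0] by linarith
  \<comment> \<open>The majorants of the series are uniform only on bounded sets of times, so the
    series is differentiated on an open interval around \<open>t\<close>.\<close>
  define T where "T = \<bar>t\<bar> + 1"
  define S where "S = {-T<..<T}"
  define D where "D k s = - \<i> * (of_real (\<omega> m) * dyson a n k \<omega> s m + (if k = 0 then 0 else hop a (dyson a n (k - 1) \<omega> s) m))" for k s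
  have tS: "t \<in> S" by (auto simp: S_def T_def)
  have dD: "((\<lambda>s. dyson a n k \<omega> s m) has_vector_derivative D k s) (at s)" for k s
    unfolding D_def using dyson_0_has_vector_derivative dyson_Suc_has_vector_derivative[OF dyson_continuous]
    by (cases k) (auto simp del: dyson.simps)
  define c where "c = (2::real) ^ nat \<bar>n\<bar>"
  define e where "e k = (4 * B * T) ^ k / fact k * (c * wt m)" for k
  \<comment> \<open>The derivative of term \<open>k\<close> contains the hopping of term
    \<open>k - 1\<close>, whence the shifted index in the majorant.\<close>
  define M where "M k = \<bar>\<omega> m\<bar> * e k + (if k = 0 then 0 else 4 * B * e (k - 1))" for k
  have es: "summable e" unfolding e_def by (rule sums_summable[OF exp_sums])
  have Ms: "summable M"
  proof -
    have "summable (\<lambda>k. \<bar>\<omega> m\<bar> * e (Suc k) + 4 * B * e k)"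
      using es by (intro summable_add summable_mult) (simp_all add: summable_Suc_iff)
    then have "summable (\<lambda>k. M (Suc k))" by (simp add: M_def)
    then show ?thesis by (simp add: summable_Suc_iff)
  qed
  have dyb: "cmod (dyson a n k \<omega> s m') \<le> (4 * B * T) ^ k / fact k * c * wt m'" if "s \<in> S" for k s m'
  proof -
    have "(4 * B * \<bar>s\<bar>) ^ k \<le> (4 * B * T) ^ k" using that B by (intro power_mono mult_left_mono) (auto simp: S_def)
    then have "(4 * B * \<bar>s\<bar>) ^ k / fact k * c * wt m' \<le> (4 * B * T) ^ k / fact k * c * wt m'"
      by (intro mult_right_mono divide_right_mono) (auto simp: c_def)
    then show ?thesis using dyson_bound[where a=a and B=B and n=n and k=k and \<omega>=\<omega> and t=s and m=m', OF a] unfolding c_def by linarith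
  qed
  have Db: "cmod (D k s) \<le> M k" if s: "s \<in> S" for k s
  proof -
    have 1: "cmod (dyson a n k \<omega> s m) \<le> e k" using dyb[OF s, of k m] by (simp add: e_def mult.assoc)
    have 2: "cmod (hop a (dyson a n (k - 1) \<omega> s) m) \<le> 4 * B * e (k - 1)"
      using hop_bound[OF a dyb[OF s]] by (simp add: e_def mult.assoc)
    have "cmod (D k s) \<le> \<bar>\<omega> m\<bar> * cmod (dyson a n k \<omega> s m) + (if k = 0 then 0 else cmod (hop a (dyson a n (k - 1) \<omega> s) m))"
      unfolding D_def norm_mult by (auto simp: norm_mult intro: order_trans[OF norm_triangle_ineq])
    also have "\<dots> \<le> M k"
      unfolding M_def using 1 2 by (intro add_mono mult_left_mono) auto
    finally show ?thesis .
  qed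
  have ul: "uniform_limit S (\<lambda>n x. \<Sum>i<n. D i x) (\<lambda>x. suminf (\<lambda>i. D i x)) sequentially"
    by (rule Weierstrass_m_test[OF Db Ms])
  obtain g where g: "\<And>x. x \<in> S \<Longrightarrow> (\<lambda>k. dyson a n k \<omega> x m) sums g x"
     "\<And>x. x \<in> S \<Longrightarrow> (g has_derivative (\<lambda>h. h *\<^sub>R suminf (\<lambda>i. D i x))) (at x within S)"
  proof -
    have "\<exists>g. \<forall>x\<in>S. (\<lambda>k. dyson a n k \<omega> x m) sums g x \<and> (g has_derivative (\<lambda>h. h *\<^sub>R suminf (\<lambda>i. D i x))) (at x within S)"
    proof (rule has_derivative_series[where f'="\<lambda>k x h. h *\<^sub>R D k x"])
      show "convex S" by (simp add: S_def)
      show "((\<lambda>s. dyson a n k \<omega> s m) has_derivative (\<lambda>h. h *\<^sub>R D k x)) (at x within S)" for k x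
        using has_vector_derivative_at_within[OF dD] by (simp add: has_vector_derivative_def)
      show "t \<in> S" by (rule tS)
      show "(\<lambda>k. dyson a n k \<omega> t m) sums propagator a \<omega> n t m" by (rule dyson_sums[OF a])
      fix \<epsilon> :: real assume \<epsilon>: "\<epsilon> > 0"
      from uniform_limitD[OF ul this]
      show "\<forall>\<^sub>F N in sequentially. \<forall>x\<in>S. \<forall>h. norm ((\<Sum>i<N. h *\<^sub>R D i x) - h *\<^sub>R suminf (\<lambda>i. D i x)) \<le> \<epsilon> * norm h"
      proof eventually_elim
        case (elim N)
        show ?case
        proof (intro ballI allI)
          fix x h assume "x \<in> S"
          then have "norm ((\<Sum>i<N. D i x) - suminf (\<lambda>i. D i x)) \<le> \<epsilon>" using elim by (auto simp: dist_norm intro: less_imp_le)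
          then have "norm (h *\<^sub>R ((\<Sum>i<N. D i x) - suminf (\<lambda>i. D i x))) \<le> \<epsilon> * norm h"
            unfolding norm_scaleR by (subst mult.commute) (simp add: mult_right_mono)
          then show "norm ((\<Sum>i<N. h *\<^sub>R D i x) - h *\<^sub>R suminf (\<lambda>i. D i x)) \<le> \<epsilon> * norm h"
            by (simp add: scaleR_diff_right scaleR_sum_right)
        qed
      qed
    qed
    then show ?thesis using that by blast
  qed
  have gp: "g x = propagator a \<omega> n x m" if "x \<in> S" for x
    by (rule sums_unique2[OF g(1)[OF that] dyson_sums(1)[where a=a and B=B, OF a]])
  have "(g has_vector_derivative suminf (\<lambda>i. D i t)) (at t)"
  proof -
    have "at t within S = at t" by (rule at_within_open[OF tS]) (simp add: S_def)
    then show ?thesis using g(2)[OF tS] by (simp add: has_vector_derivative_def)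
  qed
  then have der: "((\<lambda>s. propagator a \<omega> n s m) has_vector_derivative suminf (\<lambda>i. D i t)) (at t)"
    by (rule has_vector_derivative_transform_within_open[where S=S]) (use tS gp in \<open>auto simp: S_def\<close>)
  have "(\<lambda>k. - \<i> * (of_real (\<omega> m) * dyson a n (Suc k) \<omega> t m + hop a (dyson a n k \<omega> t) m)) sums
      (- \<i> * (of_real (\<omega> m) * (propagator a \<omega> n t m - dyson a n 0 \<omega> t m) + hop a (propagator a \<omega> n t) m))"
  proof -
    note ds = dyson_sums(1)[where a=a and B=B and n=n and \<omega>=\<omega> and t=t, OF a]
    have "(\<lambda>k. dyson a n (Suc k) \<omega> t m) sums (propagator a \<omega> n t m - dyson a n 0 \<omega> t m)"
      using ds[of m] by (subst sums_Suc_iff) (simp del: dyson.simps)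
    then show ?thesis unfolding hop_def by (intro sums_mult sums_add ds)
  qed
  then have "(\<lambda>k. D (Suc k) t) sums
      (- \<i> * (of_real (\<omega> m) * (propagator a \<omega> n t m - dyson a n 0 \<omega> t m) + hop a (propagator a \<omega> n t) m))"
    by (simp add: D_def del: dyson.simps)
  from sums_Suc[OF this] have "(\<lambda>k. D k t) sums (- \<i> * jac a \<omega> (propagator a \<omega> n t) m)"
    by (simp add: D_def jac_hop algebra_simps del: dyson.simps)
  with der show ?thesis by (simp add: sums_iff)
qed

lemma l2norm_le_infsum:
  fixes g :: "int \<Rightarrow> real"
  assumes "g summable_on UNIV" "\<And>m. cmod (x m) \<le> g m"
  shows "x \<in> l2" "l2norm x \<le> infsum g UNIV"
proof -
  have "L2_set (\<lambda>m. cmod (x m)) F \<le> infsum g UNIV" if F: "finite F" for F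
  proof -
    have "L2_set (\<lambda>m. cmod (x m)) F \<le> (\<Sum>m\<in>F. \<bar>cmod (x m)\<bar>)" by (rule L2_set_le_sum_abs)
    also have "\<dots> \<le> (\<Sum>m\<in>F. g m)" by (intro sum_mono) (use assms in auto)
    also have "\<dots> \<le> infsum g UNIV"
      using assms(2) order_trans[OF norm_ge_zero] by (intro finite_sum_le_infsum assms F) auto
    finally show ?thesis .
  qed
  from l2norm_leI[OF this] show "x \<in> l2" "l2norm x \<le> infsum g UNIV" by auto
qed

lemma propagator_coord_sol:
  assumes a: "\<And>n. \<bar>a n\<bar> \<le> B"
  shows "coord_sol a \<omega> (propagator a \<omega> n)"
  unfolding coord_sol_def
proof (intro conjI allI)
  have B: "B \<ge> 0" using a[of 0] by linarith
  fix t :: real and m :: int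
  show "((\<lambda>s. propagator a \<omega> n s m) has_vector_derivative - \<i> * jac a \<omega> (propagator a \<omega> n t) m) (at t)"
    by (rule propagator_has_vector_derivative[OF a])
  fix T :: real
  define g where "g m = exp (4 * B * T) * 2 ^ nat \<bar>n\<bar> * wt m" for m
  have gs: "g summable_on UNIV" unfolding g_def by (intro summable_on_cmult_right wt_summable)
  have "propagator a \<omega> n t \<in> l2 \<and> l2norm (propagator a \<omega> n t) \<le> infsum g UNIV" if t: "\<bar>t\<bar> \<le> T" for t
  proof -
    have "cmod (propagator a \<omega> n t m) \<le> g m" for m
    proof -
      have "exp (4 * B * \<bar>t\<bar>) * 2 ^ nat \<bar>n\<bar> * wt m \<le> g m"
        unfolding g_def using t B by (intro mult_right_mono) (auto intro: mult_left_mono)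
      then show ?thesis using dyson_sums(2)[where a=a and B=B, OF a, of \<omega> n t m] by linarith
    qed
    from l2norm_le_infsum[OF gs this] show ?thesis by simp
  qed
  then show "\<exists>C. \<forall>t. \<bar>t\<bar> \<le> T \<longrightarrow> propagator a \<omega> n t \<in> l2 \<and> l2norm (propagator a \<omega> n t) \<le> C" by blast
qed

lemma jac_kdelta:
  "jac a \<omega> (kdelta n) m =
     of_real (a n) * kdelta (n + 1) m + of_real (a (n - 1)) * kdelta (n - 1) m + of_real (\<omega> n) * kdelta n m"
  by (auto simp: jac_def kdelta_def)

lemma has_vector_derivative_quotient:
  fixes f :: "real \<Rightarrow> complex"
  assumes "(f has_vector_derivative f') (at t)"
  shows "((\<lambda>h. (f (t + h) - f t) / of_real h) \<longlongrightarrow> f') (at 0)"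
proof (rule LIM_zero_cancel, subst tendsto_norm_zero_iff[symmetric])
  have "((\<lambda>h. norm (f (t + h) - f t - h *\<^sub>R f') / norm h) \<longlongrightarrow> 0) (at 0)"
    using assms unfolding has_vector_derivative_def has_derivative_at by blast
  then show "((\<lambda>h. norm ((f (t + h) - f t) / of_real h - f')) \<longlongrightarrow> 0) (at 0)"
  proof (rule Lim_transform_eventually, intro eventually_mono[OF eventually_neq_at_within[of 0]])
    fix h :: real assume "h \<noteq> 0"
    then have "(f (t + h) - f t) / of_real h - f' = (f (t + h) - f t - h *\<^sub>R f') / of_real h"
      by (simp add: field_simps scaleR_conv_of_real)
    then show "norm (f (t + h) - f t - h *\<^sub>R f') / norm h = norm ((f (t + h) - f t) / of_real h - f')"
      by (simp add: norm_divide)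
  qed
qed

text \<open>Coordinatewise convergence is immediate; convergence in norm needs a summable majorant,
  which a factor \<open>\<omega> m\<close> for all sites would destroy. Only site \<open>n\<close>
  has a nonzero initial value, and only there does the potential have to enter the estimate, through
  the single number \<open>\<omega> n\<close>.\<close>

lemma propagator_strong_derivative_0:
  assumes a: "\<And>n. \<bar>a n\<bar> \<le> B"
  shows "((\<lambda>h. l2norm (\<lambda>m. (propagator a \<omega> n h m - kdelta n m) / of_real h + \<i> * jac a \<omega> (kdelta n) m)) \<longlongrightarrow> 0) (at 0)"
proof -
  have B: "B \<ge> 0" using a[of 0] by linarith
  let ?u = "propagator a \<omega> n"
  define r where "r h m = (?u h m - kdelta n m) / of_real h + \<i> * jac a \<omega> (kdelta n) m" for h m
  define c where "c = exp (4 * B) * 2 ^ nat \<bar>n\<bar>"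
  have c: "c > 0" by (simp add: c_def)
  \<comment> \<open>Half of \<open>C\<close> is for the difference quotient, the other half for
    \<open>jac a \<omega> (kdelta n)\<close>.\<close>
  define C where "C = 2 * (4 * B * c + \<bar>\<omega> n\<bar> * c)"
  have ub: "cmod (?u s m) \<le> c * wt m" if "\<bar>s\<bar> \<le> 1" for s m
  proof -
    have "exp (4 * B * \<bar>s\<bar>) * 2 ^ nat \<bar>n\<bar> * wt m \<le> c * wt m"
      unfolding c_def using that B by (intro mult_right_mono) (auto intro: mult_left_le)
    then show ?thesis using dyson_sums(2)[where a=a and B=B, OF a, of \<omega> n s m] by linarith
  qed
  have hb: "cmod (hop a (?u s) m) \<le> 4 * B * c * wt m" if "\<bar>s\<bar> \<le> 1" for s m
    by (rule hop_bound[OF a ub[OF that]])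
  note du = propagator_has_vector_derivative[where a=a and B=B and \<omega>=\<omega> and n=n, OF a]
  have u0: "?u 0 = kdelta n" by (rule propagator_0[OF a])
  have diff: "cmod (?u h m - kdelta n m) \<le> \<bar>h\<bar> * (C / 2 * wt m)" if h: "\<bar>h\<bar> \<le> 1" for h m
  proof (cases "m = n")
    case True
    have "cmod (?u h m - kdelta n m) \<le> (C / 2 * wt m) * \<bar>h\<bar> ^ Suc 0 / Suc 0"
    proof (rule vector_derivative_power_bound)
      show "((\<lambda>s. ?u s m - kdelta n m) has_vector_derivative - \<i> * jac a \<omega> (?u s) m - 0) (at s)" for s
        by (intro has_vector_derivative_diff du has_vector_derivative_const)
      show "?u 0 m - kdelta n m = 0" by (simp add: u0)
      fix s :: real assume "\<bar>s\<bar> \<le> \<bar>h\<bar>"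
      then have s: "\<bar>s\<bar> \<le> 1" using h by simp
      have "cmod (jac a \<omega> (?u s) m) \<le> cmod (hop a (?u s) m) + \<bar>\<omega> m\<bar> * cmod (?u s m)"
        unfolding jac_hop by (rule order_trans[OF norm_triangle_ineq]) (simp add: norm_mult)
      also have "\<dots> \<le> 4 * B * c * wt m + \<bar>\<omega> m\<bar> * (c * wt m)"
        by (intro add_mono mult_left_mono hb ub s) auto
      also have "\<dots> = C / 2 * wt m" using True by (simp add: C_def algebra_simps)
      finally show "cmod (- \<i> * jac a \<omega> (?u s) m - 0) \<le> C / 2 * wt m * \<bar>s\<bar> ^ 0" by (simp add: norm_mult)
    qed
    then show ?thesis by (simp add: mult.commute)
  next
    case False
    \<comment> \<open>Away from \<open>n\<close> the initial value is zero, so the modulus of the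
      difference is that of \<open>?g h\<close>, and the derivative of \<open>?g\<close> is free of
      the potential.\<close>
    let ?g = "\<lambda>s. exp (\<i> * of_real (s * \<omega> m)) * ?u s m"
    have "cmod (?g h) \<le> (C / 2 * wt m) * \<bar>h\<bar> ^ Suc 0 / Suc 0"
    proof (rule vector_derivative_power_bound)
      show "(?g has_vector_derivative exp (\<i> * of_real (s * \<omega> m)) * (- \<i> * hop a (?u s) m)) (at s)" for s
        using exp_times_has_vector_derivative[OF du[of m s], of "\<omega> m"]
        by (simp add: jac_hop algebra_simps)
      show "?g 0 = 0" using False by (simp add: u0 kdelta_def)
      fix s :: real assume "\<bar>s\<bar> \<le> \<bar>h\<bar>"
      then have s: "\<bar>s\<bar> \<le> 1" using h by simp
      have "4 * B * c * wt m \<le> C / 2 * wt m" unfolding C_def using c by (intro mult_right_mono) auto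
      from order_trans[OF hb[OF s] this]
      show "cmod (exp (\<i> * of_real (s * \<omega> m)) * (- \<i> * hop a (?u s) m)) \<le> C / 2 * wt m * \<bar>s\<bar> ^ 0"
        unfolding cmod_exp_times by (simp add: norm_mult)
    qed
    then show ?thesis unfolding cmod_exp_times using False by (simp add: mult.commute kdelta_def)
  qed
  have rb: "cmod (r h m) \<le> C * wt m" if h: "\<bar>h\<bar> \<le> 1" "h \<noteq> 0" for h m
  proof -
    have 1: "cmod ((?u h m - kdelta n m) / of_real h) \<le> C / 2 * wt m"
      using diff[OF h(1), of m] h(2) by (simp add: norm_divide divide_le_eq mult_ac)
    have "cmod (kdelta n m) \<le> c * wt m" for m using ub[of 0] by (simp add: u0)
    note kb = this
    have "cmod (jac a \<omega> (kdelta n) m) \<le> cmod (hop a (kdelta n) m) + cmod (of_real (\<omega> m) * kdelta n m)"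
      unfolding jac_hop by (rule norm_triangle_ineq)
    also have "cmod (of_real (\<omega> m) * kdelta n m) = \<bar>\<omega> n\<bar> * cmod (kdelta n m)"
      by (auto simp: kdelta_def)
    also have "cmod (hop a (kdelta n) m) + \<bar>\<omega> n\<bar> * cmod (kdelta n m) \<le> 4 * B * c * wt m + \<bar>\<omega> n\<bar> * (c * wt m)"
      by (intro add_mono hop_bound[OF a kb] mult_left_mono kb) auto
    also have "\<dots> = C / 2 * wt m" by (simp add: C_def algebra_simps)
    finally have 2: "cmod (\<i> * jac a \<omega> (kdelta n) m) \<le> C / 2 * wt m" by (simp add: norm_mult)
    show ?thesis using norm_triangle_ineq[of "(?u h m - kdelta n m) / of_real h" "\<i> * jac a \<omega> (kdelta n) m"] 1 2
      unfolding r_def by simp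
  qed
  have near: "\<forall>\<^sub>F h in at (0::real). \<bar>h\<bar> \<le> 1 \<and> h \<noteq> 0"
    unfolding eventually_at by (intro exI[of _ 1]) auto
  have rl: "((\<lambda>h. r h m) \<longlongrightarrow> 0) (at 0)" for m
  proof -
    have "((\<lambda>s. ?u s m) has_vector_derivative - \<i> * jac a \<omega> (kdelta n) m) (at 0)"
      using du[of m 0] by (simp add: u0)
    from tendsto_add[OF has_vector_derivative_quotient[OF this] tendsto_const[of "\<i> * jac a \<omega> (kdelta n) m"]]
    show ?thesis by (simp add: r_def u0)
  qed
  have "((\<lambda>h. \<Sum>\<^sub>\<infinity>m. cnj (r h m) * r h m) \<longlongrightarrow> (\<Sum>\<^sub>\<infinity>m::int. 0)) (at 0)"
  proof (rule infsum_dominated_tendsto[where h="\<lambda>m. C\<^sup>2 * wt m"])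
    show "((\<lambda>h. cnj (r h m) * r h m) \<longlongrightarrow> 0) (at 0)" for m
      using tendsto_mult[OF tendsto_cnj[OF rl[of m]] rl[of m]] by simp
    show "\<forall>\<^sub>F h in at 0. \<forall>m. cmod (cnj (r h m) * r h m) \<le> C\<^sup>2 * wt m"
    proof (intro eventually_mono[OF near] allI)
      fix h :: real and m assume h: "\<bar>h\<bar> \<le> 1 \<and> h \<noteq> 0"
      have "cmod (cnj (r h m) * r h m) = (cmod (r h m))\<^sup>2" by (simp add: norm_mult power2_eq_square)
      also have "\<dots> \<le> (C * wt m)\<^sup>2" using rb[of h m] h by (intro power_mono) auto
      also have "\<dots> \<le> C\<^sup>2 * wt m"
        unfolding power_mult_distrib using wt_le_1[of m]
        by (intro mult_left_mono) (auto simp: power2_eq_square mult_left_le_one_le)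
      finally show "cmod (cnj (r h m) * r h m) \<le> C\<^sup>2 * wt m" .
    qed
    show "(\<lambda>m. C\<^sup>2 * wt m) summable_on UNIV" by (intro summable_on_cmult_right wt_summable)
  qed simp
  then have "((\<lambda>h. l2inner (r h) (r h)) \<longlongrightarrow> 0) (at 0)" by (simp add: l2inner_def)
  from tendsto_real_sqrt[OF tendsto_norm[OF this]]
  have lim: "((\<lambda>h. sqrt (cmod (l2inner (r h) (r h)))) \<longlongrightarrow> 0) (at 0)" by simp
  have "((\<lambda>h. l2norm (r h)) \<longlongrightarrow> 0) (at 0)"
  proof (rule Lim_transform_eventually[OF lim], intro eventually_mono[OF near])
    fix h :: real assume h: "\<bar>h\<bar> \<le> 1 \<and> h \<noteq> 0"
    have "(\<lambda>m. C * wt m) summable_on UNIV" by (intro summable_on_cmult_right wt_summable)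
    then have "r h \<in> l2" by (rule l2norm_le_infsum(1)) (use rb h in auto)
    then show "sqrt (cmod (l2inner (r h) (r h))) = l2norm (r h)" by (simp add: l2inner_self norm_power)
  qed
  then show ?thesis unfolding r_def[abs_def] .
qed

lemma propagator_l2: "(\<And>n. \<bar>a n\<bar> \<le> B) \<Longrightarrow> propagator a \<omega> n t \<in> l2"
  using coord_sol_l2[OF propagator_coord_sol] by blast

text \<open>The difference quotient plus \<open>\<i> * v\<close> is again a coordinatewise solution,
  so its norm at time \<open>t\<close> equals its norm at time zero, where \<open>v\<close> is
  \<open>jac a \<omega> (kdelta n)\<close>. This carries the strong derivative from time zero to
  every time. Comparison with the coordinatewise derivative then identifies \<open>v\<close> as J
  applied to the propagator, which says that J commutes with the evolution.\<close>

lemma propagator_strong_derivative: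
  fixes \<omega> :: "int \<Rightarrow> real"
  assumes a: "\<And>n. \<bar>a n\<bar> \<le> B"
  defines "v \<equiv> \<lambda>n t m. of_real (a n) * propagator a \<omega> (n + 1) t m + of_real (a (n - 1)) * propagator a \<omega> (n - 1) t m
        + of_real (\<omega> n) * propagator a \<omega> n t m"
  shows "((\<lambda>h. l2norm (\<lambda>m. (propagator a \<omega> n (t + h) m - propagator a \<omega> n t m) / of_real h + \<i> * v n t m)) \<longlongrightarrow> 0) (at 0)"
    and "jac a \<omega> (propagator a \<omega> n t) = v n t"
    and "coord_sol a \<omega> (v n)"
proof -
  let ?u = "propagator a \<omega>"
  have sol: "coord_sol a \<omega> (?u n)" for n by (rule propagator_coord_sol[OF a])
  have u0: "?u n 0 = kdelta n" for n by (rule propagator_0[OF a])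
  show solv: "coord_sol a \<omega> (v n)" for n
    unfolding v_def by (intro coord_sol_add coord_sol_scale sol)
  define q where "q h t m = (?u n (t + h) m - ?u n t m) / of_real h + \<i> * v n t m" for h t m
  have solq: "coord_sol a \<omega> (q h)" for h
  proof -
    have "coord_sol a \<omega> (\<lambda>t m. 1 / of_real h * (?u n (t + h) m - ?u n t m) + \<i> * v n t m)"
      by (intro coord_sol_add coord_sol_scale coord_sol_diff coord_sol_shift sol solv)
    moreover have "q h = (\<lambda>t m. 1 / of_real h * (?u n (t + h) m - ?u n t m) + \<i> * v n t m)"
      by (simp add: q_def fun_eq_iff)
    ultimately show ?thesis by simp
  qed
  have "q h 0 = (\<lambda>m. (?u n h m - kdelta n m) / of_real h + \<i> * jac a \<omega> (kdelta n) m)" for h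
    by (simp add: q_def v_def u0 jac_kdelta fun_eq_iff)
  then have "((\<lambda>h. l2norm (q h 0)) \<longlongrightarrow> 0) (at 0)"
    using propagator_strong_derivative_0[where a=a and B=B and \<omega>=\<omega> and n=n, OF a] by simp
  moreover have "l2norm (q h t) = l2norm (q h 0)" for h
    by (rule coord_sol_norm_const[OF a solq])
  ultimately have ql: "((\<lambda>h. l2norm (q h t)) \<longlongrightarrow> 0) (at 0)" by simp
  then show "((\<lambda>h. l2norm (\<lambda>m. (?u n (t + h) m - ?u n t m) / of_real h + \<i> * v n t m)) \<longlongrightarrow> 0) (at 0)"
    by (simp add: q_def[abs_def])
  show "jac a \<omega> (?u n t) = v n t"
  proof
    fix m
    have "((\<lambda>h. q h t m) \<longlongrightarrow> 0) (at 0)"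
      by (rule tendsto_0_le[OF ql, where K=1]) (use l2_coord_le[OF coord_sol_l2[OF solq]] in auto)
    then have 1: "((\<lambda>h. q h t m - \<i> * v n t m) \<longlongrightarrow> 0 - \<i> * v n t m) (at 0)" by (intro tendsto_intros)
    have "((\<lambda>h. (?u n (t + h) m - ?u n t m) /\<^sub>R h) \<longlongrightarrow> - \<i> * jac a \<omega> (?u n t) m) (at 0)"
      using has_vector_derivative_quotient[OF coord_sol_deriv[OF sol]]
      by (simp add: scaleR_conv_of_real divide_inverse mult.commute)
    then have 2: "((\<lambda>h. q h t m - \<i> * v n t m) \<longlongrightarrow> - \<i> * jac a \<omega> (?u n t) m) (at 0)"
      by (simp add: q_def scaleR_conv_of_real divide_inverse mult.commute)
    show "jac a \<omega> (?u n t) m = v n t m" using LIM_unique[OF 1 2] by simp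
  qed
qed

lemma schroedinger_sol_propagator:
  assumes a: "\<And>n. \<bar>a n\<bar> \<le> B"
  shows "schroedinger_sol a \<omega> (kdelta n) (propagator a \<omega> n)"
  unfolding schroedinger_sol_def
proof (intro conjI allI)
  note sd = propagator_strong_derivative[where a=a and B=B and \<omega>=\<omega> and n=n, OF a]
  show "propagator a \<omega> n 0 = kdelta n" by (rule propagator_0[OF a])
  fix t
  show "propagator a \<omega> n t \<in> l2" by (rule propagator_l2[OF a])
  show "jac a \<omega> (propagator a \<omega> n t) \<in> l2" unfolding sd(2) using coord_sol_l2[OF sd(3)] .
  show "((\<lambda>h. l2norm (\<lambda>m. (propagator a \<omega> n (t + h) m - propagator a \<omega> n t m) / of_real h
      + \<i> * jac a \<omega> (propagator a \<omega> n t) m)) \<longlongrightarrow> 0) (at 0)"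
    unfolding sd(2) by (rule sd(1))
qed

text \<open>The Dyson series gives existence and norm conservation gives uniqueness, so the definite
  description in \<open>evol\<close> denotes.\<close>

lemma evol_kdelta:
  assumes a: "\<And>n. \<bar>a n\<bar> \<le> B"
  shows "evol a \<omega> (kdelta n) = propagator a \<omega> n"
  unfolding evol_def
proof (rule the_equality)
  show s: "schroedinger_sol a \<omega> (kdelta n) (propagator a \<omega> n)" by (rule schroedinger_sol_propagator[OF a])
  fix \<psi> assume \<psi>: "schroedinger_sol a \<omega> (kdelta n) \<psi>"
  show "\<psi> = propagator a \<omega> n"
    by (rule coord_sol_unique[OF a schroedinger_sol_coord_sol[OF \<psi>] schroedinger_sol_coord_sol[OF s]])
       (use \<psi> s in \<open>simp add: schroedinger_sol_def\<close>)
qed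

section \<open>Measurability in the potential\<close>

lemma dyson_measurable:
  "(\<lambda>p. dyson a n k (fst p) (snd p) m) \<in> borel_measurable (PiM UNIV (\<lambda>_. borel) \<Otimes>\<^sub>M borel)"
proof (induction k arbitrary: m)
  case 0
  show ?case by simp
next
  case (Suc k)
  note [measurable] = Suc
  let ?P = "PiM UNIV (\<lambda>_::int. borel :: real measure) \<Otimes>\<^sub>M (borel :: real measure)"
  \<comment> \<open>The induction carries joint measurability in potential and time, because the
    next term integrates over the time.\<close>
  define F where "F p s = exp (\<i> * of_real (s * fst p m)) * hop a (dyson a n k (fst p) s) m" for p :: "(int \<Rightarrow> real) \<times> real" and s :: real
  have d[measurable]: "(\<lambda>(p, s). dyson a n k (fst p) s m') \<in> borel_measurable (?P \<Otimes>\<^sub>M lborel)" for m'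
    using measurable_compose[OF _ Suc[of m'], of "\<lambda>(p, s). (fst p, s)" "?P \<Otimes>\<^sub>M lborel"]
    by (simp add: split_beta')
  have F[measurable]: "(\<lambda>(p, s). F p s) \<in> borel_measurable (?P \<Otimes>\<^sub>M lborel)"
    unfolding F_def hop_def by measurable
  \<comment> \<open>The oriented integral becomes a difference of two integrals over the whole line,
    so that its upper limit enters only through a measurable condition.\<close>
  have I: "(LBINT s=ereal 0..ereal t. F p s) =
     (LINT s|lborel. (if 0 < s \<and> s < t then F p s else 0)) - (LINT s|lborel. (if t < s \<and> s < 0 then F p s else 0))" for p t
  proof -
    have *: "indicator {x<..<y} s *\<^sub>R F p s = (if x < s \<and> s < y then F p s else 0)" for x y s :: real
      by (simp add: indicator_def)
    have z: "(LINT s|lborel. (if x < s \<and> s < y then F p s else 0)) = 0" if "y \<le> x" for x y :: real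
      using that by (intro integral_eq_zero_AE AE_I2) auto
    show ?thesis
      using z[of t 0] z[of 0 t]
      by (cases "0 \<le> t") (simp_all add: interval_lebesgue_integral_def set_lebesgue_integral_def *)
  qed
  have "(\<lambda>p. dyson a n (Suc k) (fst p) (snd p) m) = (\<lambda>p. - \<i> * exp (- (\<i> * of_real (snd p * fst p m))) *
     (LBINT s=ereal 0..ereal (snd p). F p s))"
    by (simp add: F_def)
  also have "\<dots> \<in> borel_measurable ?P"
    unfolding I by measurable
  finally show ?case .
qed

lemma propagator_measurable:
  "(\<lambda>\<omega>. propagator a \<omega> n t m) \<in> borel_measurable (PiM UNIV (\<lambda>_. borel))"
proof -
  have [measurable]: "(\<lambda>\<omega>. dyson a n k \<omega> t m) \<in> borel_measurable (PiM UNIV (\<lambda>_. borel))" for k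
    using measurable_compose[OF _ dyson_measurable[of a n k m], of "\<lambda>\<omega>. (\<omega>, t)" "PiM UNIV (\<lambda>_. borel)"] by simp
  show ?thesis unfolding propagator_def by measurable
qed

section \<open>Compact Hermitian kernels\<close>

text \<open>Fatou's lemma for sums: each finite block of the limit obeys the bound. This is one half
  of the weak compactness of balls; extraction of a diagonal subsequence is the other.\<close>

lemma l2_coord_limit:
  assumes x: "\<And>j::nat. x j \<in> l2" "\<And>j. l2norm (x j) \<le> R" and lim: "\<And>m. (\<lambda>j. x j m) \<longlonglongrightarrow> y m"
  shows "y \<in> l2" "l2norm y \<le> R"
proof -
  have "L2_set (\<lambda>m. cmod (y m)) F \<le> R" if F: "finite F" for F
  proof (rule LIMSEQ_le_const2)
    show "(\<lambda>j. L2_set (\<lambda>m. cmod (x j m)) F) \<longlonglongrightarrow> L2_set (\<lambda>m. cmod (y m)) F"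
      unfolding L2_set_def by (intro tendsto_intros lim)
    show "\<exists>N. \<forall>j\<ge>N. L2_set (\<lambda>m. cmod (x j m)) F \<le> R"
      using order_trans[OF l2_L2_set_le[OF x(1) F] x(2)] by blast
  qed
  from l2norm_leI[OF this] show "y \<in> l2" "l2norm y \<le> R" by auto
qed

text \<open>The first-order condition at a maximum: with \<open>s\<close> a small multiple of
  \<open>b\<close> the linear term would outweigh the quadratic one.\<close>

lemma linear_le_quadratic_imp_zero:
  fixes b c :: real
  assumes "\<And>s. 2 * s * b \<le> s\<^sup>2 * c"
  shows "b = 0"
proof -
  define d where "d = \<bar>c\<bar> + 1"
  have d: "d > 0" by (simp add: d_def)
  have "2 * (b / d) * b \<le> (b / d)\<^sup>2 * c" by (rule assms)
  also have "\<dots> \<le> (b / d)\<^sup>2 * d" by (intro mult_left_mono) (auto simp: d_def)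
  finally have "2 * b\<^sup>2 / d \<le> b\<^sup>2 / d" using d by (simp add: power2_eq_square field_simps)
  then have "b\<^sup>2 \<le> 0" using d by (simp add: divide_le_cancel)
  then show ?thesis by simp
qed

text \<open>The summability of the row norms makes the kernel operator compact in the strong sense that
  the image of the unit ball is dominated by a summable sequence.\<close>
locale herm_kernel =
  fixes L :: "int \<Rightarrow> int \<Rightarrow> complex" and \<rho> :: "int \<Rightarrow> real"
  assumes herm: "L m k = cnj (L k m)"
    and row: "finite F \<Longrightarrow> (\<Sum>k\<in>F. (cmod (L m k))\<^sup>2) \<le> (\<rho> m)\<^sup>2"
    and rho_nonneg: "\<rho> m \<ge> 0"
    and rho_summable: "\<rho> summable_on UNIV"
begin

definition ap :: "(int \<Rightarrow> complex) \<Rightarrow> int \<Rightarrow> complex" where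
  "ap x m = (\<Sum>\<^sub>\<infinity>k. L m k * x k)"

lemma row_l2: "L m \<in> l2" "l2norm (L m) \<le> \<rho> m"
  using l2norm_le_sqI[OF row rho_nonneg] by auto

text \<open>Hermiticity turns the bound on rows into one on columns; the latter is the majorant,
  summable in \<open>k\<close>, for sums along a row.\<close>

lemma entry_le: "cmod (L m k) \<le> \<rho> m" "cmod (L m k) \<le> \<rho> k"
proof -
  have *: "cmod (L m k) \<le> \<rho> m" for m k
    using order_trans[OF l2_coord_le[OF row_l2(1)] row_l2(2)] .
  show "cmod (L m k) \<le> \<rho> m" by (rule *)
  show "cmod (L m k) \<le> \<rho> k" using *[of k m] herm[of m k] by simp
qed

lemma ap_bound:
  assumes "x \<in> l2" shows "cmod (ap x m) \<le> \<rho> m * l2norm x"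
  unfolding ap_def
  by (rule order_trans[OF l2_mult_summable(4)[OF row_l2(1) assms] mult_right_mono[OF row_l2(2)]]) simp

lemma ap_l2: assumes "x \<in> l2" shows "ap x \<in> l2" "l2norm (ap x) \<le> infsum \<rho> UNIV * l2norm x"
proof -
  have s: "(\<lambda>m. \<rho> m * l2norm x) summable_on UNIV" by (intro summable_on_cmult_left rho_summable)
  from l2norm_le_infsum[OF s ap_bound[OF assms]]
  show "ap x \<in> l2" "l2norm (ap x) \<le> infsum \<rho> UNIV * l2norm x"
    using infsum_cmult_left'[of \<rho> "l2norm x" UNIV] by auto
qed

lemma ap_add: "x \<in> l2 \<Longrightarrow> y \<in> l2 \<Longrightarrow> ap (\<lambda>k. x k + y k) = (\<lambda>m. ap x m + ap y m)"
  unfolding ap_def distrib_left by (intro ext infsum_add l2_mult_summable row_l2)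

lemma ap_scale: "ap (\<lambda>k. c * x k) = (\<lambda>m. c * ap x m)"
  unfolding ap_def by (simp add: mult.left_commute infsum_cmult_right')

text \<open>The row norms make the double series absolutely summable, so the order of summation may
  be exchanged.\<close>

lemma ap_sym:
  assumes x: "x \<in> l2" and y: "y \<in> l2"
  shows "l2inner y (ap x) = l2inner (ap y) x"
proof -
  let ?f = "\<lambda>m k. cnj (y m) * (L m k * x k)"
  have s: "(\<lambda>p. norm (case p of (m, k) \<Rightarrow> ?f m k)) summable_on UNIV \<times> UNIV"
    unfolding Infinite_Sum.abs_summable_on_Sigma_iff
  proof (intro conjI ballI)
    fix m
    show "(\<lambda>k. norm (case (m, k) of (m, k) \<Rightarrow> ?f m k)) summable_on UNIV"
      using summable_on_cmult_right[OF l2_mult_summable(1)[OF row_l2(1) x, of m], of "cmod (y m)"]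
      by (simp add: norm_mult)
  next
    have le: "infsum (\<lambda>k. norm (case (m, k) of (m, k) \<Rightarrow> ?f m k)) UNIV \<le> l2norm y * l2norm x * \<rho> m" for m
    proof -
      have "infsum (\<lambda>k. norm (case (m, k) of (m, k) \<Rightarrow> ?f m k)) UNIV = cmod (y m) * (\<Sum>\<^sub>\<infinity>k. cmod (L m k * x k))"
        by (simp add: norm_mult infsum_cmult_right')
      also have "\<dots> \<le> l2norm y * (l2norm (L m) * l2norm x)"
        by (intro mult_mono l2_coord_le y l2_mult_summable row_l2 x infsum_nonneg) auto
      also have "\<dots> \<le> l2norm y * (\<rho> m * l2norm x)"
        by (intro mult_left_mono mult_right_mono row_l2) auto
      finally show ?thesis by (simp add: mult_ac)
    qed
    have "(\<lambda>m. l2norm y * l2norm x * \<rho> m) summable_on UNIV" by (intro summable_on_cmult_right rho_summable)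
    then show "(\<lambda>m. norm (infsum (\<lambda>k. norm (case (m, k) of (m, k) \<Rightarrow> ?f m k)) UNIV)) summable_on UNIV"
      by (rule summable_on_comparison_test) (use le in \<open>auto simp: infsum_nonneg abs_of_nonneg\<close>)
  qed
  have s': "(\<lambda>(m, k). ?f m k) summable_on UNIV \<times> UNIV" using s by (rule abs_summable_summable)
  have "l2inner y (ap x) = (\<Sum>\<^sub>\<infinity>m. \<Sum>\<^sub>\<infinity>k. ?f m k)"
    unfolding l2inner_def ap_def by (simp add: infsum_cmult_right')
  also have "\<dots> = (\<Sum>\<^sub>\<infinity>k. \<Sum>\<^sub>\<infinity>m. ?f m k)" by (rule infsum_swap_banach[OF s'])
  also have "\<dots> = (\<Sum>\<^sub>\<infinity>k. \<Sum>\<^sub>\<infinity>m. cnj (L k m * y m) * x k)"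
    by (subst herm) (simp add: mult_ac)
  also have "\<dots> = l2inner (ap y) x"
    unfolding l2inner_def ap_def by (simp only: infsum_cmult_left' infsum_cnj)
  finally show ?thesis .
qed

text \<open>Compactness at work: coordinatewise convergence in a ball is merely weak, yet the
  summable \<open>\<rho>\<close> is a majorant that lets the quadratic form pass to the
  limit.\<close>

lemma ap_tendsto:
  assumes x: "\<And>j::nat. x j \<in> l2" "\<And>j. l2norm (x j) \<le> R" and lim: "\<And>m. (\<lambda>j. x j m) \<longlonglongrightarrow> y m"
  shows "(\<lambda>j. ap (x j) m) \<longlonglongrightarrow> ap y m"
    and "(\<lambda>j. l2inner (x j) (ap (x j))) \<longlonglongrightarrow> l2inner y (ap y)"
proof -
  have R: "R \<ge> 0" using x(2)[of 0] l2norm_nonneg order_trans by blast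
  have xb: "cmod (x j k) \<le> R" for j k using order_trans[OF l2_coord_le[OF x(1)] x(2)] .
  show ap: "(\<lambda>j. ap (x j) m) \<longlonglongrightarrow> ap y m" for m
    unfolding ap_def
  proof (rule infsum_dominated_tendsto[where h="\<lambda>k. \<rho> k * R"])
    show "(\<lambda>j. L m k * x j k) \<longlonglongrightarrow> L m k * y k" for k by (intro tendsto_intros lim)
    show "\<forall>\<^sub>F j in sequentially. \<forall>k. cmod (L m k * x j k) \<le> \<rho> k * R"
      unfolding norm_mult by (intro always_eventually allI mult_mono entry_le xb rho_nonneg) auto
  qed (auto intro!: summable_on_cmult_left rho_summable)
  show "(\<lambda>j. l2inner (x j) (ap (x j))) \<longlonglongrightarrow> l2inner y (ap y)"
    unfolding l2inner_def
  proof (rule infsum_dominated_tendsto[where h="\<lambda>k. R * (\<rho> k * R)"])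
    show "(\<lambda>j. cnj (x j k) * ap (x j) k) \<longlonglongrightarrow> cnj (y k) * ap y k" for k by (intro tendsto_intros lim ap)
    have "cmod (ap (x j) k) \<le> \<rho> k * R" for j k
      by (rule order_trans[OF ap_bound[OF x(1)] mult_left_mono[OF x(2) rho_nonneg]])
    then show "\<forall>\<^sub>F j in sequentially. \<forall>k. cmod (cnj (x j k) * ap (x j) k) \<le> R * (\<rho> k * R)"
      unfolding norm_mult complex_mod_cnj by (intro always_eventually allI mult_mono xb R) auto
  qed (auto intro!: summable_on_cmult_left summable_on_cmult_right rho_summable)
qed

section \<open>Variational construction of an eigenvector\<close>

definition quad :: "(int \<Rightarrow> complex) \<Rightarrow> real" where
  "quad x = Re (l2inner x (ap x))"

lemma quad_add_scale:
  assumes x: "x \<in> l2" and y: "y \<in> l2"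
  shows "quad (\<lambda>k. x k + of_real s * y k) = quad x + 2 * s * Re (l2inner y (ap x)) + s\<^sup>2 * quad y"
proof -
  let ?y = "\<lambda>k. of_real s * y k"
  note l = l2_scale[OF y, of "of_real s"] ap_l2(1)[OF x] ap_l2(1)[OF y] l2_scale[OF ap_l2(1)[OF y], of "of_real s"]
  have "Re (l2inner x (ap y)) = Re (l2inner y (ap x))"
    using ap_sym[OF y x] l2inner_commute[of "ap x" y] by simp
  then show ?thesis
    using x y l unfolding quad_def
    by (simp add: ap_add ap_scale l2_add l2inner_add_left l2inner_add_right l2inner_scale_left l2inner_scale_right
         power2_eq_square algebra_simps)
qed

lemma l2norm_add_scale:
  assumes x: "x \<in> l2" and y: "y \<in> l2"
  shows "(l2norm (\<lambda>k. x k + of_real s * y k))\<^sup>2 = (l2norm x)\<^sup>2 + 2 * s * Re (l2inner y x) + s\<^sup>2 * (l2norm y)\<^sup>2"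
proof -
  note l = l2_scale[OF y, of "of_real s"]
  have sq: "(l2norm z)\<^sup>2 = Re (l2inner z z)" if "z \<in> l2" for z using l2inner_self[OF that] by simp
  have "Re (l2inner x y) = Re (l2inner y x)" using l2inner_commute[of x y] by simp
  then show ?thesis
    unfolding sq[OF x] sq[OF y] sq[OF l2_add(1)[OF x l]] using x y l
    by (simp add: l2_add l2inner_add_left l2inner_add_right l2inner_scale_left l2inner_scale_right
         power2_eq_square algebra_simps)
qed

lemma quad_scale: "quad (\<lambda>k. c * x k) = (cmod c)\<^sup>2 * quad x"
proof -
  have "l2inner (\<lambda>k. c * x k) (ap (\<lambda>k. c * x k)) = of_real ((cmod c)\<^sup>2) * l2inner x (ap x)"
    unfolding ap_scale l2inner_scale_left l2inner_scale_right complex_norm_square by (simp add: mult_ac)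
  then show ?thesis by (simp add: quad_def)
qed

text \<open>Rayleigh's principle inside \<open>S\<close>. Closure under bounded coordinatewise
  limits is all that a maximising sequence requires of \<open>S\<close>, and this condition persists
  when a space is cut down to an eigenspace of a compact kernel, so that the theorem can be applied
  a second time there.\<close>

theorem eigenvector_exists:
  assumes Sl2: "S \<subseteq> l2"
    and Sadd: "\<And>x y. x \<in> S \<Longrightarrow> y \<in> S \<Longrightarrow> (\<lambda>k. x k + y k) \<in> S"
    and Sscale: "\<And>c x. x \<in> S \<Longrightarrow> (\<lambda>k. c * x k) \<in> S"
    and Sap: "\<And>x. x \<in> S \<Longrightarrow> ap x \<in> S"
    and Sclosed: "\<And>x y. (\<And>j::nat. x j \<in> S) \<Longrightarrow> (\<And>j. l2norm (x j) \<le> 1) \<Longrightarrow> (\<And>m. (\<lambda>j. x j m) \<longlonglongrightarrow> y m) \<Longrightarrow> y \<in> S"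
    and nz: "x0 \<in> S" "ap x0 \<noteq> (\<lambda>_. 0)"
  shows "\<exists>x\<in>S. x \<noteq> (\<lambda>_. 0) \<and> (\<exists>\<kappa>::real. \<kappa> \<noteq> 0 \<and> ap x = (\<lambda>m. of_real \<kappa> * x m))"
proof -
  have l: "x \<in> l2" if "x \<in> S" for x using that Sl2 by blast
  \<comment> \<open>If the form vanished on all of \<open>S\<close>, its value at
    \<open>x0 + ap x0\<close> would leave only the cross term, which is twice the squared norm of
    \<open>ap x0\<close>.\<close>
  have "\<exists>z\<in>S. quad z \<noteq> 0"
  proof (rule ccontr)
    assume "\<not> ?thesis"
    then have 0: "quad z = 0" if "z \<in> S" for z using that by blast
    define y where "y = ap x0"
    have y: "y \<in> S" unfolding y_def by (rule Sap[OF nz(1)])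
    have "quad (\<lambda>k. x0 k + of_real 1 * y k) = 0" by (intro 0 Sadd Sscale nz y)
    then have "Re (l2inner y (ap x0)) = 0"
      using quad_add_scale[OF l[OF nz(1)] l[OF y], of 1] 0[OF nz(1)] 0[OF y] by simp
    then have "l2norm y = 0" using l2inner_self[OF l[OF y]] by (simp add: y_def)
    then show False using l2norm_eq_0D[OF l[OF y]] nz(2) by (simp add: y_def)
  qed
  \<comment> \<open>The sign \<open>\<sigma>\<close> makes the form positive somewhere, so that one
    maximisation covers both signs.\<close>
  then obtain z \<sigma> where z: "z \<in> S" and \<sigma>: "\<sigma> = 1 \<or> \<sigma> = (-1::real)" and zpos: "\<sigma> * quad z > 0"
    by (metis linorder_neqE_linordered_idom mult_1 mult_minus1 neg_0_less_iff_less)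
  define p where "p x = \<sigma> * quad x" for x
  define Q where "Q = p ` {x \<in> S. l2norm x \<le> 1}"
  have pscale: "p (\<lambda>k. c * x k) = (cmod c)\<^sup>2 * p x" for c x by (simp add: p_def quad_scale)
  have unit: "(\<lambda>k. of_real (1 / l2norm x) * x k) \<in> {x \<in> S. l2norm x \<le> 1}" if "x \<in> S" "l2norm x \<noteq> 0" for x
    using that by (auto intro: Sscale simp: l2norm_scale norm_divide simp del: of_real_divide)
  have Qb: "q \<le> infsum \<rho> UNIV" if q: "q \<in> Q" for q
  proof -
    obtain x where x: "x \<in> S" "l2norm x \<le> 1" "q = p x" using q by (auto simp: Q_def)
    have "q \<le> \<bar>quad x\<bar>" using \<sigma> by (auto simp: x p_def)
    also have "\<dots> \<le> cmod (l2inner x (ap x))" unfolding quad_def by (rule abs_Re_le_cmod)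
    also have "\<dots> \<le> l2norm x * l2norm (ap x)" by (intro l2inner_bound l x ap_l2)
    also have "\<dots> \<le> 1 * (infsum \<rho> UNIV * 1)"
      using x by (intro mult_mono order_trans[OF ap_l2(2)[OF l] mult_left_mono] infsum_nonneg rho_nonneg) auto
    finally show ?thesis by simp
  qed
  then have bdd: "bdd_above Q" by (rule bdd_aboveI)
  define \<kappa> where "\<kappa> = Sup Q"
  have le\<kappa>: "p x \<le> \<kappa>" if "x \<in> S" "l2norm x \<le> 1" for x
    unfolding \<kappa>_def by (rule cSup_upper[OF _ bdd]) (use that in \<open>auto simp: Q_def\<close>)
  have pzero: "p x = 0" if "x \<in> S" "l2norm x = 0" for x
    using l2norm_eq_0D[OF l[OF that(1)] that(2)] by (simp add: p_def quad_def l2inner_def)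
  have le\<kappa>2: "p x \<le> \<kappa> * (l2norm x)\<^sup>2" if x: "x \<in> S" for x
  proof (cases "l2norm x = 0")
    case True then show ?thesis using pzero[OF x] by simp
  next
    case False
    have "p (\<lambda>k. of_real (1 / l2norm x) * x k) \<le> \<kappa>" using unit[OF x False] by (intro le\<kappa>) auto
    then show ?thesis using False unfolding pscale
      by (simp add: norm_divide power_divide divide_le_eq mult.commute)
  qed
  have znz: "l2norm z \<noteq> 0" using pzero[OF z] zpos by (auto simp: p_def)
  have \<kappa>pos: "\<kappa> > 0"
    using le\<kappa>2[OF z] zpos znz unfolding p_def
    by (smt (verit) mult_nonpos_nonneg zero_le_power2)
  have "\<exists>x. x \<in> S \<and> l2norm x \<le> 1 \<and> p x > \<kappa> - 1 / real (Suc j)" for j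
  proof -
    have "Q \<noteq> {}" using unit[OF z znz] by (auto simp: Q_def)
    then have "\<exists>q\<in>Q. \<kappa> - 1 / real (Suc j) < q"
      unfolding \<kappa>_def by (intro less_cSupD) auto
    then show ?thesis by (auto simp: Q_def)
  qed
  then obtain X where X: "\<And>j. X j \<in> S" "\<And>j. l2norm (X j) \<le> 1" "\<And>j. p (X j) > \<kappa> - 1 / real (Suc j)"
    by metis
  have Xb: "cmod (X j m) \<le> 1" for j m using order_trans[OF l2_coord_le[OF l[OF X(1)]] X(2)] .
  \<comment> \<open>The maximiser is a weak limit; a priori its norm may be less than one.\<close>
  obtain s :: "nat \<Rightarrow> nat" where s: "strict_mono s" "\<And>m. \<exists>y. (\<lambda>j. X (s j) m) \<longlonglongrightarrow> y"
    using function_convergent_subsequence[of "UNIV::int set" X 1] Xb by (metis UNIV_I countableI_type)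
  then obtain x where x: "\<And>m. (\<lambda>j. X (s j) m) \<longlonglongrightarrow> x m" by metis
  have xS: "x \<in> S" by (rule Sclosed[OF _ _ x]) (use X in auto)
  have x1: "l2norm x \<le> 1" by (rule l2_coord_limit(2)[OF _ _ x]) (use X l in auto)
  have "(\<lambda>j. l2inner (X (s j)) (ap (X (s j)))) \<longlonglongrightarrow> l2inner x (ap x)"
    by (rule ap_tendsto(2)[OF _ _ x]) (use X l in auto)
  then have pl: "(\<lambda>j. p (X (s j))) \<longlonglongrightarrow> p x" unfolding p_def quad_def by (intro tendsto_intros)
  have "(\<lambda>j. \<kappa> - 1 / real (Suc (s j))) \<longlonglongrightarrow> \<kappa> - 0"
    using LIMSEQ_subseq_LIMSEQ[OF LIMSEQ_inverse_real_of_nat s(1)]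
    by (intro tendsto_diff tendsto_const) (simp add: o_def inverse_eq_divide)
  from LIMSEQ_le[OF this pl] have "\<kappa> \<le> p x" using X(3) by (auto intro: less_imp_le)
  then have px: "p x = \<kappa>" using le\<kappa>[OF xS x1] by simp
  \<comment> \<open>The residual of the eigenvalue equation, used as the direction of variation: the
    first-order condition then states that the norm of the residual is zero.\<close>
  define y where "y = (\<lambda>k. of_real \<sigma> * ap x k + of_real (- \<kappa>) * x k)"
  have yS: "y \<in> S" unfolding y_def by (intro Sadd Sscale Sap xS)
  have "2 * t * (\<sigma> * Re (l2inner y (ap x)) - \<kappa> * Re (l2inner y x)) \<le> t\<^sup>2 * (\<kappa> * (l2norm y)\<^sup>2 - p y)" for t
  proof -
    have "p (\<lambda>k. x k + of_real t * y k) \<le> \<kappa> * (l2norm (\<lambda>k. x k + of_real t * y k))\<^sup>2"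
      by (intro le\<kappa>2 Sadd Sscale xS yS)
    then have "p x + 2 * t * (\<sigma> * Re (l2inner y (ap x))) + t\<^sup>2 * p y
       \<le> \<kappa> * (l2norm x)\<^sup>2 + \<kappa> * (2 * t * Re (l2inner y x)) + \<kappa> * (t\<^sup>2 * (l2norm y)\<^sup>2)"
      unfolding p_def quad_add_scale[OF l[OF xS] l[OF yS]] l2norm_add_scale[OF l[OF xS] l[OF yS]]
      by (simp add: algebra_simps)
    \<comment> \<open>Only \<open>l2norm x \<le> 1\<close> is known of the maximiser, and this is
      enough because \<open>\<kappa>\<close> is positive.\<close>
    moreover have "\<kappa> * (l2norm x)\<^sup>2 \<le> \<kappa>" using x1 \<kappa>pos by (simp add: mult_left_le power_le_one)
    ultimately show ?thesis unfolding px by (simp add: algebra_simps)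
  qed
  then have b0: "\<sigma> * Re (l2inner y (ap x)) - \<kappa> * Re (l2inner y x) = 0"
    by (rule linear_le_quadratic_imp_zero)
  have "l2inner y y = of_real \<sigma> * l2inner y (ap x) + of_real (- \<kappa>) * l2inner y x"
  proof -
    have "l2inner y y = l2inner y (\<lambda>k. of_real \<sigma> * ap x k + of_real (- \<kappa>) * x k)" by (simp only: y_def)
    also have "\<dots> = of_real \<sigma> * l2inner y (ap x) + of_real (- \<kappa>) * l2inner y x"
      by (simp only: l2inner_add_right l[OF yS] l2_scale ap_l2(1) l[OF xS] l2inner_scale_right)
    finally show ?thesis .
  qed
  then have "Re (l2inner y y) = 0" using b0 by simp
  then have "l2norm y = 0" using l2inner_self[OF l[OF yS]] by simp
  then have "y = (\<lambda>_. 0)" by (rule l2norm_eq_0D[OF l[OF yS]])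
  then have ym: "of_real \<sigma> * ap x m = of_real \<kappa> * x m" for m
    unfolding y_def by (metis add_eq_0_iff2 minus_minus mult_minus_left of_real_minus)
  have "ap x m = of_real (\<sigma> * \<kappa>) * x m" for m
    using ym[of m, symmetric] \<sigma> by auto
  then have "ap x = (\<lambda>m. of_real (\<sigma> * \<kappa>) * x m)" by auto
  moreover have "\<sigma> * \<kappa> \<noteq> 0" using \<sigma> \<kappa>pos by auto
  moreover have "x \<noteq> (\<lambda>_. 0)"
  proof
    assume "x = (\<lambda>_. 0)"
    then have "p x = 0" by (simp add: p_def quad_def l2inner_def)
    then show False using px \<kappa>pos by simp
  qed
  ultimately show ?thesis using xS by blast
qed

end

section \<open>Weak limits, finite nets and time averages\<close>

text \<open>A finite part of \<open>e\<close> sees finitely many coordinates, and its small tail is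
  paired with vectors of norm at most \<open>R\<close>.\<close>

lemma l2inner_weak_tendsto:
  assumes e: "e \<in> l2" and x: "\<And>j::nat. x j \<in> l2" "\<And>j. l2norm (x j) \<le> R" and lim: "\<And>m. (\<lambda>j. x j m) \<longlonglongrightarrow> y m"
  shows "(\<lambda>j. l2inner e (x j)) \<longlonglongrightarrow> l2inner e y"
proof (rule LIMSEQ_I)
  fix \<epsilon> :: real assume \<epsilon>: "\<epsilon> > 0"
  have R: "R \<ge> 0" using x(2)[of 0] l2norm_nonneg order_trans by blast
  note y = l2_coord_limit[OF x lim]
  define \<eta> where "\<eta> = \<epsilon> / (4 * (R + 1))"
  have \<eta>: "\<eta> > 0" using \<epsilon> R by (simp add: \<eta>_def)
  have es: "(\<lambda>m. (cmod (e m))\<^sup>2) summable_on UNIV" using e by (simp add: l2_def)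
  obtain X where X: "finite X" "dist (\<Sum>m\<in>X. (cmod (e m))\<^sup>2) (\<Sum>\<^sub>\<infinity>m. (cmod (e m))\<^sup>2) \<le> \<eta>\<^sup>2"
    using infsum_finite_approximation[OF es, of "\<eta>\<^sup>2"] \<eta> by auto
  define e' where "e' m = (if m \<in> X then 0 else e m)" for m
  have e': "e' \<in> l2" "l2norm e' \<le> \<eta>"
  proof -
    have "(\<Sum>m\<in>F. (cmod (e' m))\<^sup>2) \<le> \<eta>\<^sup>2" if F: "finite F" for F
    proof -
      have "(\<Sum>m\<in>F. (cmod (e' m))\<^sup>2) = (\<Sum>m\<in>F - X. (cmod (e m))\<^sup>2)"
        using F by (intro sum.mono_neutral_cong_right) (auto simp: e'_def)
      also have "\<dots> = (\<Sum>m\<in>X \<union> F. (cmod (e m))\<^sup>2) - (\<Sum>m\<in>X. (cmod (e m))\<^sup>2)"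
        using F X by (subst sum_diff[symmetric]) (auto intro!: sum.cong)
      also have "\<dots> \<le> \<eta>\<^sup>2"
        using finite_sum_le_infsum[OF es, of "X \<union> F"] F X by (auto simp: dist_real_def)
      finally show ?thesis .
    qed
    from l2norm_le_sqI[OF this] \<eta> show "e' \<in> l2" "l2norm e' \<le> \<eta>" by auto
  qed
  define S where "S z = (\<Sum>m\<in>X. cnj (e m) * z m)" for z
  have split: "cmod (l2inner e z - S z) \<le> \<eta> * R" if z: "z \<in> l2" "l2norm z \<le> R" for z
  proof -
    have "l2inner e z = (\<Sum>\<^sub>\<infinity>m. (if m \<in> X then cnj (e m) * z m else 0) + cnj (e' m) * z m)"
      unfolding l2inner_def by (intro infsum_cong) (simp add: e'_def)
    also have "\<dots> = (\<Sum>\<^sub>\<infinity>m. (if m \<in> X then cnj (e m) * z m else 0)) + l2inner e' z"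
      unfolding l2inner_def
      by (intro infsum_add l2inner_summable e' z finite_nonzero_values_imp_summable_on finite_subset[OF _ X(1)]) auto
    also have "(\<Sum>\<^sub>\<infinity>m. (if m \<in> X then cnj (e m) * z m else 0)) = S z"
      using infsum_cong_neutral[of UNIV X "\<lambda>m. if m \<in> X then cnj (e m) * z m else 0" "\<lambda>m. cnj (e m) * z m"] X
      by (simp add: S_def)
    finally have "l2inner e z - S z = l2inner e' z" by simp
    moreover have "cmod (l2inner e' z) \<le> \<eta> * R"
      by (rule order_trans[OF l2inner_bound[OF e'(1) z(1)]]) (intro mult_mono e' z, use \<eta> in auto)
    ultimately show ?thesis by simp
  qed
  have "(\<lambda>j. S (x j)) \<longlonglongrightarrow> S y" unfolding S_def by (intro tendsto_intros lim)
  then obtain N where N: "\<And>j. j \<ge> N \<Longrightarrow> cmod (S (x j) - S y) < \<epsilon> / 2" using LIMSEQ_D[of _ _ "\<epsilon>/2"] \<epsilon> by fastforce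
  have "\<eta> * R \<le> \<epsilon> / 4" unfolding \<eta>_def using R \<epsilon> by (simp add: field_simps)
  then have b: "cmod (l2inner e z - S z) \<le> \<epsilon> / 4" if "z \<in> l2" "l2norm z \<le> R" for z
    using split[OF that] by simp
  have "cmod (l2inner e (x j) - l2inner e y) < \<epsilon>" if "j \<ge> N" for j
  proof -
    have "l2inner e (x j) - l2inner e y = (l2inner e (x j) - S (x j)) + (S (x j) - S y) - (l2inner e y - S y)" by simp
    then have "cmod (l2inner e (x j) - l2inner e y) \<le> cmod (l2inner e (x j) - S (x j)) + cmod (S (x j) - S y) + cmod (l2inner e y - S y)"
      by (simp only: order_trans[OF norm_triangle_ineq4 add_right_mono[OF norm_triangle_ineq]])
    then show ?thesis using b[OF x(1) x(2), of j] b[OF y] N[OF that] by simp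
  qed
  then show "\<exists>no. \<forall>j\<ge>no. norm (l2inner e (x j) - l2inner e y) < \<epsilon>" by blast
qed

text \<open>Outside a finite window \<open>g\<close> keeps all orbit points close together; inside,
  they are sorted into finitely many cells. Choosing one time for each occupied cell keeps the net
  on the orbit, as the recurrence argument requires.\<close>

lemma dominated_finite_net:
  fixes u :: "real \<Rightarrow> int \<Rightarrow> complex"
  assumes g: "g summable_on UNIV" and u: "\<And>t m. cmod (u t m) \<le> g m" and \<epsilon>: "\<epsilon> > 0"
  shows "\<exists>F. finite F \<and> (\<forall>t. \<exists>s\<in>F. l2norm (\<lambda>m. u t m - u s m) \<le> \<epsilon>)"
proof -
  have g0: "g m \<ge> 0" for m using u[of 0 m] norm_ge_zero order_trans by blast
  obtain X where X: "finite X" "dist (sum g X) (infsum g UNIV) \<le> \<epsilon>/4"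
    using infsum_finite_approximation[OF g, of "\<epsilon>/4"] \<epsilon> by auto
  have tl: "infsum g UNIV - sum g X \<le> \<epsilon>/4" using X(2) unfolding dist_real_def by linarith
  \<comment> \<open>The cells have side \<open>1 / l\<close>, so the window contributes at most
    \<open>card X * (2 / l)\<close>, which is at most \<open>\<epsilon> / 2\<close>. The added 1
    covers an empty window.\<close>
  define l where "l = 4 * (real (card X) + 1) / \<epsilon>"
  have l: "l > 0" using \<epsilon> by (simp add: l_def)
  define q where "q t = (\<lambda>m\<in>X. (\<lfloor>l * Re (u t m)\<rfloor>, \<lfloor>l * Im (u t m)\<rfloor>))" for t
  define b where "b = \<lceil>l * infsum g UNIV\<rceil> + 1"
  have fl: "\<lfloor>l * r\<rfloor> \<in> {- b..b}" if "\<bar>r\<bar> \<le> infsum g UNIV" for r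
  proof -
    have "\<bar>l * r\<bar> \<le> l * infsum g UNIV" using that l by (simp add: abs_mult)
    then show ?thesis unfolding b_def by (auto; linarith)
  qed
  have ub: "cmod (u t m) \<le> infsum g UNIV" for t m
    using u[of t m] finite_sum_le_infsum[OF g, of "{m}"] g0 by simp
  have "range q \<subseteq> PiE X (\<lambda>_. {- b..b} \<times> {- b..b})"
    unfolding q_def using order_trans[OF abs_Re_le_cmod ub] order_trans[OF abs_Im_le_cmod ub] fl by auto
  then have "finite (range q)" by (rule finite_subset) (intro finite_PiE X, auto)
  then obtain F where F: "finite F" "range q = q ` F"
    using finite_subset_image[of "range q" q UNIV] by auto
  show ?thesis
  proof (intro exI[of _ F] conjI F allI)
    fix t
    obtain s where s: "s \<in> F" "q t = q s" using F(2) by (metis imageE rangeI)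
    have near: "cmod (u t m - u s m) \<le> 2 / l" if m: "m \<in> X" for m
    proof -
      have *: "\<bar>x - y\<bar> \<le> 1 / l" if "\<lfloor>l * x\<rfloor> = \<lfloor>l * y\<rfloor>" for x y
      proof -
        have "\<bar>l * x - l * y\<bar> \<le> 1" using that by linarith
        then have "l * \<bar>x - y\<bar> \<le> 1" using l by (simp add: abs_mult flip: right_diff_distrib)
        then show ?thesis using l by (simp add: field_simps)
      qed
      have "q t m = q s m" using s by simp
      then have "\<lfloor>l * Re (u t m)\<rfloor> = \<lfloor>l * Re (u s m)\<rfloor>" "\<lfloor>l * Im (u t m)\<rfloor> = \<lfloor>l * Im (u s m)\<rfloor>"
        using m by (auto simp: q_def)
      from *[OF this(1)] *[OF this(2)]
      show ?thesis using cmod_le[of "u t m - u s m"] by simp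
    qed
    have "L2_set (\<lambda>m. cmod (u t m - u s m)) Y \<le> \<epsilon>" if Y: "finite Y" for Y
    proof -
      have "L2_set (\<lambda>m. cmod (u t m - u s m)) Y \<le> (\<Sum>m\<in>Y. \<bar>cmod (u t m - u s m)\<bar>)" by (rule L2_set_le_sum_abs)
      also have "\<dots> = (\<Sum>m\<in>Y \<inter> X. cmod (u t m - u s m)) + (\<Sum>m\<in>Y - X. cmod (u t m - u s m))"
        using Y by (simp add: sum.Int_Diff[of Y _ X])
      also have "(\<Sum>m\<in>Y \<inter> X. cmod (u t m - u s m)) \<le> real (card (Y \<inter> X)) * (2 / l)"
        by (rule sum_bounded_above) (use near in auto)
      also have "\<dots> \<le> real (card X) * (2 / l)"
        using X l by (intro mult_right_mono) (auto intro: card_mono)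
      also have "(\<Sum>m\<in>Y - X. cmod (u t m - u s m)) \<le> (\<Sum>m\<in>Y - X. 2 * g m)"
      proof (rule sum_mono)
        fix m show "cmod (u t m - u s m) \<le> 2 * g m"
          using norm_triangle_ineq4[of "u t m" "u s m"] u[of t m] u[of s m] by simp
      qed
      also have "(\<Sum>m\<in>Y - X. 2 * g m) = 2 * (sum g (X \<union> Y) - sum g X)"
        using X Y by (subst sum_diff[symmetric]) (auto simp: sum_distrib_left intro!: sum.cong)
      also have "\<dots> \<le> 2 * (\<epsilon> / 4)"
        using finite_sum_le_infsum[OF g, of "X \<union> Y"] X(1) Y g0 tl by simp
      also have "real (card X) * (2 / l) \<le> \<epsilon> / 2" using \<epsilon> unfolding l_def by (simp add: field_simps)
      finally show ?thesis by simp
    qed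
    from l2norm_leI(2)[OF this] show "\<exists>s\<in>F. l2norm (\<lambda>m. u t m - u s m) \<le> \<epsilon>" using s(1) by blast
  qed
qed

section \<open>Time averages\<close>

definition avg :: "real \<Rightarrow> (real \<Rightarrow> complex) \<Rightarrow> complex" where
  "avg T f = integral {0..T} f / of_real T"

lemma avg_integrable: "continuous_on UNIV f \<Longrightarrow> f integrable_on {0..T::real}" for f :: "real \<Rightarrow> complex"
  by (intro integrable_continuous_real) (auto intro: continuous_on_subset)

lemma avg_bound:
  assumes "T > 0" "continuous_on UNIV f" "\<And>t. cmod (f t) \<le> c"
  shows "cmod (avg T f) \<le> c"
proof -
  have "cmod (integral {0..T} f) \<le> c * (T - 0)"
    by (rule integral_bound) (use assms in \<open>auto intro: continuous_on_subset\<close>)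
  then show ?thesis using assms(1) by (simp add: avg_def norm_divide divide_le_eq)
qed

lemma avg_add:
  assumes "continuous_on UNIV f" "continuous_on UNIV g"
  shows "avg T (\<lambda>t. f t + g t) = avg T f + avg T g"
  unfolding avg_def integral_add[OF avg_integrable[OF assms(1)] avg_integrable[OF assms(2)]]
  by (rule add_divide_distrib)

lemma avg_mult: "avg T (\<lambda>t. c * f t) = c * avg T f"
  unfolding avg_def by simp

lemma avg_sum:
  assumes "\<And>i. i \<in> A \<Longrightarrow> continuous_on UNIV (f i)" "finite A"
  shows "avg T (\<lambda>t. \<Sum>i\<in>A. f i t) = (\<Sum>i\<in>A. avg T (f i))"
  unfolding avg_def by (subst integral_sum) (auto intro: avg_integrable assms simp: sum_divide_distrib)

lemma avg_cnj: "avg T (\<lambda>t. cnj (f t)) = cnj (avg T f)"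
  unfolding avg_def by (simp add: integral_cnj)

lemma avg_Re_ge:
  assumes T: "T > 0" and f: "continuous_on UNIV f" and c: "\<And>t. Re (f t) \<ge> c"
  shows "Re (avg T f) \<ge> c"
proof -
  have i: "f integrable_on {0..T}" by (rule avg_integrable[OF f])
  have "Re (integral {0..T} f) = integral {0..T} (\<lambda>t. Re (f t))"
    using integral_linear[OF i bounded_linear_Re] by (simp add: o_def)
  moreover have "integral {0..T} (\<lambda>t. c) \<le> integral {0..T} (\<lambda>t. Re (f t))"
    using integrable_linear[OF i bounded_linear_Re] by (intro integral_le) (auto simp: o_def c)
  ultimately have "c * T \<le> Re (integral {0..T} f)" using T by (simp add: mult.commute)
  then show ?thesis using T by (simp add: avg_def Re_divide_of_real le_divide_eq)
qed

lemma avg_derivative_tendsto: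
  assumes d: "\<And>t. (f has_vector_derivative f' t) (at t)" and b: "\<And>t. cmod (f t) \<le> c"
    and T: "filterlim T at_top sequentially"
  shows "(\<lambda>j. avg (T j) f') \<longlonglongrightarrow> 0"
proof (rule tendsto_0_le[where K=1])
  show "(\<lambda>j. 2 * c / T j) \<longlonglongrightarrow> 0" by (rule real_tendsto_divide_at_top[OF tendsto_const T])
  have "\<forall>\<^sub>F j in sequentially. T j > 0" using T by (simp add: filterlim_at_top_dense)
  then show "\<forall>\<^sub>F j in sequentially. norm (avg (T j) f') \<le> norm (2 * c / T j) * 1"
  proof eventually_elim
    case (elim j)
    have "(f' has_integral f (T j) - f 0) {0..T j}"
      by (rule fundamental_theorem_of_calculus) (use elim in \<open>auto intro: has_vector_derivative_at_within[OF d]\<close>)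
    then have "integral {0..T j} f' = f (T j) - f 0" by (rule integral_unique)
    moreover have "cmod (f (T j) - f 0) \<le> c + c"
      by (rule order_trans[OF norm_triangle_ineq4 add_mono[OF b b]])
    ultimately show ?case using elim by (simp add: avg_def norm_divide divide_right_mono abs_of_pos)
  qed
qed

text \<open>With \<open>F\<close> a primitive of \<open>f\<close>, the difference
  \<open>f (t + s) - f t\<close> is the derivative of \<open>F (t + s) - F t\<close>, which never
  exceeds \<open>c * \<bar>s\<bar>\<close> in modulus. Its average therefore vanishes in the
  limit.\<close>

lemma avg_shift_tendsto:
  assumes f: "continuous_on UNIV f" and b: "\<And>t. cmod (f t) \<le> c"
    and T: "filterlim T at_top sequentially" and lim: "(\<lambda>j. avg (T j) f) \<longlonglongrightarrow> L"
  shows "(\<lambda>j. avg (T j) (\<lambda>t. f (t + s))) \<longlonglongrightarrow> L"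
proof -
  define F where "F x = (LBINT y=ereal 0..ereal x. f y)" for x
  have F: "(F has_vector_derivative f x) (at x)" for x
    unfolding F_def by (rule interval_integral_has_vector_derivative[OF f])
  have sh: "((\<lambda>x. F (x + r)) has_vector_derivative f (x + r)) (at x)" for x r
  proof -
    have "((\<lambda>x. x + r) has_vector_derivative 1) (at x)"
      by (auto intro!: derivative_eq_intros simp flip: has_real_derivative_iff_has_vector_derivative)
    from vector_diff_chain_at[OF this F] show ?thesis by (simp add: o_def)
  qed
  have Fb: "cmod (F (x + s) - F x) \<le> c * \<bar>s\<bar>" for x
  proof -
    have "cmod (F (s + x) - F x) \<le> c * \<bar>s\<bar> ^ Suc 0 / Suc 0"
    proof (rule vector_derivative_power_bound)
      show "((\<lambda>s. F (s + x) - F x) has_vector_derivative f (s + x) - 0) (at s)" for s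
        by (intro has_vector_derivative_diff sh has_vector_derivative_const)
    qed (use b in auto)
    then show ?thesis by (simp add: add.commute)
  qed
  have "(\<lambda>j. avg (T j) (\<lambda>t. f (t + s) + (-1) * f t)) \<longlonglongrightarrow> 0"
  proof (rule avg_derivative_tendsto[OF _ _ T])
    show "((\<lambda>t. F (t + s) - F t) has_vector_derivative f (t + s) + (-1) * f t) (at t)" for t
      using has_vector_derivative_diff[OF sh F] by simp
  qed (rule Fb)
  moreover have "continuous_on UNIV (\<lambda>t. f (t + s))"
    by (rule continuous_on_compose2[OF f]) (auto intro!: continuous_intros)
  moreover have "continuous_on UNIV (\<lambda>t. (-1) * f t)" by (intro continuous_intros f)
  ultimately have "(\<lambda>j. avg (T j) (\<lambda>t. f (t + s)) - avg (T j) f) \<longlonglongrightarrow> 0"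
    by (simp only: avg_add avg_mult) simp
  from tendsto_add[OF this lim] show ?thesis by simp
qed

section \<open>The averaged kernel of a dominated orbit\<close>

text \<open>The space \<open>S\<close> of the overview. The zero vector among the \<open>e\<close>
  imposes no condition, and complex \<open>\<zeta>\<close> avoid any appeal to the reality of
  eigenvalues.\<close>

definition eig_orth :: "(int \<Rightarrow> real) \<Rightarrow> (int \<Rightarrow> real) \<Rightarrow> (int \<Rightarrow> complex) set" where
  "eig_orth a \<omega> = {\<psi> \<in> l2. \<forall>e\<in>l2. \<forall>\<zeta>::complex. jac a \<omega> e = (\<lambda>n. \<zeta> * e n) \<longrightarrow> l2inner e \<psi> = 0}"

lemma eig_orth_add: "x \<in> eig_orth a \<omega> \<Longrightarrow> y \<in> eig_orth a \<omega> \<Longrightarrow> (\<lambda>k. x k + y k) \<in> eig_orth a \<omega>"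
  by (auto simp: eig_orth_def l2_add l2inner_add_right)

lemma eig_orth_scale: "x \<in> eig_orth a \<omega> \<Longrightarrow> (\<lambda>k. c * x k) \<in> eig_orth a \<omega>"
  by (auto simp: eig_orth_def l2_scale l2inner_scale_right)

lemma eig_orth_closed:
  assumes "\<And>j::nat. x j \<in> eig_orth a \<omega>" "\<And>j. l2norm (x j) \<le> R" "\<And>m. (\<lambda>j. x j m) \<longlonglongrightarrow> y m"
  shows "y \<in> eig_orth a \<omega>"
  unfolding eig_orth_def mem_Collect_eq
proof (intro conjI ballI allI impI)
  have x: "x j \<in> l2" for j using assms(1)[of j] by (simp add: eig_orth_def)
  show "y \<in> l2" by (rule l2_coord_limit[OF x assms(2,3)])
  fix e \<zeta> assume e: "e \<in> l2" "jac a \<omega> e = (\<lambda>n. \<zeta> * e n)"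
  have "l2inner e (x j) = 0" for j using assms(1)[of j] e unfolding eig_orth_def by blast
  then have "(\<lambda>j. l2inner e (x j)) \<longlonglongrightarrow> 0" by simp
  with l2inner_weak_tendsto[OF e(1) x assms(2,3)] show "l2inner e y = 0" by (rule LIMSEQ_unique)
qed

lemma eig_orth_no_eigenvector:
  assumes x: "x \<in> eig_orth a \<omega>" and "jac a \<omega> x = (\<lambda>n. \<zeta> * x n)"
  shows "x = (\<lambda>_. 0)"
proof -
  have l: "x \<in> l2" using x by (simp add: eig_orth_def)
  have "l2inner x x = 0" using assms l unfolding eig_orth_def by blast
  then show ?thesis using l2inner_self[OF l] l2norm_eq_0D[OF l] by simp
qed

text \<open>The assumption on \<open>jac a \<omega> (u t)\<close> makes its norm constant in time;
  that constant bounds the rows of the product JK even when J is unbounded.\<close>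

locale dominated_orbit =
  fixes a \<omega> :: "int \<Rightarrow> real" and B :: real and u :: "real \<Rightarrow> int \<Rightarrow> complex" and g :: "int \<Rightarrow> real"
  assumes a_le: "\<And>n. \<bar>a n\<bar> \<le> B"
    and sol: "coord_sol a \<omega> u"
    and jac_sol: "coord_sol a \<omega> (\<lambda>t. jac a \<omega> (u t))"
    and g_summable: "g summable_on UNIV"
    and u_le: "\<And>t m. cmod (u t m) \<le> g m"
begin

lemma g_nonneg: "g m \<ge> 0"
  using u_le[of 0 m] norm_ge_zero order_trans by blast

lemma g_le: "g m \<le> infsum g UNIV"
  using finite_sum_le_infsum[OF g_summable, of "{m}"] g_nonneg by simp

lemma u_continuous: "continuous_on UNIV (\<lambda>t. u t m)"
  by (intro continuous_at_imp_continuous_on ballI coord_sol_isCont[OF sol])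

lemma jac_u_continuous: "continuous_on UNIV (\<lambda>t. jac a \<omega> (u t) m)"
  by (intro continuous_at_imp_continuous_on ballI coord_sol_isCont[OF jac_sol])

text \<open>The averages are uniformly bounded over a countable set of index pairs, so a diagonal
  subsequence converges in all entries at once. The limit may depend on the subsequence, hence the
  times are recorded together with it.\<close>

lemma averaged_kernel_exists:
  "\<exists>T K. (\<forall>j::nat. T j > 0) \<and> filterlim T at_top sequentially \<and>
     (\<forall>m k. (\<lambda>j. avg (T j) (\<lambda>t. u t m * cnj (u t k))) \<longlonglongrightarrow> K m k)"
proof -
  define f where "f j = (\<lambda>(m, k). avg (real (Suc j)) (\<lambda>t. u t m * cnj (u t k)))" for j
  have "cmod (f j p) \<le> infsum g UNIV * infsum g UNIV" for j p
  proof -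
    obtain m k where p: "p = (m, k)" by (cases p)
    have "cmod (u t m * cnj (u t k)) \<le> infsum g UNIV * infsum g UNIV" for t
      unfolding norm_mult complex_mod_cnj
      by (intro mult_mono order_trans[OF u_le g_le] order_trans[OF g_nonneg g_le]) auto
    then show ?thesis unfolding f_def p prod.case
      by (intro avg_bound continuous_intros u_continuous) auto
  qed
  then obtain s :: "nat \<Rightarrow> nat" where s: "strict_mono s" "\<And>p. \<exists>y. (\<lambda>j. f (s j) p) \<longlonglongrightarrow> y"
    using function_convergent_subsequence[of "UNIV::(int \<times> int) set" f "infsum g UNIV * infsum g UNIV"]
    by (metis UNIV_I countableI_type)
  then obtain K where K: "\<And>p. (\<lambda>j. f (s j) p) \<longlonglongrightarrow> K p" by metis
  have "filterlim (\<lambda>j. real (Suc (s j))) at_top sequentially"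
    by (rule filterlim_compose[OF filterlim_real_sequentially]
         filterlim_compose[OF filterlim_Suc filterlim_subseq[OF s(1)]])+
  then show ?thesis using K
    by (intro exI[of _ "\<lambda>j. real (Suc (s j))"] exI[of _ "\<lambda>m k. K (m, k)"]) (auto simp: f_def)
qed

end

section \<open>The averaged kernel and its product with J\<close>

locale averaged_orbit = dominated_orbit +
  fixes T :: "nat \<Rightarrow> real" and K :: "int \<Rightarrow> int \<Rightarrow> complex"
  assumes T_pos: "\<And>j. T j > 0" and T_lim: "filterlim T at_top sequentially"
    and K_lim: "\<And>m k. (\<lambda>j. avg (T j) (\<lambda>t. u t m * cnj (u t k))) \<longlonglongrightarrow> K m k"
begin

lemma K_herm: "K m k = cnj (K k m)"
proof (rule LIMSEQ_unique[OF K_lim])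
  have "(\<lambda>t. cnj (u t k * cnj (u t m))) = (\<lambda>t. u t m * cnj (u t k))" by (simp add: mult.commute)
  then show "(\<lambda>j. avg (T j) (\<lambda>t. u t m * cnj (u t k))) \<longlonglongrightarrow> cnj (K k m)"
    using tendsto_cnj[OF K_lim[of k m]] unfolding avg_cnj[symmetric] by simp
qed

lemma K_le: "cmod (K m k) \<le> g m * g k"
proof (rule LIMSEQ_le_const2[OF tendsto_norm[OF K_lim]])
  have "cmod (u t m * cnj (u t k)) \<le> g m * g k" for t
    unfolding norm_mult complex_mod_cnj by (intro mult_mono u_le g_nonneg) auto
  then show "\<exists>N. \<forall>j\<ge>N. cmod (avg (T j) (\<lambda>t. u t m * cnj (u t k))) \<le> g m * g k"
    by (intro exI[of _ 0] allI impI avg_bound continuous_intros u_continuous T_pos)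
qed

lemma jac_K_lim_left:
  "(\<lambda>j. avg (T j) (\<lambda>t. jac a \<omega> (u t) m * cnj (u t k))) \<longlonglongrightarrow> jac a \<omega> (\<lambda>m'. K m' k) m"
proof -
  have "avg S (\<lambda>t. jac a \<omega> (u t) m * cnj (u t k)) = jac a \<omega> (\<lambda>m'. avg S (\<lambda>t. u t m' * cnj (u t k))) m" for S
  proof -
    have c: "continuous_on UNIV (\<lambda>t. z * (u t m' * cnj (u t k)))" for z m'
      by (intro continuous_intros u_continuous)
    have "(\<lambda>t. jac a \<omega> (u t) m * cnj (u t k)) =
      (\<lambda>t. (of_real (a m) * (u t (m + 1) * cnj (u t k)) + of_real (a (m - 1)) * (u t (m - 1) * cnj (u t k)))
        + of_real (\<omega> m) * (u t m * cnj (u t k)))"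
      by (simp add: jac_def algebra_simps)
    then show ?thesis
      unfolding jac_def by (simp only: avg_add[OF continuous_on_add[OF c c] c] avg_add[OF c c] avg_mult)
  qed
  note eq = this
  show ?thesis unfolding eq unfolding jac_def by (intro tendsto_intros K_lim)
qed

lemma jac_K_lim_right:
  "(\<lambda>j. avg (T j) (\<lambda>t. u t m * cnj (jac a \<omega> (u t) k))) \<longlonglongrightarrow> jac a \<omega> (K m) k"
proof -
  have 1: "(\<lambda>t. cnj (jac a \<omega> (u t) k * cnj (u t m))) = (\<lambda>t. u t m * cnj (jac a \<omega> (u t) k))"
    by (simp add: mult.commute)
  have 2: "cnj (jac a \<omega> (\<lambda>k'. K k' m) k) = jac a \<omega> (K m) k"
    unfolding jac_cnj[symmetric] K_herm[of m, abs_def, symmetric] by (simp add: K_herm[symmetric])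
  show ?thesis using tendsto_cnj[OF jac_K_lim_left[of k m]] unfolding avg_cnj[symmetric] 1 2 .
qed

lemma jac_K_commute: "jac a \<omega> (\<lambda>m'. K m' k) m = jac a \<omega> (K m) k"
proof -
  let ?l = "\<lambda>t. jac a \<omega> (u t) m * cnj (u t k)" and ?r = "\<lambda>t. u t m * cnj (jac a \<omega> (u t) k)"
  have d: "((\<lambda>t. u t m * cnj (u t k)) has_vector_derivative (- \<i> * ?l t + \<i> * ?r t)) (at t)" for t
    using has_vector_derivative_mult[OF coord_sol_deriv[OF sol, of m t] has_vector_derivative_cnj[OF coord_sol_deriv[OF sol, of k t]]]
    by (simp add: algebra_simps)
  have 0: "(\<lambda>j. avg (T j) (\<lambda>t. - \<i> * ?l t + \<i> * ?r t)) \<longlonglongrightarrow> 0"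
  proof (rule avg_derivative_tendsto[OF d _ T_lim])
    show "cmod (u t m * cnj (u t k)) \<le> g m * g k" for t
      unfolding norm_mult complex_mod_cnj by (intro mult_mono u_le g_nonneg) auto
  qed
  have eq: "avg (T j) (\<lambda>t. - \<i> * ?l t + \<i> * ?r t) = - \<i> * avg (T j) ?l + \<i> * avg (T j) ?r" for j
    by (subst avg_add) (simp_all only: avg_mult, (intro continuous_intros u_continuous jac_u_continuous)+)
  have "(\<lambda>j. - \<i> * avg (T j) ?l + \<i> * avg (T j) ?r) \<longlonglongrightarrow>
      - \<i> * jac a \<omega> (\<lambda>m'. K m' k) m + \<i> * jac a \<omega> (K m) k"
    by (intro tendsto_intros jac_K_lim_left jac_K_lim_right)
  from LIMSEQ_unique[OF this 0[unfolded eq]]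
  have "- \<i> * jac a \<omega> (\<lambda>m'. K m' k) m + \<i> * jac a \<omega> (K m) k = 0" .
  then show ?thesis by simp
qed

text \<open>Minkowski's inequality for averages, obtained by duality: the row of averages is paired
  with itself, and Cauchy-Schwarz at each time uses the conserved norm of
  \<open>jac a \<omega> (u t)\<close>. The bound then passes to the limit on each finite set of
  columns.\<close>

lemma jac_K_row:
  assumes F: "finite F"
  shows "(\<Sum>k\<in>F. (cmod (jac a \<omega> (K m) k))\<^sup>2) \<le> (g m * l2norm (jac a \<omega> (u 0)))\<^sup>2"
proof -
  define c where "c = l2norm (jac a \<omega> (u 0))"
  define v where "v t = jac a \<omega> (u t)" for t
  have v: "v t \<in> l2" "l2norm (v t) = c" for t
    unfolding v_def c_def using coord_sol_l2[OF jac_sol] coord_sol_norm_const[OF a_le jac_sol] by auto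
  have c0: "c \<ge> 0" by (simp add: c_def)
  define M where "M j k = avg (T j) (\<lambda>t. u t m * cnj (v t k))" for j k
  have vc: "continuous_on UNIV (\<lambda>t. v t k)" for k unfolding v_def by (rule jac_u_continuous)
  have "(\<Sum>k\<in>F. (cmod (M j k))\<^sup>2) \<le> (g m * c)\<^sup>2" for j
  proof -
    define \<sigma> where "\<sigma> = L2_set (\<lambda>k. cmod (M j k)) F"
    have \<sigma>0: "\<sigma> \<ge> 0" by (simp add: \<sigma>_def)
    have \<sigma>2: "\<sigma>\<^sup>2 = (\<Sum>k\<in>F. (cmod (M j k))\<^sup>2)"
      unfolding \<sigma>_def L2_set_def by (simp add: sum_nonneg)
    have "of_real (\<sigma>\<^sup>2) = (\<Sum>k\<in>F. cnj (M j k) * M j k)"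
      unfolding \<sigma>2 of_real_sum complex_norm_square by (simp add: mult.commute)
    also have "\<dots> = avg (T j) (\<lambda>t. \<Sum>k\<in>F. cnj (M j k) * (u t m * cnj (v t k)))"
      by (subst avg_sum) (auto simp: avg_mult M_def intro!: continuous_intros u_continuous vc F)
    finally have "\<sigma>\<^sup>2 = cmod (avg (T j) (\<lambda>t. \<Sum>k\<in>F. cnj (M j k) * (u t m * cnj (v t k))))"
      by (metis abs_of_nonneg norm_of_real zero_le_power2)
    also have "\<dots> \<le> g m * (\<sigma> * c)"
    proof (rule avg_bound[OF T_pos])
      show "continuous_on UNIV (\<lambda>t. \<Sum>k\<in>F. cnj (M j k) * (u t m * cnj (v t k)))"
        by (intro continuous_intros u_continuous vc)
      fix t
      have "cmod (\<Sum>k\<in>F. cnj (M j k) * (u t m * cnj (v t k))) \<le> (\<Sum>k\<in>F. cmod (cnj (M j k) * (u t m * cnj (v t k))))"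
        by (rule norm_sum)
      also have "\<dots> = cmod (u t m) * (\<Sum>k\<in>F. \<bar>cmod (M j k)\<bar> * \<bar>cmod (v t k)\<bar>)"
        by (simp add: norm_mult sum_distrib_left mult_ac)
      also have "\<dots> \<le> g m * (\<sigma> * L2_set (\<lambda>k. cmod (v t k)) F)"
        unfolding \<sigma>_def by (intro mult_mono u_le L2_set_mult_ineq g_nonneg sum_nonneg) auto
      also have "\<dots> \<le> g m * (\<sigma> * c)"
        using l2_L2_set_le[OF v(1) F, of t] v(2)[of t] by (intro mult_left_mono g_nonneg \<sigma>0) auto
      finally show "cmod (\<Sum>k\<in>F. cnj (M j k) * (u t m * cnj (v t k))) \<le> g m * (\<sigma> * c)" .
    qed
    finally have "\<sigma> * \<sigma> \<le> (g m * c) * \<sigma>" by (simp add: power2_eq_square mult_ac)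
    then have "\<sigma> \<le> g m * c"
      using \<sigma>0 g_nonneg[of m] c0 by (cases "\<sigma> = 0") (auto simp: mult_le_cancel_right)
    then show ?thesis unfolding \<sigma>2[symmetric] using \<sigma>0 by (intro power_mono)
  qed
  moreover have "(\<lambda>j. \<Sum>k\<in>F. (cmod (M j k))\<^sup>2) \<longlonglongrightarrow> (\<Sum>k\<in>F. (cmod (jac a \<omega> (K m) k))\<^sup>2)"
    unfolding M_def v_def by (intro tendsto_intros jac_K_lim_right)
  ultimately show ?thesis unfolding c_def[symmetric] by (intro LIMSEQ_le_const2) auto
qed

sublocale KK: herm_kernel K "\<lambda>m. g m * infsum g UNIV"
proof
  fix m k and F :: "int set"
  show "K m k = cnj (K k m)" by (rule K_herm)
  show "g m * infsum g UNIV \<ge> 0" by (intro mult_nonneg_nonneg g_nonneg infsum_nonneg)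
  show "(\<lambda>m. g m * infsum g UNIV) summable_on UNIV" by (intro summable_on_cmult_left g_summable)
  assume F: "finite F"
  have "L2_set (\<lambda>k. cmod (K m k)) F \<le> (\<Sum>k\<in>F. \<bar>cmod (K m k)\<bar>)" by (rule L2_set_le_sum_abs)
  also have "\<dots> \<le> (\<Sum>k\<in>F. g m * g k)" by (intro sum_mono) (simp add: K_le)
  also have "\<dots> \<le> g m * infsum g UNIV"
    unfolding sum_distrib_left[symmetric] using g_nonneg
    by (intro mult_left_mono finite_sum_le_infsum[OF g_summable F]) auto
  finally have "(L2_set (\<lambda>k. cmod (K m k)) F)\<^sup>2 \<le> (g m * infsum g UNIV)\<^sup>2" by (intro power_mono) auto
  then show "(\<Sum>k\<in>F. (cmod (K m k))\<^sup>2) \<le> (g m * infsum g UNIV)\<^sup>2"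
    unfolding L2_set_def by (simp add: sum_nonneg)
qed

text \<open>The kernel of the product JK. It is Hermitian because J and K commute, and the factor
  \<open>g m\<close> in the row bound makes it compact.\<close>

sublocale MM: herm_kernel "\<lambda>m. jac a \<omega> (K m)" "\<lambda>m. g m * l2norm (jac a \<omega> (u 0))"
proof
  fix m k and F :: "int set"
  have "jac a \<omega> (K m) k = jac a \<omega> (\<lambda>m'. K m' k) m" by (rule jac_K_commute[symmetric])
  also have "(\<lambda>m'. K m' k) = (\<lambda>m'. cnj (K k m'))" by (intro ext K_herm)
  finally show "jac a \<omega> (K m) k = cnj (jac a \<omega> (K k) m)" by (simp add: jac_cnj)
  show "g m * l2norm (jac a \<omega> (u 0)) \<ge> 0" by (intro mult_nonneg_nonneg g_nonneg l2norm_nonneg)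
  show "(\<lambda>m. g m * l2norm (jac a \<omega> (u 0))) summable_on UNIV" by (intro summable_on_cmult_left g_summable)
  show "finite F \<Longrightarrow> (\<Sum>k\<in>F. (cmod (jac a \<omega> (K m) k))\<^sup>2) \<le> (g m * l2norm (jac a \<omega> (u 0)))\<^sup>2"
    by (rule jac_K_row)
qed

lemma jac_KK_ap:
  assumes x: "x \<in> l2"
  shows "jac a \<omega> (KK.ap x) = MM.ap x"
proof
  fix m
  have s: "(\<lambda>k. c * (K m' k * x k)) summable_on UNIV" for c m'
    by (intro summable_on_cmult_right l2_mult_summable KK.row_l2 x)
  have "MM.ap x m = (\<Sum>\<^sub>\<infinity>k. jac a \<omega> (\<lambda>m'. K m' k) m * x k)"
    by (simp add: MM.ap_def jac_K_commute)
  also have "\<dots> = (\<Sum>\<^sub>\<infinity>k. of_real (a m) * (K (m + 1) k * x k) + of_real (a (m - 1)) * (K (m - 1) k * x k)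
      + of_real (\<omega> m) * (K m k * x k))"
    by (simp add: jac_def algebra_simps)
  also have "\<dots> = jac a \<omega> (KK.ap x) m"
    unfolding jac_def KK.ap_def infsum_cmult_right'[symmetric]
    by (subst infsum_add, intro summable_on_add s, rule s, subst infsum_add, rule s, rule s) simp
  finally show "jac a \<omega> (KK.ap x) m = MM.ap x m" by simp
qed

text \<open>Since the rows of JK are square summable, the rows of K lie in the maximal domain of J,
  and Green's formula moves J from the vector to the row.\<close>

lemma KK_ap_jac:
  assumes x: "x \<in> l2" "jac a \<omega> x \<in> l2"
  shows "KK.ap (jac a \<omega> x) = MM.ap x"
proof
  fix m
  show "KK.ap (jac a \<omega> x) m = MM.ap x m"
    unfolding KK.ap_def MM.ap_def
    by (rule jac_green[OF a_le KK.row_l2(1) MM.row_l2(1) x, symmetric])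
qed

text \<open>K maps an eigenvector of J to an eigenvector for the same eigenvalue or to zero, and
  symmetry moves K across the inner product.\<close>

lemma KK_ap_eig_orth:
  assumes "x \<in> eig_orth a \<omega>"
  shows "KK.ap x \<in> eig_orth a \<omega>"
  unfolding eig_orth_def mem_Collect_eq
proof (intro conjI ballI allI impI)
  have x: "x \<in> l2" using assms by (simp add: eig_orth_def)
  show "KK.ap x \<in> l2" by (rule KK.ap_l2(1)[OF x])
  fix e \<zeta> assume e: "e \<in> l2" "jac a \<omega> e = (\<lambda>n. \<zeta> * e n)"
  have je: "jac a \<omega> e \<in> l2" unfolding e(2) by (rule l2_scale[OF e(1)])
  have "jac a \<omega> (KK.ap e) = KK.ap (jac a \<omega> e)" using jac_KK_ap[OF e(1)] KK_ap_jac[OF e(1) je] by simp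
  also have "\<dots> = (\<lambda>n. \<zeta> * KK.ap e n)" unfolding e(2) by (rule KK.ap_scale)
  finally have "l2inner (KK.ap e) x = 0" using assms KK.ap_l2(1)[OF e(1)] unfolding eig_orth_def by blast
  then show "l2inner e (KK.ap x) = 0" using KK.ap_sym[OF x e(1)] by simp
qed

lemma KK_ap_eq_0:
  assumes \<psi>: "\<psi> \<in> eig_orth a \<omega>"
  shows "KK.ap \<psi> = (\<lambda>_. 0)"
proof (rule ccontr)
  assume nz: "KK.ap \<psi> \<noteq> (\<lambda>_. 0)"
  let ?S = "eig_orth a \<omega>"
  have Sl2: "?S \<subseteq> l2" by (auto simp: eig_orth_def)
  have "\<exists>x\<in>?S. x \<noteq> (\<lambda>_. 0) \<and> (\<exists>\<kappa>::real. \<kappa> \<noteq> 0 \<and> KK.ap x = (\<lambda>m. of_real \<kappa> * x m))"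
  proof (rule KK.eigenvector_exists[OF Sl2 _ _ _ _ \<psi> nz])
    show "y \<in> ?S" if y: "\<And>j::nat. X j \<in> ?S" "\<And>j. l2norm (X j) \<le> 1" "\<And>m. (\<lambda>j. X j m) \<longlonglongrightarrow> y m" for X y
      by (rule eig_orth_closed[OF y])
  qed (rule eig_orth_add eig_orth_scale KK_ap_eig_orth; assumption)+
  then obtain x and \<kappa> :: real where x: "x \<in> ?S" "x \<noteq> (\<lambda>_. 0)" and \<kappa>: "\<kappa> \<noteq> 0" "KK.ap x = (\<lambda>m. of_real \<kappa> * x m)"
    by blast
  \<comment> \<open>An eigenspace of K within the complement. On it JK is \<open>\<kappa>\<close>
    times J, so J is bounded there; it also maps the space into itself.\<close>
  define S' where "S' = {x \<in> ?S. KK.ap x = (\<lambda>m. of_real \<kappa> * x m)}"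
  have S'l2: "S' \<subseteq> l2" using Sl2 by (auto simp: S'_def)
  have MJ: "MM.ap y = (\<lambda>m. of_real \<kappa> * jac a \<omega> y m)" if "y \<in> S'" for y
  proof -
    have "MM.ap y = jac a \<omega> (KK.ap y)" using that S'l2 by (intro jac_KK_ap[symmetric]) auto
    also have "\<dots> = (\<lambda>m. of_real \<kappa> * jac a \<omega> y m)" using that by (auto simp: S'_def jac_scale)
    finally show ?thesis .
  qed
  have no_eig: False if y: "y \<in> S'" "y \<noteq> (\<lambda>_. 0)" "MM.ap y = (\<lambda>m. of_real \<mu> * y m)" for y \<mu>
  proof -
    have "jac a \<omega> y = (\<lambda>m. of_real (\<mu> / \<kappa>) * y m)"
    proof
      fix m
      have "of_real \<kappa> * jac a \<omega> y m = of_real \<mu> * y m" using MJ[OF y(1)] y(3) by (metis)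
      then show "jac a \<omega> y m = of_real (\<mu> / \<kappa>) * y m" using \<kappa>(1) by (simp add: field_simps)
    qed
    from eig_orth_no_eigenvector[OF _ this] show False using y(1,2) by (auto simp: S'_def)
  qed
  have xS': "x \<in> S'" using x \<kappa> by (simp add: S'_def)
  have jl2: "jac a \<omega> y \<in> l2" if y: "y \<in> S'" for y
  proof -
    have "(\<lambda>m. of_real (1 / \<kappa>) * MM.ap y m) \<in> l2" using y S'l2 by (intro l2_scale MM.ap_l2(1)) auto
    then show ?thesis unfolding MJ[OF y] using \<kappa>(1) by simp
  qed
  \<comment> \<open>If JK annihilates \<open>x\<close>, then \<open>x\<close> is an eigenvector of J
    for the eigenvalue zero. Otherwise the variational theorem applies to JK on
    \<open>S'\<close>.\<close>
  show False
  proof (cases "MM.ap x = (\<lambda>_. 0)")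
    case True
    then show False using no_eig[OF xS' x(2), of 0] by simp
  next
    case False
    have "\<exists>y\<in>S'. y \<noteq> (\<lambda>_. 0) \<and> (\<exists>\<mu>::real. \<mu> \<noteq> 0 \<and> MM.ap y = (\<lambda>m. of_real \<mu> * y m))"
    proof (rule MM.eigenvector_exists[OF S'l2 _ _ _ _ xS' False])
      show "(\<lambda>k. y k + z k) \<in> S'" if "y \<in> S'" "z \<in> S'" for y z
      proof -
        have "KK.ap (\<lambda>k. y k + z k) = (\<lambda>m. KK.ap y m + KK.ap z m)" using that S'l2 by (intro KK.ap_add) auto
        then show ?thesis using that by (auto simp: S'_def distrib_left intro: eig_orth_add)
      qed
      show "(\<lambda>k. c * y k) \<in> S'" if "y \<in> S'" for c y
        using that by (auto simp: S'_def KK.ap_scale intro: eig_orth_scale)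
      show "MM.ap y \<in> S'" if y: "y \<in> S'" for y
      proof -
        have yl2: "y \<in> l2" and yS: "y \<in> ?S" using y S'l2 by (auto simp: S'_def)
        have J: "jac a \<omega> y \<in> ?S" unfolding eig_orth_def mem_Collect_eq
        proof (intro conjI ballI allI impI jl2[OF y])
          fix e \<zeta> assume e: "e \<in> l2" "jac a \<omega> e = (\<lambda>n. \<zeta> * e n)"
          have je: "jac a \<omega> e \<in> l2" unfolding e(2) by (rule l2_scale[OF e(1)])
          have "l2inner e (jac a \<omega> y) = l2inner (jac a \<omega> e) y"
            by (rule jac_symmetric[OF a_le e(1) je yl2 jl2[OF y], symmetric])
          also have "\<dots> = 0" unfolding e(2) l2inner_scale_left using yS e unfolding eig_orth_def by auto
          finally show "l2inner e (jac a \<omega> y) = 0" .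
        qed
        have "KK.ap (jac a \<omega> y) = (\<lambda>m. of_real \<kappa> * jac a \<omega> y m)"
          unfolding KK_ap_jac[OF yl2 jl2[OF y]] by (rule MJ[OF y])
        then have "jac a \<omega> y \<in> S'" using J by (simp add: S'_def)
        then show ?thesis unfolding MJ[OF y]
          by (auto simp: S'_def KK.ap_scale intro: eig_orth_scale)
      qed
      show "y \<in> S'" if y: "\<And>j::nat. X j \<in> S'" "\<And>j. l2norm (X j) \<le> 1" "\<And>m. (\<lambda>j. X j m) \<longlonglongrightarrow> y m" for X y
      proof -
        have X: "X j \<in> l2" "X j \<in> ?S" "KK.ap (X j) = (\<lambda>m. of_real \<kappa> * X j m)" for j
          using y(1)[of j] S'l2 by (auto simp: S'_def)
        have "KK.ap y m = of_real \<kappa> * y m" for m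
        proof (rule LIMSEQ_unique)
          show "(\<lambda>j. KK.ap (X j) m) \<longlonglongrightarrow> KK.ap y m" by (rule KK.ap_tendsto(1)[OF X(1) y(2,3)])
          show "(\<lambda>j. KK.ap (X j) m) \<longlonglongrightarrow> of_real \<kappa> * y m" unfolding X(3) by (intro tendsto_intros y(3))
        qed
        moreover have "y \<in> ?S" by (rule eig_orth_closed[OF X(2) y(2,3)])
        ultimately show ?thesis by (auto simp: S'_def)
      qed
    qed
    then show False using no_eig by blast
  qed
qed

end

section \<open>Recurrence and completeness of the eigenvectors\<close>

context averaged_orbit
begin

text \<open>Averages converge to \<open>K\<close> only entry by entry, so the pairing with
  \<open>\<psi>\<close> is truncated to a window. The limit in time comes first, with the window
  fixed, and the window grows afterwards.\<close>

lemma orbit_start_orth: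
  assumes \<psi>: "\<psi> \<in> eig_orth a \<omega>"
  shows "l2inner \<psi> (u 0) = 0"
proof (rule ccontr)
  assume nz: "l2inner \<psi> (u 0) \<noteq> 0"
  have \<psi>l2: "\<psi> \<in> l2" using \<psi> by (simp add: eig_orth_def)
  have ul2: "u t \<in> l2" for t by (rule coord_sol_l2[OF sol])
  define h where "h m = cmod (\<psi> m) * g m" for m
  have h0: "h m \<ge> 0" for m by (simp add: h_def g_nonneg)
  have hs: "h summable_on UNIV"
    by (rule summable_on_comparison_test[OF summable_on_cmult_right[OF g_summable, of "l2norm \<psi>"]])
       (auto simp: h_def g_nonneg intro: mult_right_mono l2_coord_le[OF \<psi>l2])
  define P where "P = infsum h UNIV"
  define I where "I N = {- int N..int N}" for N
  have I: "finite (I N)" for N by (simp add: I_def)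
  define R where "R N = P - sum h (I N)" for N
  have R0: "R \<longlonglongrightarrow> 0"
    using tendsto_diff[OF tendsto_const infsum_int_tendsto[OF hs], of P] by (simp add: R_def[abs_def] P_def I_def)
  have P0: "P \<ge> 0" unfolding P_def by (rule infsum_nonneg[OF h0])
  define f where "f t = l2inner \<psi> (u t)" for t
  define fN where "fN N t = (\<Sum>m\<in>I N. cnj (\<psi> m) * u t m)" for N t
  have ffN: "cmod (f t - fN N t) \<le> R N" for t N
    unfolding f_def fN_def l2inner_def R_def P_def
    by (rule infsum_tail_bound[OF hs _ I]) (auto simp: h_def norm_mult intro: mult_left_mono u_le)
  define Q where "Q N = (\<Sum>m\<in>I N. \<Sum>k\<in>I N. cnj (\<psi> m) * \<psi> k * K m k)" for N
  have fNb: "cmod (fN N t) \<le> P" for N t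
  proof -
    have "cmod (fN N t) \<le> (\<Sum>m\<in>I N. h m)"
      unfolding fN_def by (rule order_trans[OF norm_sum sum_mono]) (auto simp: h_def norm_mult intro: mult_left_mono u_le)
    also have "\<dots> \<le> P" unfolding P_def by (rule finite_sum_le_infsum[OF hs I]) (auto simp: h0)
    finally show ?thesis .
  qed
  have fNc: "continuous_on UNIV (fN N)" for N
    unfolding fN_def by (intro continuous_intros u_continuous)
  have avgQ: "(\<lambda>j. avg (T j) (\<lambda>t. fN N t * cnj (fN N t))) \<longlonglongrightarrow> Q N" for N
  proof -
    have "(\<lambda>t. fN N t * cnj (fN N t)) = (\<lambda>t. \<Sum>m\<in>I N. \<Sum>k\<in>I N. cnj (\<psi> m) * \<psi> k * (u t m * cnj (u t k)))"
      unfolding fN_def cnj_sum sum_product by (simp add: mult_ac)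
    moreover have "avg S (\<lambda>t. \<Sum>m\<in>I N. \<Sum>k\<in>I N. cnj (\<psi> m) * \<psi> k * (u t m * cnj (u t k)))
       = (\<Sum>m\<in>I N. \<Sum>k\<in>I N. cnj (\<psi> m) * \<psi> k * avg S (\<lambda>t. u t m * cnj (u t k)))" for S
    proof -
      have "avg S (\<lambda>t. \<Sum>m\<in>I N. \<Sum>k\<in>I N. cnj (\<psi> m) * \<psi> k * (u t m * cnj (u t k)))
        = (\<Sum>m\<in>I N. avg S (\<lambda>t. \<Sum>k\<in>I N. cnj (\<psi> m) * \<psi> k * (u t m * cnj (u t k))))"
        by (rule avg_sum[OF _ I]) (intro continuous_intros u_continuous)
      also have "\<dots> = (\<Sum>m\<in>I N. \<Sum>k\<in>I N. avg S (\<lambda>t. cnj (\<psi> m) * \<psi> k * (u t m * cnj (u t k))))"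
        by (intro sum.cong refl avg_sum[OF _ I]) (intro continuous_intros u_continuous)
      finally show ?thesis by (simp only: avg_mult)
    qed
    ultimately show ?thesis unfolding Q_def by (simp only:) (intro tendsto_intros K_lim)
  qed
  have Qb: "cmod (Q N) \<le> P * R N" for N
  proof -
    \<comment> \<open>The full row sum against \<open>\<psi>\<close> is zero, so the truncated one
      is no larger than the tail it omits.\<close>
    have row: "cmod (\<Sum>k\<in>I N. K m k * \<psi> k) \<le> g m * R N" for m
    proof -
      have "cmod ((\<Sum>\<^sub>\<infinity>k. K m k * \<psi> k) - (\<Sum>k\<in>I N. K m k * \<psi> k)) \<le> infsum (\<lambda>k. g m * h k) UNIV - (\<Sum>k\<in>I N. g m * h k)"
      proof (rule infsum_tail_bound[OF summable_on_cmult_right[OF hs] _ I])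
        fix k show "cmod (K m k * \<psi> k) \<le> g m * h k"
          using mult_right_mono[OF K_le[of m k], of "cmod (\<psi> k)"] by (simp add: h_def norm_mult mult_ac)
      qed
      moreover have "(\<Sum>\<^sub>\<infinity>k. K m k * \<psi> k) = 0" using KK_ap_eq_0[OF \<psi>] by (metis KK.ap_def)
      moreover have "infsum (\<lambda>k. g m * h k) UNIV - (\<Sum>k\<in>I N. g m * h k) = g m * R N"
        by (simp add: R_def P_def infsum_cmult_right' sum_distrib_left right_diff_distrib)
      ultimately show ?thesis by simp
    qed
    have RN: "R N \<ge> 0" unfolding R_def P_def using finite_sum_le_infsum[OF hs I, of N] h0 by simp
    have "Q N = (\<Sum>m\<in>I N. cnj (\<psi> m) * (\<Sum>k\<in>I N. K m k * \<psi> k))"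
      unfolding Q_def sum_distrib_left by (simp add: mult_ac)
    also have "cmod \<dots> \<le> (\<Sum>m\<in>I N. h m * R N)"
    proof (rule order_trans[OF norm_sum sum_mono])
      fix m show "cmod (cnj (\<psi> m) * (\<Sum>k\<in>I N. K m k * \<psi> k)) \<le> h m * R N"
        using mult_left_mono[OF row[of m], of "cmod (\<psi> m)"] by (simp add: h_def norm_mult mult_ac)
    qed
    also have "\<dots> = (\<Sum>m\<in>I N. h m) * R N" by (simp add: sum_distrib_right)
    also have "\<dots> \<le> P * R N"
      unfolding P_def by (intro mult_right_mono RN finite_sum_le_infsum[OF hs I]) (auto simp: h0)
    finally show ?thesis .
  qed
  define \<beta> where "\<beta> = cmod (f 0)"
  have \<beta>: "\<beta> > 0" using nz by (simp add: \<beta>_def f_def)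
  define M where "M = l2norm \<psi> + 1"
  have n1: "M > 0" "l2norm \<psi> \<le> M" using l2norm_nonneg[of \<psi>] unfolding M_def by linarith+
  \<comment> \<open>With this choice, replacing \<open>u 0\<close> by a point within
    \<open>\<epsilon>\<close> of it changes the pairing by at most a quarter of its initial size
    \<open>\<beta>\<close>.\<close>
  define \<epsilon> where "\<epsilon> = \<beta> / (4 * M)"
  have \<epsilon>: "\<epsilon> > 0" using \<beta> n1 by (simp add: \<epsilon>_def)
  have \<epsilon>': "l2norm \<psi> * \<epsilon> \<le> \<beta> / 4"
  proof -
    have "l2norm \<psi> * \<epsilon> \<le> M * \<epsilon>" using \<epsilon> n1 by (intro mult_right_mono) auto
    also have "\<dots> = \<beta> / 4" using n1 by (simp add: \<epsilon>_def)
    finally show ?thesis .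
  qed
  obtain F where F: "finite F" "\<And>t. \<exists>s\<in>F. l2norm (\<lambda>m. u t m - u s m) \<le> \<epsilon>"
    using dominated_finite_net[where u=u and g=g, OF g_summable u_le \<epsilon>] by blast
  have rec: "\<exists>s\<in>F. cmod (f (t + - s)) \<ge> 3 / 4 * \<beta>" for t
  proof -
    obtain s where s: "s \<in> F" "l2norm (\<lambda>m. u t m - u s m) \<le> \<epsilon>" using F(2) by blast
    \<comment> \<open>The solution \<open>w\<close> is \<open>u t - u s\<close> at time
      \<open>s\<close> and \<open>u (t - s) - u 0\<close> at time zero; conservation of its norm
      turns closeness of \<open>u t\<close> to a net point into a return near the start.\<close>
    define w where "w r m = u (r + (t - s)) m - u r m" for r m
    have ws: "coord_sol a \<omega> w"
      unfolding w_def[abs_def] by (intro coord_sol_diff coord_sol_shift sol)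
    have "l2norm (w 0) = l2norm (w s)" using coord_sol_norm_const[OF a_le ws, of s] by simp
    also have "\<dots> \<le> \<epsilon>" using s(2) by (simp add: w_def[abs_def])
    finally have w0: "l2norm (w 0) \<le> \<epsilon>" .
    have "u (t + - s) = (\<lambda>m. w 0 m + u 0 m)" by (simp add: w_def)
    then have "f (t + - s) = l2inner \<psi> (w 0) + f 0"
      unfolding f_def by (simp only: l2inner_add_right[OF \<psi>l2 coord_sol_l2[OF ws] ul2])
    moreover have "cmod (l2inner \<psi> (w 0)) \<le> \<beta> / 4"
      using order_trans[OF l2inner_bound[OF \<psi>l2 coord_sol_l2[OF ws]] mult_left_mono[OF w0]] \<epsilon>' by (simp add: order_trans)
    ultimately have "cmod (f (t + - s)) \<ge> 3 / 4 * \<beta>"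
      using norm_triangle_ineq4[of "l2inner \<psi> (w 0) + f 0" "l2inner \<psi> (w 0)"] by (simp add: \<beta>_def)
    then show ?thesis using s(1) by blast
  qed
  have "0 < \<beta> / 4" using \<beta> by simp
  from LIMSEQ_D[OF R0 this] obtain N0 where N0': "\<And>N. N \<ge> N0 \<Longrightarrow> norm (R N - 0) < \<beta> / 4" by blast
  have N0: "R N \<le> \<beta> / 4" if "N \<ge> N0" for N
    using N0'[OF that] unfolding diff_0_right real_norm_def by linarith
  have main: "(\<beta> / 2)\<^sup>2 \<le> real (card F) * (P * R N)" if N: "N \<ge> N0" for N
  proof -
    define q where "q t = fN N t * cnj (fN N t)" for t
    have qc: "continuous_on UNIV q" unfolding q_def by (intro continuous_intros fNc)
    have qs: "continuous_on UNIV (\<lambda>t. q (t + s))" for s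
      by (rule continuous_on_compose2[OF qc]) (auto intro!: continuous_intros)
    have qr: "q t = of_real ((cmod (fN N t))\<^sup>2)" for t unfolding q_def complex_norm_square by simp
    have qb: "cmod (q t) \<le> P * P" for t
      unfolding q_def norm_mult complex_mod_cnj by (intro mult_mono fNb P0) auto
    \<comment> \<open>At every time some shift in \<open>F\<close> makes the pairing large, but
      which one varies with \<open>t\<close>. Summing over \<open>F\<close> gives a lower bound at
      all times, while each shifted term has the same limiting average \<open>Q N\<close>.\<close>
    have lim: "(\<lambda>j. avg (T j) (\<lambda>t. \<Sum>s\<in>F. q (t + - s))) \<longlonglongrightarrow> (\<Sum>s\<in>F. Q N)"
      unfolding avg_sum[OF qs F(1)]
      by (intro tendsto_sum avg_shift_tendsto[OF qc qb T_lim]) (unfold q_def, rule avgQ)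
    have "Re (avg (T j) (\<lambda>t. \<Sum>s\<in>F. q (t + - s))) \<ge> (\<beta> / 2)\<^sup>2" for j
    proof (rule avg_Re_ge[OF T_pos])
      show "continuous_on UNIV (\<lambda>t. \<Sum>s\<in>F. q (t + - s))" by (intro continuous_on_sum qs)
      fix t
      obtain s where s: "s \<in> F" "cmod (f (t + - s)) \<ge> 3 / 4 * \<beta>" using rec by blast
      have "cmod (f (t + - s)) \<le> cmod (f (t + - s) - fN N (t + - s)) + cmod (fN N (t + - s))"
        using norm_triangle_ineq[of "f (t + - s) - fN N (t + - s)" "fN N (t + - s)"] by simp
      then have "\<beta> / 2 \<le> cmod (fN N (t + - s))" using s(2) ffN[of "t + - s" N] N0[OF N] by linarith
      then have "(\<beta> / 2)\<^sup>2 \<le> Re (q (t + - s))" unfolding qr using \<beta> by (simp add: power_mono del: power_divide)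
      also have "\<dots> \<le> (\<Sum>s\<in>F. Re (q (t + - s)))"
        by (rule member_le_sum[OF s(1) _ F(1)]) (simp add: qr)
      finally show "(\<beta> / 2)\<^sup>2 \<le> Re (\<Sum>s\<in>F. q (t + - s))" by simp
    qed
    then have "(\<beta> / 2)\<^sup>2 \<le> Re (\<Sum>s\<in>F. Q N)"
      by (intro LIMSEQ_le_const[OF tendsto_Re[OF lim]]) auto
    also have "\<dots> = real (card F) * Re (Q N)" by simp
    also have "\<dots> \<le> real (card F) * (P * R N)"
      using complex_Re_le_cmod[of "Q N"] Qb[of N] by (intro mult_left_mono) auto
    finally show ?thesis .
  qed
  have "(\<lambda>N. real (card F) * (P * R N)) \<longlonglongrightarrow> real (card F) * (P * 0)" by (intro tendsto_intros R0)
  then have "(\<beta> / 2)\<^sup>2 \<le> real (card F) * (P * 0)" by (rule LIMSEQ_le_const) (use main in blast)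
  then show False using \<beta> by simp
qed

end

text \<open>Domination by \<open>g\<close> is uniform in time, so the orbit may be restarted at
  \<open>t\<close>. The averaging times and the kernel are allowed to change with
  \<open>t\<close>.\<close>

lemma (in dominated_orbit) orbit_orth:
  assumes \<psi>: "\<psi> \<in> eig_orth a \<omega>"
  shows "l2inner \<psi> (u t) = 0"
proof -
  interpret sh: dominated_orbit a \<omega> B "\<lambda>s. u (s + t)" g
    by unfold_locales (rule a_le coord_sol_shift[OF sol] coord_sol_shift[OF jac_sol] g_summable u_le)+
  obtain T K where TK: "\<And>j::nat. T j > 0" "filterlim T at_top sequentially"
     "\<And>m k. (\<lambda>j. avg (T j) (\<lambda>s. u (s + t) m * cnj (u (s + t) k))) \<longlonglongrightarrow> K m k"
    using sh.averaged_kernel_exists by blast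
  interpret av: averaged_orbit a \<omega> B "\<lambda>s. u (s + t)" g T K
    by unfold_locales (rule TK)+
  show ?thesis using av.orbit_start_orth[OF \<psi>] by simp
qed

section \<open>From two adjacent starting sites to all sites\<close>

lemma int_two_step_induct:
  assumes "P 0" "P 1"
    and up: "\<And>n::int. P n \<Longrightarrow> P (n - 1) \<Longrightarrow> P (n + 1)"
    and down: "\<And>n. P n \<Longrightarrow> P (n + 1) \<Longrightarrow> P (n - 1)"
  shows "P n"
proof -
  have pos: "P (int k) \<and> P (int k + 1)" for k
  proof (induction k)
    case (Suc k)
    then show ?case using up[of "int k + 1"] by (simp add: add.commute)
  qed (use assms in auto)
  have neg: "P (- int k) \<and> P (- int k + 1)" for k
  proof (induction k)
    case (Suc k)
    then have "P (- int k - 1)" using down[of "- int k"] by blast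
    moreover have e: "- int (Suc k) = - int k - 1" "- int (Suc k) + 1 = - int k" by auto
    ultimately show ?case unfolding e(2) unfolding e(1) using Suc by blast
  qed (use assms in auto)
  show ?thesis using pos[of "nat n"] neg[of "nat (- n)"] by (cases "n \<ge> 0") auto
qed

text \<open>Orthogonality at all times annihilates the difference quotient, hence also its strong
  limit. Up to a factor this limit is J applied to the propagator, and its expansion in the
  propagators of the neighbouring sites gives the recurrence.\<close>

lemma propagator_orth_step:
  assumes a: "\<And>n. \<bar>a n\<bar> \<le> B" and \<psi>: "\<psi> \<in> l2" and 0: "\<And>t. l2inner \<psi> (propagator a \<omega> n t) = 0"
  shows "of_real (a n) * l2inner \<psi> (propagator a \<omega> (n + 1) t) + of_real (a (n - 1)) * l2inner \<psi> (propagator a \<omega> (n - 1) t) = 0"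
proof -
  let ?u = "propagator a \<omega>"
  have l: "?u n t \<in> l2" for n t by (rule propagator_l2[OF a])
  define v where "v = (\<lambda>m. of_real (a n) * ?u (n + 1) t m + of_real (a (n - 1)) * ?u (n - 1) t m + of_real (\<omega> n) * ?u n t m)"
  have vl: "v \<in> l2" unfolding v_def by (intro l2_add l2_scale l)
  define q where "q h = (\<lambda>m. (?u n (t + h) m - ?u n t m) / of_real h + \<i> * v m)" for h
  have lim: "((\<lambda>h. l2norm (q h)) \<longlongrightarrow> 0) (at 0)"
    using propagator_strong_derivative(1)[where a=a and B=B and \<omega>=\<omega> and n=n and t=t, OF a] by (simp add: q_def v_def)
  have qeq: "q h = (\<lambda>m. (1 / of_real h) * (?u n (t + h) m + (-1) * ?u n t m) + \<i> * v m)" for h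
    by (simp add: q_def)
  have ql: "q h \<in> l2" for h unfolding qeq by (intro l2_add l2_scale l vl)
  have "l2inner \<psi> (q h) = \<i> * l2inner \<psi> v" for h
    unfolding qeq by (simp only: l2inner_add_right \<psi> l2_add l2_scale l vl l2inner_scale_right 0) simp
  then have "cmod (l2inner \<psi> v) \<le> l2norm \<psi> * l2norm (q h)" for h
    using l2inner_bound[OF \<psi> ql, of h] by (simp add: norm_mult)
  moreover have "((\<lambda>h. l2norm \<psi> * l2norm (q h)) \<longlongrightarrow> l2norm \<psi> * 0) (at 0)" by (intro tendsto_intros lim)
  ultimately have "cmod (l2inner \<psi> v) \<le> l2norm \<psi> * 0"
    by (intro tendsto_lowerbound[where F="at (0::real)"]) auto
  then have "l2inner \<psi> v = 0" by simp
  then show ?thesis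
    unfolding v_def by (simp only: l2inner_add_right \<psi> l2_add l2_scale l l2inner_scale_right 0) simp
qed

lemma eig_orth_trivial:
  assumes a: "\<And>n. \<bar>a n\<bar> \<le> B" and a0: "\<And>n. a n \<noteq> 0"
    and g: "g summable_on UNIV" and dom: "\<And>t m. cmod (propagator a \<omega> 0 t m) \<le> g m" "\<And>t m. cmod (propagator a \<omega> 1 t m) \<le> g m"
    and \<psi>: "\<psi> \<in> eig_orth a \<omega>"
  shows "\<psi> = (\<lambda>_. 0)"
proof -
  let ?u = "propagator a \<omega>"
  have \<psi>l2: "\<psi> \<in> l2" using \<psi> by (simp add: eig_orth_def)
  have orb: "l2inner \<psi> (?u n t) = 0" if "\<And>t m. cmod (?u n t m) \<le> g m" for n t
  proof -
    note sd = propagator_strong_derivative[where a=a and B=B and \<omega>=\<omega> and n=n, OF a]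
    have "coord_sol a \<omega> (\<lambda>t. jac a \<omega> (?u n t))" unfolding sd(2) by (rule sd(3))
    then interpret dominated_orbit a \<omega> B "?u n" g
      using a propagator_coord_sol[where a=a and B=B and \<omega>=\<omega> and n=n, OF a] g that by unfold_locales
    show ?thesis by (rule orbit_orth[OF \<psi>])
  qed
  define Z where "Z n \<longleftrightarrow> (\<forall>t. l2inner \<psi> (?u n t) = 0)" for n
  have Z01: "Z 0" "Z 1" unfolding Z_def using orb dom by auto
  note step = propagator_orth_step[where a=a and B=B and \<omega>=\<omega>, OF a \<psi>l2]
  have up: "Z (n + 1)" if "Z n" "Z (n - 1)" for n
    unfolding Z_def
  proof
    fix t show "l2inner \<psi> (?u (n + 1) t) = 0" using step[of n t] that a0[of n] by (simp add: Z_def)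
  qed
  have down: "Z (n - 1)" if "Z n" "Z (n + 1)" for n
    unfolding Z_def
  proof
    fix t show "l2inner \<psi> (?u (n - 1) t) = 0" using step[of n t] that a0[of "n - 1"] by (simp add: Z_def)
  qed
  have Z: "Z n" for n by (rule int_two_step_induct[where P=Z, OF Z01 up down])
  show ?thesis
  proof
    fix m
    have "l2inner \<psi> (kdelta m) = 0"
      using Z[of m] propagator_0[where a=a and B=B and \<omega>=\<omega> and n=m, OF a] unfolding Z_def by metis
    then show "\<psi> m = 0" using l2inner_kdelta[of m \<psi>] l2inner_commute[of \<psi> "kdelta m"] by simp
  qed
qed

section \<open>Simplicity of eigenvalues and the orthonormal family of eigenvectors\<close>

lemma eigenvector_zero:
  assumes a0: "\<And>n. a n \<noteq> 0" and e: "jac a \<omega> e = (\<lambda>n. \<zeta> * e n)" and z: "e 0 = 0" "e 1 = 0"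
  shows "e = (\<lambda>_. 0)"
proof -
  have eq: "of_real (a n) * e (n + 1) + of_real (a (n - 1)) * e (n - 1) + of_real (\<omega> n) * e n = \<zeta> * e n" for n
    using e unfolding jac_def fun_eq_iff by blast
  have up: "e (n + 1) = 0" if "e n = 0" "e (n - 1) = 0" for n
    using eq[of n] that a0[of n] by simp
  have down: "e (n - 1) = 0" if "e n = 0" "e (n + 1) = 0" for n
    using eq[of n] that a0[of "n - 1"] by simp
  have "e n = 0" for n by (rule int_two_step_induct[where P="\<lambda>n. e n = 0", OF z up down])
  then show ?thesis by auto
qed

text \<open>The Wronskian of the two solutions is constant and tends to zero, so it vanishes. Their
  values at the sites 0 and 1 are then proportional, and these two values determine a
  solution.\<close>

lemma eigenvalue_simple:
  assumes a: "\<And>n. \<bar>a n\<bar> \<le> B" and a0: "\<And>n. a n \<noteq> 0"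
    and x: "x \<in> l2" "jac a \<omega> x = (\<lambda>n. \<zeta> * x n)" and y: "y \<in> l2" "jac a \<omega> y = (\<lambda>n. \<zeta> * y n)" "y \<noteq> (\<lambda>_. 0)"
  shows "\<exists>c. x = (\<lambda>n. c * y n)"
proof -
  have "wronski a x y k = wronski a x y (k - 1)" for k
    using jac_wronski[of a \<omega> x k y] x(2) y(2) by simp
  then have st: "wronski a x y (k + 1) = wronski a x y k" for k by (metis add_diff_cancel_right')
  have "wronski a x y (int N) = wronski a x y 0" for N
  proof (induction N)
    case (Suc N)
    then show ?case using st[of "int N"] by (simp add: add.commute)
  qed simp
  then have "(\<lambda>N::nat. wronski a x y 0) \<longlonglongrightarrow> 0"
    using wronski_tendsto_zero(1)[where a=a and B=B and c=0, OF a x(1) y(1)] by simp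
  then have "wronski a x y 0 = 0" by (simp add: LIMSEQ_const_iff)
  then have w: "x 1 * y 0 = x 0 * y 1" using a0[of 0] by (simp add: wronski_def)
  have "\<exists>c. x 0 = c * y 0 \<and> x 1 = c * y 1"
  proof (cases "y 0 = 0")
    case False
    then show ?thesis using w by (intro exI[of _ "x 0 / y 0"]) (simp add: field_simps)
  next
    case True
    then have "y 1 \<noteq> 0" using eigenvector_zero[OF a0 y(2)] y(3) by blast
    then show ?thesis using w True by (intro exI[of _ "x 1 / y 1"]) simp
  qed
  then obtain c where c: "x 0 = c * y 0" "x 1 = c * y 1" by blast
  define z where "z = (\<lambda>n. x n + (- c) * y n)"
  have "jac a \<omega> z = (\<lambda>n. \<zeta> * z n)"
  proof
    fix n show "jac a \<omega> z n = \<zeta> * z n"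
      unfolding z_def jac_add jac_scale x(2) y(2) by (simp add: algebra_simps)
  qed
  then have "z = (\<lambda>_. 0)" by (rule eigenvector_zero[OF a0]) (simp_all add: z_def c)
  then have "x = (\<lambda>n. c * y n)" unfolding z_def fun_eq_iff by simp
  then show ?thesis by blast
qed

lemma eigenvalue_real:
  assumes a: "\<And>n. \<bar>a n\<bar> \<le> B" and x: "x \<in> l2" "jac a \<omega> x = (\<lambda>n. \<zeta> * x n)" "x \<noteq> (\<lambda>_. 0)"
  shows "cnj \<zeta> = \<zeta>"
proof -
  have jx: "jac a \<omega> x \<in> l2" unfolding x(2) by (rule l2_scale[OF x(1)])
  have "l2inner (jac a \<omega> x) x = l2inner x (jac a \<omega> x)" by (rule jac_symmetric[OF a x(1) jx x(1) jx])
  then have "cnj \<zeta> * l2inner x x = \<zeta> * l2inner x x"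
    unfolding x(2) l2inner_scale_left l2inner_scale_right .
  moreover have "l2inner x x \<noteq> 0" using l2inner_self[OF x(1)] l2norm_eq_0D[OF x(1)] x(3) by auto
  ultimately show ?thesis by simp
qed

lemma eigenvectors_orth:
  assumes a: "\<And>n. \<bar>a n\<bar> \<le> B"
    and x: "x \<in> l2" "jac a \<omega> x = (\<lambda>n. \<zeta> * x n)" and y: "y \<in> l2" "jac a \<omega> y = (\<lambda>n. \<xi> * y n)" and ne: "\<zeta> \<noteq> \<xi>"
  shows "l2inner x y = 0"
proof (cases "x = (\<lambda>_. 0)")
  case True
  then show ?thesis by (simp add: l2inner_def)
next
  case False
  have jx: "jac a \<omega> x \<in> l2" unfolding x(2) by (rule l2_scale[OF x(1)])
  have jy: "jac a \<omega> y \<in> l2" unfolding y(2) by (rule l2_scale[OF y(1)])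
  have "l2inner (jac a \<omega> x) y = l2inner x (jac a \<omega> y)" by (rule jac_symmetric[OF a x(1) jx y(1) jy])
  then have "cnj \<zeta> * l2inner x y = \<xi> * l2inner x y"
    unfolding x(2) y(2) l2inner_scale_left l2inner_scale_right .
  then show ?thesis using eigenvalue_real[OF a x False] ne by auto
qed

text \<open>All normalised eigenvectors together would not be orthogonal, since each comes with its
  multiples by phases. One vector is therefore chosen for each eigenvalue, and simplicity shows that
  a vector orthogonal to these is orthogonal to every eigenvector.\<close>

lemma pure_point_spectrumI:
  assumes a: "\<And>n. \<bar>a n\<bar> \<le> B" and a0: "\<And>n. a n \<noteq> 0"
    and triv: "\<And>\<psi>. \<psi> \<in> eig_orth a \<omega> \<Longrightarrow> \<psi> = (\<lambda>_. 0)"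
  shows "pure_point_spectrum a \<omega>"
proof -
  define eig where "eig \<zeta> e \<longleftrightarrow> e \<in> l2 \<and> l2norm e = 1 \<and> jac a \<omega> e = (\<lambda>n. \<zeta> * e n)" for \<zeta> :: complex and e
  define E where "E = {\<zeta>. \<exists>e. eig \<zeta> e}"
  define b where "b \<zeta> = (SOME e. eig \<zeta> e)" for \<zeta>
  have b: "eig \<zeta> (b \<zeta>)" if "\<zeta> \<in> E" for \<zeta> using that unfolding E_def b_def mem_Collect_eq by (rule someI_ex)
  show ?thesis
    unfolding pure_point_spectrum_def
  proof (intro exI[of _ "b ` E"] conjI ballI impI)
    show "b ` E \<subseteq> l2" using b by (auto simp: eig_def)
    show "l2norm \<phi> = 1" if "\<phi> \<in> b ` E" for \<phi> using that b by (auto simp: eig_def)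
    show "\<exists>z. jac a \<omega> \<phi> = (\<lambda>n. z * \<phi> n)" if "\<phi> \<in> b ` E" for \<phi> using that b by (auto simp: eig_def)
    show "l2inner \<phi> \<psi> = 0" if pp: "\<phi> \<in> b ` E" "\<psi> \<in> b ` E" "\<phi> \<noteq> \<psi>" for \<phi> \<psi>
    proof -
      obtain \<zeta> \<xi> where "\<zeta> \<in> E" "\<xi> \<in> E" "\<phi> = b \<zeta>" "\<psi> = b \<xi>" "\<zeta> \<noteq> \<xi>" using pp by auto
      then show ?thesis using eigenvectors_orth[where a=a and B=B and \<omega>=\<omega> and x="b \<zeta>" and y="b \<xi>" and \<zeta>=\<zeta> and \<xi>=\<xi>, OF a] b[of \<zeta>] b[of \<xi>] by (auto simp: eig_def)
    qed
    fix \<psi> assume \<psi>: "\<psi> \<in> l2" and orth: "\<forall>\<phi>\<in>b ` E. l2inner \<phi> \<psi> = 0"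
    have "l2inner e \<psi> = 0" if e: "e \<in> l2" "jac a \<omega> e = (\<lambda>n. \<zeta> * e n)" for e \<zeta>
    proof (cases "e = (\<lambda>_. 0)")
      case True
      then show ?thesis by (simp add: l2inner_def)
    next
      case False
      then have ne: "l2norm e \<noteq> 0" using l2norm_eq_0D[OF e(1)] by blast
      define k :: complex where "k = of_real (1 / l2norm e)"
      let ?e = "\<lambda>n. k * e n"
      have "jac a \<omega> ?e = (\<lambda>n. \<zeta> * ?e n)" by (simp add: fun_eq_iff jac_scale e(2))
      moreover have "cmod k * l2norm e = 1" using ne by (simp add: k_def norm_divide)
      ultimately have "eig \<zeta> ?e" using l2_scale[OF e(1)] by (simp add: eig_def l2norm_scale)
      then have \<zeta>: "\<zeta> \<in> E" by (auto simp: E_def)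
      have "b \<zeta> \<noteq> (\<lambda>_. 0)" using b[OF \<zeta>] by (auto simp: eig_def l2norm_def)
      then obtain c where "e = (\<lambda>n. c * b \<zeta> n)"
        using eigenvalue_simple[OF a a0 e] b[OF \<zeta>] unfolding eig_def by blast
      then have "l2inner e \<psi> = cnj c * l2inner (b \<zeta>) \<psi>" by (simp only: l2inner_scale_left)
      then show ?thesis using orth \<zeta> by simp
    qed
    then have "\<psi> \<in> eig_orth a \<omega>" using \<psi> by (auto simp: eig_orth_def)
    then show "\<psi> = (\<lambda>_. 0)" by (rule triv)
  qed
qed

section \<open>Measurability and the almost sure bound\<close>

lemma sets_mu: "sets (mu r d c) = sets (PiM UNIV (\<lambda>_. borel))"
  unfolding mu_def by (intro sets_PiM_cong) auto

lemma l2norm_kdelta: "l2norm (kdelta n) = 1"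
proof -
  have "complex_of_real ((l2norm (kdelta n))\<^sup>2) = of_real 1"
    using l2inner_self[OF kdelta_l2, of n] l2inner_kdelta[of n "kdelta n"] by (simp add: kdelta_def)
  then have "(l2norm (kdelta n))\<^sup>2 = 1" by (simp only: of_real_eq_iff)
  then show ?thesis using l2norm_nonneg[of "kdelta n"] by (simp add: power2_eq_1_iff)
qed

lemma propagator_norm_le_1:
  assumes a: "\<And>n. \<bar>a n\<bar> \<le> B"
  shows "cmod (propagator a \<omega> n t m) \<le> 1"
proof -
  have "l2norm (propagator a \<omega> n t) = l2norm (kdelta n)"
    unfolding propagator_0[where a=a and B=B and \<omega>=\<omega> and n=n, OF a, symmetric]
    by (rule coord_sol_norm_const[OF a propagator_coord_sol[OF a]])
  also have "\<dots> = 1" by (rule l2norm_kdelta)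
  finally show ?thesis using l2_coord_le[OF propagator_l2[where a=a and B=B and \<omega>=\<omega> and n=n and t=t, OF a], of m] by simp
qed

text \<open>A supremum over countably many times is measurable in the potential, which is not
  evident for the one over all real times; by continuity in time it still bounds the propagator
  everywhere.\<close>

definition rat_sup :: "(int \<Rightarrow> real) \<Rightarrow> int \<Rightarrow> int \<Rightarrow> (int \<Rightarrow> real) \<Rightarrow> ennreal" where
  "rat_sup a n m \<omega> = (SUP t\<in>\<rat>. ennreal (cmod (propagator a \<omega> n t m)))"

lemma rat_sup_measurable: "rat_sup a n m \<in> borel_measurable (PiM UNIV (\<lambda>_. borel))"
  unfolding rat_sup_def[abs_def]
  by (intro borel_measurable_SUP countable_rat measurable_compose[OF _ measurable_ennreal]
        measurable_compose[OF propagator_measurable borel_measurable_norm])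

lemma rat_sup_le_1:
  assumes a: "\<And>n. \<bar>a n\<bar> \<le> B"
  shows "rat_sup a n m \<omega> \<le> 1"
  unfolding rat_sup_def
  by (intro SUP_least) (use propagator_norm_le_1[where a=a and B=B, OF a] in \<open>auto simp: ennreal_le_1\<close>)

lemma propagator_le_rat_sup:
  assumes a: "\<And>n. \<bar>a n\<bar> \<le> B"
  shows "cmod (propagator a \<omega> n t m) \<le> enn2real (rat_sup a n m \<omega>)"
proof -
  let ?C = "{t. cmod (propagator a \<omega> n t m) \<le> enn2real (rat_sup a n m \<omega>)}"
  have fin: "rat_sup a n m \<omega> < top"
    by (rule le_less_trans[OF rat_sup_le_1[where a=a and B=B, OF a]]) simp
  have "\<rat> \<subseteq> ?C"
  proof
    fix t :: real assume "t \<in> \<rat>"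
    then have "ennreal (cmod (propagator a \<omega> n t m)) \<le> rat_sup a n m \<omega>"
      unfolding rat_sup_def by (rule SUP_upper)
    then have "enn2real (ennreal (cmod (propagator a \<omega> n t m))) \<le> enn2real (rat_sup a n m \<omega>)"
      using fin by (rule enn2real_mono)
    then show "t \<in> ?C" by simp
  qed
  moreover have "closed ?C"
  proof (rule closed_Collect_le)
    show "continuous_on UNIV (\<lambda>t. cmod (propagator a \<omega> n t m))"
      by (intro continuous_on_norm continuous_at_imp_continuous_on ballI
            coord_sol_isCont[OF propagator_coord_sol[where a=a and B=B, OF a]])
  qed simp
  ultimately have "closure \<rat> \<subseteq> ?C" by (rule closure_minimal)
  then show ?thesis unfolding Rats_closure_real by auto
qed

text \<open>Monotonicity of the nonnegative integral asks for no measurability of the integrand in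
  \<open>amp\<close>, so a pointwise comparison of suprema is enough.\<close>

lemma rat_sup_integral_le:
  assumes a: "\<And>n. \<bar>a n\<bar> \<le> B"
  shows "(\<integral>\<^sup>+ \<omega>. rat_sup a n m \<omega> \<partial>mu r d c) \<le> amp r d c a m n"
  unfolding amp_def
proof (rule nn_integral_mono)
  fix \<omega>
  show "rat_sup a n m \<omega> \<le> (SUP t. ennreal (cmod (l2inner (kdelta m) (evol a \<omega> (kdelta n) t))))"
    unfolding rat_sup_def l2inner_kdelta evol_kdelta[OF a] by (rule SUP_subset_mono) auto
qed

lemma summable_on_int:
  fixes g :: "int \<Rightarrow> real"
  assumes g0: "\<And>m. g m \<ge> 0" and s: "summable (\<lambda>k::nat. g (int (Suc k)) + g (- int (Suc k)))"
  shows "g summable_on UNIV"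
proof -
  have 1: "(\<lambda>k. g (f k)) summable_on UNIV"
    if "\<And>k. g (f k) \<le> g (int (Suc k)) + g (- int (Suc k))" for f :: "nat \<Rightarrow> int"
    by (rule summable_nonneg_imp_summable_on[OF summable_comparison_test'[OF s]]) (use that g0 in auto)
  have 2: "g summable_on range f" if "\<And>k. g (f k) \<le> g (int (Suc k)) + g (- int (Suc k))" "inj f" for f :: "nat \<Rightarrow> int"
    using 1[OF that(1)] by (subst summable_on_reindex[OF that(2)]) (simp add: o_def)
  have "g summable_on ({0} \<union> (range (\<lambda>k. int (Suc k)) \<union> range (\<lambda>k. - int (Suc k))))"
    by (intro summable_on_union 2) (auto simp: inj_def g0)
  moreover have "m \<in> {0} \<union> (range (\<lambda>k. int (Suc k)) \<union> range (\<lambda>k. - int (Suc k)))" for m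
  proof -
    consider "m = 0" | "m > 0" | "m < 0" by linarith
    then show ?thesis
    proof cases
      case 2 then have "m = int (Suc (nat (m - 1)))" by simp
      then show ?thesis by blast
    next
      case 3 then have "m = - int (Suc (nat (- m - 1)))" by simp
      then show ?thesis by blast
    qed simp
  qed
  then have "{0} \<union> (range (\<lambda>k. int (Suc k)) \<union> range (\<lambda>k. - int (Suc k))) = UNIV" by blast
  ultimately show ?thesis by simp
qed

theorem theorem2p6:
  fixes r :: "real \<Rightarrow> real" and d c a :: "int \<Rightarrow> real" and \<delta> :: real
  assumes r_nonneg: "\<And>x. r x \<ge> 0"
    and r_meas: "r \<in> borel_measurable lborel"
    and r_bdd: "\<exists>M. \<forall>x. r x \<le> M"
    and r_supp: "\<exists>R. \<forall>x. \<bar>x\<bar> > R \<longrightarrow> r x = 0"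
    and r_int: "(\<integral>x. r x \<partial>lborel) = 1"
    and d_pos: "\<And>n. d n > 0"
    and c_bdd: "\<exists>B. \<forall>n. \<bar>c n\<bar> \<le> B"
    and a_bdd: "\<exists>B. \<forall>n. \<bar>a n\<bar> \<le> B"
    and \<delta>_pos: "\<delta> > 0"
    and a_ge: "\<And>n. a n \<ge> \<delta>"
    and decay: "\<exists>C \<tau>. C > 0 \<and> \<tau> > 3/2 \<and>
       (\<forall>m::int. m \<noteq> 0 \<longrightarrow>
          max (amp r d c a m 0) (amp r d c a m 1) \<le> ennreal (C * \<bar>real_of_int m\<bar> powr (-\<tau>)))"
  shows "AE \<omega> in mu r d c. pure_point_spectrum a \<omega>"
proof -
  obtain B where a: "\<And>n. \<bar>a n\<bar> \<le> B" using a_bdd by blast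
  have a0: "a n \<noteq> 0" for n using a_ge[of n] \<delta>_pos by linarith
  obtain C \<tau> where C: "C > 0" and \<tau>: "\<tau> > 3/2"
    and amp: "\<And>m. m \<noteq> 0 \<Longrightarrow> max (amp r d c a m 0) (amp r d c a m 1) \<le> ennreal (C * \<bar>real_of_int m\<bar> powr (-\<tau>))"
    using decay by blast
  let ?M = "mu r d c"
  have meas[measurable]: "rat_sup a n m \<in> borel_measurable ?M" for n m
    using rat_sup_measurable measurable_cong_sets[OF sets_mu refl] by blast
  have int: "(\<integral>\<^sup>+ \<omega>. rat_sup a n m \<omega> \<partial>?M) \<le> ennreal (C * \<bar>real_of_int m\<bar> powr (-\<tau>))"
    if "n = 0 \<or> n = 1" "m \<noteq> 0" for n m
    using order_trans[OF rat_sup_integral_le[where a=a and B=B and n=n and m=m and r=r and d=d and c=c, OF a]] amp[OF that(2)] that(1) by auto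
  define X where "X k \<omega> = (rat_sup a 0 (int (Suc k)) \<omega> + rat_sup a 1 (int (Suc k)) \<omega>)
     + (rat_sup a 0 (- int (Suc k)) \<omega> + rat_sup a 1 (- int (Suc k)) \<omega>)" for k \<omega>
  \<comment> \<open>The factor 4 counts two starting sites and two signs of the target site.\<close>
  define p where "p k = 4 * (C * real (Suc k) powr (-\<tau>))" for k
  have ps: "summable p"
  proof -
    have "summable (\<lambda>k. real k powr (-\<tau>))" using \<tau> by (simp add: summable_real_powr_iff)
    then have "summable (\<lambda>k. real (Suc k) powr (-\<tau>))" by (subst summable_Suc_iff)
    then show ?thesis unfolding p_def by (intro summable_mult)
  qed
  have p0: "p k \<ge> 0" for k using C by (simp add: p_def)
  have Xint: "(\<integral>\<^sup>+ \<omega>. X k \<omega> \<partial>?M) \<le> ennreal (p k)" for k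
  proof -
    let ?q = "ennreal (C * real (Suc k) powr (-\<tau>))"
    have q: "(\<integral>\<^sup>+ \<omega>. rat_sup a n m \<omega> \<partial>?M) \<le> ?q" if "n = 0 \<or> n = 1" "m = int (Suc k) \<or> m = - int (Suc k)" for n m
    proof -
      have "m \<noteq> 0" "\<bar>real_of_int m\<bar> = real (Suc k)" using that(2) by auto
      then show ?thesis using int[OF that(1), of m] by simp
    qed
    have "(\<integral>\<^sup>+ \<omega>. X k \<omega> \<partial>?M) = ((\<integral>\<^sup>+ \<omega>. rat_sup a 0 (int (Suc k)) \<omega> \<partial>?M) + (\<integral>\<^sup>+ \<omega>. rat_sup a 1 (int (Suc k)) \<omega> \<partial>?M))
       + ((\<integral>\<^sup>+ \<omega>. rat_sup a 0 (- int (Suc k)) \<omega> \<partial>?M) + (\<integral>\<^sup>+ \<omega>. rat_sup a 1 (- int (Suc k)) \<omega> \<partial>?M))"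
      unfolding X_def by (simp only: nn_integral_add meas borel_measurable_add)
    also have "\<dots> \<le> (?q + ?q) + (?q + ?q)" by (intro add_mono q) auto
    also have "\<dots> = ennreal (p k)" using C by (simp add: p_def flip: ennreal_plus)
    finally show ?thesis .
  qed
  have Xm[measurable]: "X k \<in> borel_measurable ?M" for k unfolding X_def[abs_def] by measurable
  have "(\<integral>\<^sup>+ \<omega>. (\<Sum>k. X k \<omega>) \<partial>?M) = (\<Sum>k. \<integral>\<^sup>+ \<omega>. X k \<omega> \<partial>?M)" by (rule nn_integral_suminf[OF Xm])
  also have "\<dots> \<le> (\<Sum>k. ennreal (p k))" by (intro suminf_le Xint) auto
  also have "\<dots> = ennreal (suminf p)" by (rule suminf_ennreal2[OF p0 ps])
  also have "\<dots> < \<infinity>" by simp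
  finally have "AE \<omega> in ?M. (\<Sum>k. X k \<omega>) \<noteq> \<infinity>"
    by (intro nn_integral_PInf_AE) auto
  then show ?thesis
  proof eventually_elim
    case (elim \<omega>)
    define g where "g m = enn2real (rat_sup a 0 m \<omega>) + enn2real (rat_sup a 1 m \<omega>)" for m
    have e: "ennreal (enn2real (rat_sup a n m \<omega>)) = rat_sup a n m \<omega>" for n m
      using le_less_trans[OF rat_sup_le_1[where a=a and B=B and n=n and m=m and \<omega>=\<omega>, OF a]] by (intro ennreal_enn2real) simp
    have X: "X k \<omega> = ennreal (g (int (Suc k)) + g (- int (Suc k)))" for k
      unfolding X_def g_def by (simp add: ennreal_plus e)
    have "summable (\<lambda>k. g (int (Suc k)) + g (- int (Suc k)))"
      by (rule summable_suminf_not_top) (use elim in \<open>auto simp: X g_def simp flip: infinity_ennreal_def\<close>)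
    \<comment> \<open>The decay hypothesis says nothing at site 0, but that site contributes just
      one finite term.\<close>
    then have gs: "g summable_on UNIV" by (intro summable_on_int) (auto simp: g_def)
    have dom: "cmod (propagator a \<omega> 0 t m) \<le> g m" "cmod (propagator a \<omega> 1 t m) \<le> g m" for t m
      using propagator_le_rat_sup[where a=a and B=B and \<omega>=\<omega> and n=0 and t=t and m=m, OF a]
        propagator_le_rat_sup[where a=a and B=B and \<omega>=\<omega> and n=1 and t=t and m=m, OF a]
        enn2real_nonneg[of "rat_sup a 0 m \<omega>"] enn2real_nonneg[of "rat_sup a 1 m \<omega>"]
      unfolding g_def by linarith+
    show ?case
      by (rule pure_point_spectrumI[OF a a0 eig_orth_trivial[OF a a0 gs dom]])
  qed
qed

end
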